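(* Let $h:\mathbb{R}\to(0,\infty)$ be an infinitely differentiable probability density such that every derivative of $\log h$ (of every order) is bounded in absolute value by a polynomial, $h$ has finite moments of all orders, and $h'/h$ is Lipschitz continuous. Let $\ell>0$ be fixed. For each integer $d\ge 1$ let $\pi_d(\mathbf{x})=\prod_{i=1}^d h(x_i)$ on $\mathbb{R}^d$, and let $Z^{(d)}=\{Z^{(d)}_n\}_{n=0}^\infty$ be the Metropolis-Adjusted Langevin Algorithm on $\mathbb{R}^d$ with target density $\pi_d$ and proposal variance $\sigma_d^2=\ell^2 d^{-1/3}$. Then for every $\epsilon>0$ there are $D<\infty$ and $T<\infty$ such that $$\mathbf{E}_{Z^{(d)}_0\sim\pi_d}\,\bigl\|\mathcal{L}_{Z^{(d)}_0}\bigl(Z^{(d)}_{\lfloor d^{1/3}t\rfloor,1}\bigr)-h\bigr\|_{KR}<\epsilon\qquad\text{for all } t\ge T\text{ and all } d\ge D.$$ Hence the MALA algorithm takes $O(d^{1/3})$ iterations to converge to within $\epsilon$ of stationarity in any one coordinate (in this averaged $KR$ distance): for every $\epsilon>0$ there are $D,T<\infty$ such that for all $d\ge D$ and all integers $n\ge d^{1/3}T$, and for each coordinate $i\in\{1,\dots,d\}$, $\mathbf{E}_{Z^{(d)}_0\sim\pi_d}\|\mathcal{L}_{Z^{(d)}_0}(Z^{(d)}_{n,i})-h\|_{KR}<\epsilon$.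
   Context: Metropolis-Adjusted Langevin Algorithm (MALA) with target density $\pi_d$: a Markov chain on $\mathbb{R}^d$ which, given $Z^{(d)}_n=z$, draws a proposal $Y^{(d)}_{n+1}\sim N\bigl(z+\tfrac12\sigma_d^2\nabla\log\pi_d(z),\ \sigma_d^2 I_d\bigr)$, whose density at $y$ is denoted $q_d(z,y)$; with probability $\min\bigl[1,\ \tfrac{\pi_d(y)\,q_d(y,z)}{\pi_d(z)\,q_d(z,y)}\bigr]$, where $y=Y^{(d)}_{n+1}$, it sets $Z^{(d)}_{n+1}=y$, and otherwise $Z^{(d)}_{n+1}=z$. The chain has stationary density $\pi_d$. $Z^{(d)}_{n,i}$ is the $i$-th coordinate of $Z^{(d)}_n$. $\mathcal{L}_z(Z^{(d)}_{n,i})$ is the law of $Z^{(d)}_{n,i}$ conditional on $Z^{(d)}_0=z$. In the $KR$ distance, $h$ stands for the probability measure $h(x)\,dx$ on $\mathbb{R}$. For a signed measure $\mu$ on $\mathbb{R}$ (with the usual metric), $\|\mu\|_{KR}=\sup_f\int f\,d\mu$, the supremum being over all $f:\mathbb{R}\to\mathbb{R}$ with $|f(x)-f(y)|\le|x-y|$ for all $x,y$ and $|f|\le 1$. $\mathbf{E}_{Z^{(d)}_0\sim\pi_d}$ denotes the average over starting states $z$ distributed according to the probability density $\pi_d$, i.e. $\int_{\mathbb{R}^d}\pi_d(z)\,\|\mathcal{L}_z(Z^{(d)}_{n,i})-h\|_{KR}\,dz$. *)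

theory Defs
  imports "HOL-Probability.Probability"
begin

section \<open>The Metropolis-adjusted Langevin algorithm\<close>

text \<open>
  Points of $R^d$ are the extensional functions on \<open>{1..d}\<close>, i.e. the elements of
  \<open>space (lebesgue_prod d)\<close>. The dimension is a value, since the result
  quantifies over it.
\<close>

definition lebesgue_prod :: "nat \<Rightarrow> (nat \<Rightarrow> real) measure" where
  "lebesgue_prod d = (\<Pi>\<^sub>M i\<in>{1..d}. lborel)"

definition grad_log :: "((nat \<Rightarrow> real) \<Rightarrow> real) \<Rightarrow> (nat \<Rightarrow> real) \<Rightarrow> nat \<Rightarrow> real" where
  "grad_log p z i = deriv (\<lambda>u. ln (p (z(i := u)))) (z i)"

text \<open>
  Below, \<open>v\<close> is the proposal variance, whereas \<^const>\<open>normal_density\<close> takes the standard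
  deviation. The covariance matrix is \<open>v\<close> times the identity, so the density is a product.
\<close>

definition mala_proposal_density ::
    "nat \<Rightarrow> real \<Rightarrow> ((nat \<Rightarrow> real) \<Rightarrow> real) \<Rightarrow> (nat \<Rightarrow> real) \<Rightarrow> (nat \<Rightarrow> real) \<Rightarrow> real" where
  "mala_proposal_density d v p z y =
     (\<Prod>i\<in>{1..d}. normal_density (z i + v / 2 * grad_log p z i) (sqrt v) (y i))"

definition mala_accept ::
    "nat \<Rightarrow> real \<Rightarrow> ((nat \<Rightarrow> real) \<Rightarrow> real) \<Rightarrow> (nat \<Rightarrow> real) \<Rightarrow> (nat \<Rightarrow> real) \<Rightarrow> real" where
  "mala_accept d v p z y =
     min 1 ((p y * mala_proposal_density d v p y z) / (p z * mala_proposal_density d v p z y))"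

definition mala_kernel ::
    "nat \<Rightarrow> real \<Rightarrow> ((nat \<Rightarrow> real) \<Rightarrow> real) \<Rightarrow> (nat \<Rightarrow> real) \<Rightarrow> (nat \<Rightarrow> real) measure" where
  "mala_kernel d v p z =
     density (lebesgue_prod d) (\<lambda>y. ennreal (mala_proposal_density d v p z y)) \<bind>
       (\<lambda>y. measure_pmf (bernoulli_pmf (mala_accept d v p z y)) \<bind>
         (\<lambda>b. return (lebesgue_prod d) (if b then y else z)))"

text \<open>The law, on $R^d$, of the \<open>n\<close>-th state of the chain started at \<open>z\<close>.\<close>

primrec mala_law ::
    "nat \<Rightarrow> real \<Rightarrow> ((nat \<Rightarrow> real) \<Rightarrow> real) \<Rightarrow> (nat \<Rightarrow> real) \<Rightarrow> nat \<Rightarrow> (nat \<Rightarrow> real) measure" where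
  "mala_law d v p z 0 = return (lebesgue_prod d) z"
| "mala_law d v p z (Suc n) = mala_law d v p z n \<bind> mala_kernel d v p"

definition mala_coord_law ::
    "nat \<Rightarrow> real \<Rightarrow> ((nat \<Rightarrow> real) \<Rightarrow> real) \<Rightarrow> (nat \<Rightarrow> real) \<Rightarrow> nat \<Rightarrow> nat \<Rightarrow> real measure" where
  "mala_coord_law d v p z n i = distr (mala_law d v p z n) borel (\<lambda>x. x i)"


section \<open>The Kantorovich-Rubinstein distance\<close>

text \<open>
  \<open>kr_dist M N\<close> is the norm of the signed measure \<open>M - N\<close> for finite measures \<open>M\<close> and \<open>N\<close>;
  the integral against \<open>M - N\<close> is the difference of the two integrals.
\<close>

definition kr_dist :: "real measure \<Rightarrow> real measure \<Rightarrow> real" where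
  "kr_dist M N =
     (SUP f\<in>{f :: real \<Rightarrow> real. (\<forall>x y. \<bar>f x - f y\<bar> \<le> \<bar>x - y\<bar>) \<and> (\<forall>x. \<bar>f x\<bar> \<le> 1)}.
        (\<integral>x. f x \<partial>M) - (\<integral>x. f x \<partial>N))"


section \<open>Product targets\<close>

definition prod_target :: "(real \<Rightarrow> real) \<Rightarrow> nat \<Rightarrow> (nat \<Rightarrow> real) \<Rightarrow> real" where
  "prod_target h d x = (\<Prod>i\<in>{1..d}. h (x i))"

text \<open>
  The average, over starting states distributed according to the product target, of the distance
  between the law of coordinate \<open>i\<close> at time \<open>n\<close> and \<open>h\<close>, for proposal variance
  \<open>l\<^sup>2 d powr (-1/3)\<close>.
  The integrand is nonnegative; the extended nonnegative integral avoids that a value is silently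
  replaced by 0.
\<close>

definition mala_avg_kr :: "(real \<Rightarrow> real) \<Rightarrow> real \<Rightarrow> nat \<Rightarrow> nat \<Rightarrow> nat \<Rightarrow> ennreal" where
  "mala_avg_kr h l d n i =
     (\<integral>\<^sup>+z. ennreal (prod_target h d z) *
        ennreal (kr_dist
          (mala_coord_law d (l\<^sup>2 * real d powr (- (1/3))) (prod_target h d) z n i)
          (density lborel (\<lambda>x. ennreal (h x))))
      \<partial>lebesgue_prod d)"

end

theory Submission
  imports Defs
begin

text \<open>
  The MALA operator \<open>P\<close> is a self-adjoint contraction of \<open>L\<^sup>2(\<pi>\<^sub>d)\<close>. For every \<open>g\<close> the second differences of
  \<open>k \<mapsto> \<parallel>P\<^sup>k g\<parallel>\<^sup>2\<close> are the decreasing numbers \<open>\<parallel>P\<^sup>k (g - P\<^sup>2 g)\<parallel>\<^sup>2\<close>, so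
  \<open>k\<^sup>2 \<parallel>P\<^sup>k (g - P\<^sup>2 g)\<parallel>\<^sup>2 \<le> 2 \<parallel>g\<parallel>\<^sup>2\<close>: no spectral gap is needed. If \<open>P g - g\<close> is close to
  \<open>s\<^sup>2 a f\<close> and \<open>P f\<close> is close to \<open>f\<close>, with \<open>s\<^sup>2 = \<ell>\<^sup>2 d\<^bsup>-1/3\<^esup>\<close> and \<open>a\<close> bounded below, then \<open>P\<^sup>n f\<close> is small
  as soon as \<open>n s\<^sup>2\<close> is large.

  For a mean-zero function \<open>f\<close> of one coordinate, \<open>g\<close> solves \<open>(h g')' = 2 h f\<close>. The factor multiplying \<open>f\<close>
  is then the acceptance probability given by the other coordinates, which concentrates around its mean
  because one coordinate contributes to the log acceptance ratio a term of size \<open>s\<^sup>3\<close> that is, up to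
  \<open>O(s\<^sup>4)\<close>, odd in the Gaussian noise; and reversibility bounds the mean of such a term by its second moment
  \<open>O(s\<^sup>6) = O(1/d)\<close>, which keeps the mean acceptance probability away from zero. Finally the KR distance
  is controlled by the masses of finitely many intervals.
\<close>

section \<open>Decay for reversible operators\<close>

text \<open>Second differences of P^2 rather than of P appear because an accept-reject operator may
  have spectrum near -1. There |P^k (g - P g)| need not decay, whereas r^(2k) (1 - r^2)^2 is
  O(1/k^2) on all of [-1, 1]. The price is that f must be almost invariant under one step: g - P^2 g
  = (g - P g) + P (g - P g) is close to -2 s^2 a f only if P f is close to f.

  The exponent 1/3 comes from two sums over the coordinates. With s^6 of order 1/d, the d mean
  contributions to the log acceptance ratio, each O(s^6), have a bounded sum, and the d squared
  conditional means, each O(s^8) on average, have a vanishing sum. The first keeps the acceptance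
  probability away from 0, the second makes it concentrate.

  The functions f and g depend only on h, on the interval and on the accuracy, never on d; this
  makes all constants uniform in d and in the coordinate.

  Bounded measurable functions stand in for L^2: all inner products exist, and operator identities
  hold at every point instead of almost everywhere. The bound is asked on the space only, because
  points of a product space are extensional functions.\<close>

definition bdd_fun :: "'a measure \<Rightarrow> ('a \<Rightarrow> real) \<Rightarrow> bool" where
  "bdd_fun M f \<longleftrightarrow> f \<in> borel_measurable M \<and> (\<exists>B. \<forall>x\<in>space M. \<bar>f x\<bar> \<le> B)"

lemma bdd_funI: "f \<in> borel_measurable M \<Longrightarrow> (\<And>x. x \<in> space M \<Longrightarrow> \<bar>f x\<bar> \<le> B) \<Longrightarrow> bdd_fun M f"
  by (auto simp: bdd_fun_def)

lemma bdd_fun_measurable: "bdd_fun M f \<Longrightarrow> f \<in> borel_measurable M"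
  by (auto simp: bdd_fun_def)

lemma bdd_fun_mult:
  assumes "bdd_fun M f" "bdd_fun M g" shows "bdd_fun M (\<lambda>x. f x * g x)"
proof -
  obtain A B where A: "\<forall>x\<in>space M. \<bar>f x\<bar> \<le> A" and B: "\<forall>x\<in>space M. \<bar>g x\<bar> \<le> B"
    using assms by (auto simp: bdd_fun_def)
  show ?thesis
  proof (rule bdd_funI)
    show "(\<lambda>x. f x * g x) \<in> borel_measurable M"
      using assms by (auto simp: bdd_fun_def)
    fix x assume "x \<in> space M"
    then show "\<bar>f x * g x\<bar> \<le> A * B"
      using A B by (auto simp: abs_mult intro!: mult_mono order_trans[OF abs_ge_zero])
  qed
qed

lemma bdd_fun_lincomb:
  assumes "bdd_fun M f" "bdd_fun M g" shows "bdd_fun M (\<lambda>x. a * f x + b * g x)"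
proof -
  obtain A B where A: "\<forall>x\<in>space M. \<bar>f x\<bar> \<le> A" and B: "\<forall>x\<in>space M. \<bar>g x\<bar> \<le> B"
    using assms by (auto simp: bdd_fun_def)
  show ?thesis
  proof (rule bdd_funI)
    show "(\<lambda>x. a * f x + b * g x) \<in> borel_measurable M"
      using assms by (auto simp: bdd_fun_def)
    fix x assume "x \<in> space M"
    then have "\<bar>a * f x\<bar> \<le> \<bar>a\<bar> * A" "\<bar>b * g x\<bar> \<le> \<bar>b\<bar> * B"
      using A B by (auto simp: abs_mult intro!: mult_left_mono)
    then show "\<bar>a * f x + b * g x\<bar> \<le> \<bar>a\<bar> * A + \<bar>b\<bar> * B" by linarith
  qed
qed

lemma bdd_fun_const: "bdd_fun M (\<lambda>x. c)"
  by (rule bdd_funI[where B="\<bar>c\<bar>"]) auto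

lemma bdd_fun_add: "bdd_fun M f \<Longrightarrow> bdd_fun M g \<Longrightarrow> bdd_fun M (\<lambda>x. f x + g x)"
  using bdd_fun_lincomb[of M f g 1 1] by simp

lemma bdd_fun_diff: "bdd_fun M f \<Longrightarrow> bdd_fun M g \<Longrightarrow> bdd_fun M (\<lambda>x. f x - g x)"
  using bdd_fun_lincomb[of M f g 1 "-1"] by simp

lemma bdd_fun_cmult: "bdd_fun M f \<Longrightarrow> bdd_fun M (\<lambda>x. c * f x)"
  using bdd_fun_mult[OF bdd_fun_const] .

lemma bdd_fun_power2: "bdd_fun M f \<Longrightarrow> bdd_fun M (\<lambda>x. (f x)\<^sup>2)"
  unfolding power2_eq_square by (rule bdd_fun_mult)

lemma (in finite_measure) bdd_fun_integrable: "bdd_fun M f \<Longrightarrow> integrable M f"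
  unfolding bdd_fun_def by (metis AE_I2 integrable_const_bound real_norm_def)

text \<open>Summation by parts twice: with the linear weights \<open>Suc j\<close> all interior
  terms cancel, so that only boundary terms survive.\<close>

lemma sum_Suc_second_difference:
  fixes b :: "nat \<Rightarrow> real"
  shows "(\<Sum>j<n. real (Suc j) * (b j - 2 * b (Suc j) + b (Suc (Suc j))))
    = b 0 - b n - real n * (b n - b (Suc n))"
  by (induction n) (auto simp: algebra_simps)

text \<open>The transition operator of a reversible chain, reduced to what the decay estimate uses.
  \<open>linear\<close> is an equality of functions, so it can be rewritten under iterates of
  \<open>P\<close>.\<close>

locale reversible_operator = prob_space M for M :: "'a measure" +
  fixes P :: "('a \<Rightarrow> real) \<Rightarrow> 'a \<Rightarrow> real"
  assumes bdd: "bdd_fun M f \<Longrightarrow> bdd_fun M (P f)"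
    and linear: "bdd_fun M f \<Longrightarrow> bdd_fun M g \<Longrightarrow> P (\<lambda>x. a * f x + b * g x) = (\<lambda>x. a * P f x + b * P g x)"
    and contraction: "bdd_fun M f \<Longrightarrow> (\<integral>x. (P f x)\<^sup>2 \<partial>M) \<le> (\<integral>x. (f x)\<^sup>2 \<partial>M)"
    and symmetric: "bdd_fun M f \<Longrightarrow> bdd_fun M g \<Longrightarrow> (\<integral>x. f x * P g x \<partial>M) = (\<integral>x. P f x * g x \<partial>M)"
begin

abbreviation sqn :: "('a \<Rightarrow> real) \<Rightarrow> real" where "sqn f \<equiv> \<integral>x. (f x)\<^sup>2 \<partial>M"

lemma bdd_pow: "bdd_fun M f \<Longrightarrow> bdd_fun M ((P ^^ k) f)"
  by (induction k) (auto intro: bdd)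

lemma linear_pow: "bdd_fun M f \<Longrightarrow> bdd_fun M g \<Longrightarrow>
    (P ^^ k) (\<lambda>x. a * f x + b * g x) = (\<lambda>x. a * (P ^^ k) f x + b * (P ^^ k) g x)"
  by (induction k) (auto simp: linear bdd_pow)

lemma contraction_pow: "bdd_fun M f \<Longrightarrow> sqn ((P ^^ k) f) \<le> sqn f"
  by (induction k) (auto intro: order_trans contraction bdd_pow)

lemma sqn_add_le:
  assumes "bdd_fun M f" "bdd_fun M g"
  shows "sqn (\<lambda>x. f x + g x) \<le> 2 * sqn f + 2 * sqn g"
proof -
  have "sqn (\<lambda>x. f x + g x) \<le> (\<integral>x. 2 * (f x)\<^sup>2 + 2 * (g x)\<^sup>2 \<partial>M)"
    using assms
    by (intro integral_mono bdd_fun_integrable bdd_fun_power2 bdd_fun_add bdd_fun_cmult)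
       (auto simp: power2_sum intro: order_trans[OF sum_squares_bound])
  also have "\<dots> = 2 * sqn f + 2 * sqn g"
    using assms by (subst Bochner_Integration.integral_add)
      (auto intro!: bdd_fun_integrable bdd_fun_power2 bdd_fun_cmult)
  finally show ?thesis .
qed

lemma sqn_cmult: "sqn (\<lambda>x. c * f x) = c\<^sup>2 * sqn f"
  by (simp add: power_mult_distrib)

text \<open>Symmetry moves one \<open>P\<close> across the inner product, which turns the cross term
  of P^k g and P^(k+2) g into the squared norm of P^(k+1) g.\<close>

lemma sqn_pow_second_difference:
  assumes g: "bdd_fun M g"
  shows "sqn ((P ^^ k) (\<lambda>x. g x - P (P g) x))
    = sqn ((P ^^ k) g) - 2 * sqn ((P ^^ Suc k) g) + sqn ((P ^^ Suc (Suc k)) g)"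
proof -
  let ?u = "(P ^^ k) g"
  note b = bdd_pow[OF g, of k] bdd_pow[OF g, of "Suc k"] bdd_pow[OF g, of "Suc (Suc k)"]
  have PP: "P (P g) = (P ^^ 2) g" by (simp add: numeral_2_eq_2)
  have "(P ^^ k) (\<lambda>x. 1 * g x + (-1) * P (P g) x) = (\<lambda>x. 1 * ?u x + (-1) * (P ^^ k) (P (P g)) x)"
    by (rule linear_pow[OF g]) (simp add: g bdd)
  moreover have "(P ^^ k) (P (P g)) = (P ^^ Suc (Suc k)) g"
    by (simp add: funpow_swap1)
  ultimately have eq: "(P ^^ k) (\<lambda>x. g x - P (P g) x) = (\<lambda>x. ?u x - (P ^^ Suc (Suc k)) g x)"
    by simp
  have sym: "(\<integral>x. ?u x * (P ^^ Suc (Suc k)) g x \<partial>M) = sqn ((P ^^ Suc k) g)"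
    using symmetric[OF b(1) b(2)] by (simp add: power2_eq_square)
  have "sqn (\<lambda>x. ?u x - (P ^^ Suc (Suc k)) g x)
      = (\<integral>x. ((?u x)\<^sup>2 - 2 * (?u x * (P ^^ Suc (Suc k)) g x)) + ((P ^^ Suc (Suc k)) g x)\<^sup>2 \<partial>M)"
    by (rule Bochner_Integration.integral_cong) (auto simp: power2_diff)
  also have "\<dots> = sqn ?u - 2 * (\<integral>x. ?u x * (P ^^ Suc (Suc k)) g x \<partial>M) + sqn ((P ^^ Suc (Suc k)) g)"
    using b by (subst Bochner_Integration.integral_add Bochner_Integration.integral_diff;
      (intro bdd_fun_integrable bdd_fun_power2 bdd_fun_cmult bdd_fun_mult bdd_fun_diff)?; simp)+
  finally show ?thesis unfolding eq sym .
qed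

text \<open>The second differences \<open>c\<close> of \<open>b\<close> decrease because they are
  squared norms of iterates of one vector under a contraction. Hence \<open>c k\<close> is below
  every earlier \<open>c j\<close>, and the weighted sum of these is at most \<open>b 0\<close> by
  summation by parts.\<close>

lemma sqn_pow_decay:
  assumes g: "bdd_fun M g"
  shows "(real k)\<^sup>2 * sqn ((P ^^ k) (\<lambda>x. g x - P (P g) x)) \<le> 2 * sqn g"
proof -
  let ?e = "\<lambda>x. g x - P (P g) x"
  define b where "b j = sqn ((P ^^ j) g)" for j
  define c where "c j = sqn ((P ^^ j) ?e)" for j
  have e: "bdd_fun M ?e" using g by (intro bdd_fun_diff bdd)
  have c_b: "c j = b j - 2 * b (Suc j) + b (Suc (Suc j))" for j
    unfolding b_def c_def by (rule sqn_pow_second_difference[OF g])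
  have c_mono: "c (Suc j) \<le> c j" for j
    unfolding c_def using contraction[OF bdd_pow[OF e]] by simp
  have c_le: "c k \<le> c j" if "j \<le> k" for j
    using that by (rule lift_Suc_antimono_le[of c, OF c_mono])
  have b_mono: "b (Suc j) \<le> b j" for j
    unfolding b_def using contraction[OF bdd_pow[OF g]] by simp
  have b0: "b j \<ge> 0" "c j \<ge> 0" for j
    unfolding b_def c_def by simp_all
  \<comment> \<open>The weights add up to k (k + 1) / 2.\<close>
  have "(real k)\<^sup>2 / 2 * c k \<le> (\<Sum>j<k. real (Suc j)) * c k"
    by (rule mult_right_mono[OF _ b0(2)]) (induction k, auto simp: power2_eq_square field_simps)
  also have "\<dots> = (\<Sum>j<k. real (Suc j) * c k)"
    by (simp add: sum_distrib_right)
  also have "\<dots> \<le> (\<Sum>j<k. real (Suc j) * c j)"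
    by (intro sum_mono mult_left_mono c_le) auto
  also have "\<dots> = b 0 - b k - real k * (b k - b (Suc k))"
    unfolding c_b by (rule sum_Suc_second_difference)
  also have "\<dots> \<le> b 0"
    using b0(1)[of k] b_mono[of k] mult_nonneg_nonneg[of "real k" "b k - b (Suc k)"] by linarith
  finally show ?thesis by (simp add: b_def c_def)
qed

text \<open>Solving for f gives 2 s a f = - (g - P (P g)) - e. The first part decays by
  \<open>sqn_pow_decay\<close>; the error e is merely contracted and so must be small from the
  start. Here \<open>s\<close> is a time step, instantiated later with the proposal
  variance.\<close>

lemma sqn_pow_le_of_approx_generator:
  assumes f: "bdd_fun M f" and g: "bdd_fun M g"
    and s: "s > 0" and c0: "0 < c0" "c0 \<le> a" and k: "k > 0"
    and r: "sqn (\<lambda>x. P g x - g x - s * a * f x) \<le> s\<^sup>2 * \<epsilon>1"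
    and Pf: "sqn (\<lambda>x. P f x - f x) \<le> \<epsilon>2"
  shows "sqn ((P ^^ k) f) \<le> sqn g / (s * c0 * real k)\<^sup>2 + 4 * \<epsilon>1 / c0\<^sup>2 + \<epsilon>2"
proof -
  define r where "r = (\<lambda>x. P g x - g x - s * a * f x)"
  \<comment> \<open>\<open>r x + P r x\<close> is the generator error doubled in the same way as g -
    P (P g) = (g - P g) + P (g - P g); the last term trades the resulting P f for f.\<close>
  define e where "e = (\<lambda>x. (r x + P r x) + (s * a) * (P f x - f x))"
  let ?d = "\<lambda>x. g x - P (P g) x"
  have rr: "sqn r \<le> s\<^sup>2 * \<epsilon>1" using r by (simp add: r_def)
  have bPg: "bdd_fun M (P g)" and bPf: "bdd_fun M (P f)" and bd: "bdd_fun M ?d"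
    using f g by (auto intro: bdd bdd_fun_diff)
  have br: "bdd_fun M r" unfolding r_def using f g bPg by (intro bdd_fun_diff bdd_fun_cmult)
  have be: "bdd_fun M e" unfolding e_def using br f bPf by (intro bdd_fun_add bdd_fun_diff bdd_fun_cmult bdd)
  have a: "a > 0" using c0 by simp
  have Pr: "P r x = P (P g) x - P g x - s * a * P f x" for x
  proof -
    have "r = (\<lambda>x. 1 * (1 * P g x + (-1) * g x) + (- s * a) * f x)" by (simp add: r_def algebra_simps fun_eq_iff)
    then have "P r = (\<lambda>x. 1 * P (\<lambda>x. 1 * P g x + (-1) * g x) x + (- s * a) * P f x)"
      using linear[of "\<lambda>x. 1 * P g x + (-1) * g x" f 1 "- s * a"] f g bPg bdd_fun_lincomb by metis
    then show ?thesis using linear[OF bPg g, of 1 "-1"] by simp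
  qed
  have f_eq: "f = (\<lambda>x. (-1 / (2 * s * a)) * ?d x + (-1 / (2 * s * a)) * e x)"
    unfolding e_def Pr using s a by (simp add: r_def fun_eq_iff field_simps)
  have "(P ^^ k) f = (\<lambda>x. (-1 / (2 * s * a)) * (P ^^ k) ?d x + (-1 / (2 * s * a)) * (P ^^ k) e x)"
    by (subst f_eq) (rule linear_pow[OF bd be])
  then have "sqn ((P ^^ k) f) = sqn (\<lambda>x. (-1 / (2 * s * a)) * ((P ^^ k) ?d x + (P ^^ k) e x))"
    by (simp add: algebra_simps)
  also have "\<dots> = 1 / (4 * s\<^sup>2 * a\<^sup>2) * sqn (\<lambda>x. (P ^^ k) ?d x + (P ^^ k) e x)"
    by (subst sqn_cmult) (simp add: power2_eq_square)
  also have "\<dots> \<le> 1 / (4 * s\<^sup>2 * a\<^sup>2) * (2 * sqn ((P ^^ k) ?d) + 2 * sqn ((P ^^ k) e))"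
    by (intro mult_left_mono sqn_add_le bdd_pow bd be) auto
  also have "\<dots> \<le> 1 / (4 * s\<^sup>2 * a\<^sup>2) * (2 * (2 * sqn g / (real k)\<^sup>2) + 2 * (8 * s\<^sup>2 * \<epsilon>1 + 2 * s\<^sup>2 * a\<^sup>2 * \<epsilon>2))"
  proof (intro mult_left_mono add_mono)
    show "sqn ((P ^^ k) ?d) \<le> 2 * sqn g / (real k)\<^sup>2"
      using sqn_pow_decay[OF g, of k] k by (simp add: field_simps)
    have "sqn ((P ^^ k) e) \<le> sqn e" by (rule contraction_pow[OF be])
    also have "\<dots> \<le> 2 * sqn (\<lambda>x. r x + P r x) + 2 * sqn (\<lambda>x. (s * a) * (P f x - f x))"
      unfolding e_def using br f bPf by (intro sqn_add_le bdd_fun_add bdd_fun_cmult bdd_fun_diff bdd)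
    also have "\<dots> \<le> 2 * (2 * sqn r + 2 * sqn (P r)) + 2 * ((s * a)\<^sup>2 * \<epsilon>2)"
      unfolding sqn_cmult using br Pf by (intro add_mono mult_left_mono sqn_add_le bdd) auto
    also have "\<dots> \<le> 2 * (2 * (s\<^sup>2 * \<epsilon>1) + 2 * (s\<^sup>2 * \<epsilon>1)) + 2 * ((s * a)\<^sup>2 * \<epsilon>2)"
      using rr order_trans[OF contraction[OF br] rr] by (intro add_mono mult_left_mono) auto
    finally show "sqn ((P ^^ k) e) \<le> 8 * s\<^sup>2 * \<epsilon>1 + 2 * s\<^sup>2 * a\<^sup>2 * \<epsilon>2"
      by (simp add: power_mult_distrib algebra_simps)
  qed auto
  also have "\<dots> = sqn g / (s * a * real k)\<^sup>2 + 4 * \<epsilon>1 / a\<^sup>2 + \<epsilon>2"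
    using s a k by (simp add: field_simps power2_eq_square)
  also have "\<dots> \<le> sqn g / (s * c0 * real k)\<^sup>2 + 4 * \<epsilon>1 / c0\<^sup>2 + \<epsilon>2"
  proof (intro add_mono divide_left_mono power_mono mult_mono order_refl)
    \<comment> \<open>The sign of \<epsilon>1 is not a hypothesis; it follows because \<epsilon>1
      bounds the integral of a square.\<close>
    have "0 \<le> s\<^sup>2 * \<epsilon>1" using r by (rule order_trans[rotated]) simp
    then show "0 \<le> 4 * \<epsilon>1" using s by (simp add: zero_le_mult_iff)
  qed (use s a c0 k in auto)
  finally show ?thesis .
qed

end

section \<open>Acceptance probabilities of independent sites\<close>

text \<open>The argument is the logarithm of the Metropolis-Hastings ratio. On this scale the
  coordinates of a product target contribute additively.\<close>

definition metropolis_ratio :: "real \<Rightarrow> real" where "metropolis_ratio x = min 1 (exp x)"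

text \<open>The antiderivative of \<^const>\<open>metropolis_ratio\<close> that vanishes at \<open>- \<infinity>\<close>; its difference quotients
  smooth the ratio to class \<open>C\<^sup>1\<^sup>,\<^sup>1\<close>.\<close>

definition metropolis_primitive :: "real \<Rightarrow> real" where
  "metropolis_primitive x = (if x \<le> 0 then exp x else 1 + x)"

definition smoothed_ratio :: "real \<Rightarrow> real \<Rightarrow> real" where
  "smoothed_ratio \<delta> x = (metropolis_primitive (x + \<delta>) - metropolis_primitive x) / \<delta>"

lemma metropolis_ratio_bounds: "0 \<le> metropolis_ratio x" "metropolis_ratio x \<le> 1"
  by (auto simp: metropolis_ratio_def)

lemma metropolis_ratio_abs_le: "\<bar>metropolis_ratio x\<bar> \<le> 1"
  using metropolis_ratio_bounds[of x] by simp

lemma metropolis_ratio_mono: "x \<le> y \<Longrightarrow> metropolis_ratio x \<le> metropolis_ratio y"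
  by (auto simp: metropolis_ratio_def min_def)

lemma metropolis_ratio_nonpos: "x \<le> 0 \<Longrightarrow> metropolis_ratio x = exp x"
  and metropolis_ratio_nonneg: "x \<ge> 0 \<Longrightarrow> metropolis_ratio x = 1"
  by (auto simp: metropolis_ratio_def min_def)

lemma exp_diff_le:
  fixes x y :: real shows "exp y - exp x \<le> exp y * (y - x)"
proof -
  have "exp y * (1 + (x - y)) \<le> exp y * exp (x - y)"
    by (intro mult_left_mono exp_ge_add_one_self) auto
  then show ?thesis by (simp add: exp_diff algebra_simps)
qed

text \<open>The ratio is the increasing derivative of the primitive, so its values at the end points
  bound the increment. The sign cases reduce this to the tangent inequality of the
  exponential.\<close>

lemma metropolis_primitive_diff_aux:
  assumes "x \<le> y"
  shows "metropolis_ratio x * (y - x) \<le> metropolis_primitive y - metropolis_primitive x"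
    and "metropolis_primitive y - metropolis_primitive x \<le> metropolis_ratio y * (y - x)"
proof -
  have 0: "metropolis_ratio x * (y - x) \<le> metropolis_primitive y - metropolis_primitive x \<and>
    metropolis_primitive y - metropolis_primitive x \<le> metropolis_ratio y * (y - x)"
  proof (cases "y \<le> 0")
    case True
    with assms have x: "x \<le> 0" by simp
    show ?thesis using exp_diff_le[of y x] exp_diff_le[of x y]
      by (simp add: metropolis_ratio_nonpos[OF x] metropolis_ratio_nonpos[OF True] metropolis_primitive_def x True
        algebra_simps)
  next
    case y: False
    show ?thesis
    proof (cases "x \<le> 0")
      case True
      have 1: "exp x * y \<le> 1 * y" using True y by (intro mult_right_mono) auto
      have 2: "1 - exp x \<le> y - x" "1 - exp x \<ge> exp x * (0 - x)" "1 + x \<le> exp x"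
        using exp_ge_add_one_self[of x] exp_diff_le[of x 0] y by (simp_all add: algebra_simps del: exp_ge_add_one_self)
      from y have y': "0 \<le> y" by simp
      have 3: "exp x * (y - x) = exp x * y - exp x * x" "exp x * (0 - x) = - (exp x * x)"
        by (simp_all add: algebra_simps)
      have 4: "metropolis_primitive y = 1 + y" "metropolis_primitive x = exp x"
        using y True by (simp_all add: metropolis_primitive_def)
      show ?thesis unfolding metropolis_ratio_nonpos[OF True] metropolis_ratio_nonneg[OF y'] 3(1) 4
        using 1 2 unfolding 3 mult_1 by (intro conjI) linarith+
    next
      case False
      then show ?thesis using y assms
        by (simp add: metropolis_ratio_nonneg metropolis_primitive_def)
    qed
  qed
  from 0 show "metropolis_ratio x * (y - x) \<le> metropolis_primitive y - metropolis_primitive x" by simp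
  from 0 show "metropolis_primitive y - metropolis_primitive x \<le> metropolis_ratio y * (y - x)" by simp
qed

lemma metropolis_ratio_lipschitz: "\<bar>metropolis_ratio y - metropolis_ratio x\<bar> \<le> \<bar>y - x\<bar>"
proof -
  have *: "metropolis_ratio y - metropolis_ratio x \<le> y - x" if "x \<le> y" for x y
  proof (cases "0 < y")
    case True
    show ?thesis
    proof (cases "0 \<le> x")
      case False
      have "1 + x \<le> exp x" by (rule exp_ge_add_one_self)
      moreover have "metropolis_ratio x = exp x" "metropolis_ratio y = 1"
        using False True by (auto simp: metropolis_ratio_nonneg metropolis_ratio_nonpos)
      ultimately show ?thesis using True by linarith
    qed (use that True in \<open>simp add: metropolis_ratio_nonneg\<close>)
  next
    case False
    have "exp y * (y - x) \<le> 1 * (y - x)"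
      using False that by (intro mult_right_mono) auto
    then show ?thesis using False that exp_diff_le[of y x]
      by (simp add: metropolis_ratio_nonpos)
  qed
  show ?thesis
    using *[of x y] *[of y x] metropolis_ratio_mono[of x y] metropolis_ratio_mono[of y x] by linarith
qed

lemma metropolis_primitive_taylor:
  "\<bar>metropolis_primitive (x + t) - metropolis_primitive x - metropolis_ratio x * t\<bar> \<le> t\<^sup>2"
proof -
  have lip: "\<bar>metropolis_ratio (x + t) * t - metropolis_ratio x * t\<bar> \<le> t\<^sup>2"
  proof -
    have "\<bar>metropolis_ratio (x + t) - metropolis_ratio x\<bar> * \<bar>t\<bar> \<le> \<bar>t\<bar> * \<bar>t\<bar>"
      using metropolis_ratio_lipschitz[of "x + t" x] by (intro mult_right_mono) auto
    then show ?thesis by (simp add: abs_mult[symmetric] left_diff_distrib power2_eq_square)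
  qed
  show ?thesis
  proof (cases "t \<ge> 0")
    case True
    then show ?thesis
      using metropolis_primitive_diff_aux[of x "x + t"] lip by auto
  next
    case False
    then show ?thesis
      using metropolis_primitive_diff_aux[of "x + t" x] lip by auto
  qed
qed

lemma smoothed_ratio_between:
  assumes "\<delta> > 0"
  shows "metropolis_ratio x \<le> smoothed_ratio \<delta> x" "smoothed_ratio \<delta> x \<le> metropolis_ratio (x + \<delta>)"
  using metropolis_primitive_diff_aux[of x "x + \<delta>"] assms
  by (auto simp: smoothed_ratio_def field_simps)

lemma smoothed_ratio_dist:
  assumes "\<delta> > 0"
  shows "\<bar>smoothed_ratio \<delta> x - metropolis_ratio x\<bar> \<le> \<delta>"
  using smoothed_ratio_between[OF assms, of x] metropolis_ratio_lipschitz[of "x + \<delta>" x] assms by simp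

lemma metropolis_primitive_measurable [measurable]: "metropolis_primitive \<in> borel_measurable borel"
  unfolding metropolis_primitive_def[abs_def] by measurable

lemma metropolis_ratio_measurable [measurable]: "metropolis_ratio \<in> borel_measurable borel"
  unfolding metropolis_ratio_def[abs_def] by measurable

lemma smoothed_ratio_measurable [measurable]: "smoothed_ratio \<delta> \<in> borel_measurable borel"
  unfolding smoothed_ratio_def[abs_def] by measurable

text \<open>A C^(1,1) bound with an explicit derivative \<open>D\<close>. In this form averaging
  over noise acts on \<phi> and \<open>D\<close> alike, without differentiation under the
  integral.\<close>

definition taylor1 :: "real \<Rightarrow> real \<Rightarrow> (real \<Rightarrow> real) \<Rightarrow> bool" where
  "taylor1 L \<kappa> \<phi> \<longleftrightarrow> \<phi> \<in> borel_measurable borel \<and> (\<forall>x. \<bar>\<phi> x\<bar> \<le> 1) \<and>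
     (\<exists>D\<in>borel_measurable borel. \<forall>x. \<bar>D x\<bar> \<le> L \<and> (\<forall>t. \<bar>\<phi> (x + t) - \<phi> x - D x * t\<bar> \<le> \<kappa> * t\<^sup>2))"

text \<open>The derivative is a difference quotient of \<open>metropolis_ratio\<close>, which is
  1-Lipschitz; hence L = 1. Two quadratic remainders of the primitive, divided by \<delta>, give 2 /
  \<delta>.\<close>

lemma taylor1_smoothed_ratio:
  assumes "\<delta> > 0"
  shows "taylor1 1 (2 / \<delta>) (smoothed_ratio \<delta>)"
  unfolding taylor1_def
proof (intro conjI allI bexI[of _ "\<lambda>x. (metropolis_ratio (x + \<delta>) - metropolis_ratio x) / \<delta>"])
  fix x t
  show "\<bar>smoothed_ratio \<delta> x\<bar> \<le> 1"
    using smoothed_ratio_between[OF assms, of x] metropolis_ratio_bounds[of x]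
      metropolis_ratio_bounds[of "x + \<delta>"] by simp
  show "\<bar>(metropolis_ratio (x + \<delta>) - metropolis_ratio x) / \<delta>\<bar> \<le> 1"
    using metropolis_ratio_lipschitz[of "x + \<delta>" x] assms by (simp add: field_simps)
  let ?a = "metropolis_primitive (x + \<delta> + t) - metropolis_primitive (x + \<delta>) - metropolis_ratio (x + \<delta>) * t"
  let ?b = "metropolis_primitive (x + t) - metropolis_primitive x - metropolis_ratio x * t"
  have "smoothed_ratio \<delta> (x + t) - smoothed_ratio \<delta> x -
     (metropolis_ratio (x + \<delta>) - metropolis_ratio x) / \<delta> * t = (?a - ?b) / \<delta>"
    using assms by (simp add: smoothed_ratio_def field_simps)
  moreover have "\<bar>?a - ?b\<bar> \<le> 2 * t\<^sup>2"
    using metropolis_primitive_taylor[of "x + \<delta>" t] metropolis_primitive_taylor[of x t] by linarith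
  ultimately show "\<bar>smoothed_ratio \<delta> (x + t) - smoothed_ratio \<delta> x -
     (metropolis_ratio (x + \<delta>) - metropolis_ratio x) / \<delta> * t\<bar> \<le> 2 / \<delta> * t\<^sup>2"
    using assms by (simp add: divide_right_mono)
qed measurable

lemma taylor1_scale:
  assumes "taylor1 L \<kappa> \<phi>" "\<theta> \<ge> 0"
  shows "taylor1 (L * \<theta>) (\<kappa> * \<theta>\<^sup>2) (\<lambda>x. \<phi> (\<theta> * x))"
proof -
  obtain D where D: "D \<in> borel_measurable borel" "\<And>x. \<bar>D x\<bar> \<le> L"
      "\<And>x t. \<bar>\<phi> (x + t) - \<phi> x - D x * t\<bar> \<le> \<kappa> * t\<^sup>2"
    using assms by (auto simp: taylor1_def)
  show ?thesis
    unfolding taylor1_def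
  proof (intro conjI allI bexI[of _ "\<lambda>x. D (\<theta> * x) * \<theta>"])
    fix x t
    show "\<bar>D (\<theta> * x) * \<theta>\<bar> \<le> L * \<theta>" using D(2)[of "\<theta> * x"] assms(2)
      by (auto simp: abs_mult intro: mult_right_mono)
    show "\<bar>\<phi> (\<theta> * (x + t)) - \<phi> (\<theta> * x) - D (\<theta> * x) * \<theta> * t\<bar> \<le> \<kappa> * \<theta>\<^sup>2 * t\<^sup>2"
      using D(3)[of "\<theta> * x" "\<theta> * t"] by (simp add: algebra_simps power_mult_distrib)
  qed (use assms D(1) in \<open>auto simp: taylor1_def\<close>)
qed

text \<open>The threshold - (1 + ln 4) / \<theta> solves exp (\<theta> x + 1) = 1/4. Below it the
  left side is nonpositive; above it the bracket is at most 1 and the ratio is at least the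
  exponential prefactor.\<close>

lemma metropolis_ratio_ge_smoothed:
  assumes "\<theta> > 0"
  shows "exp (- ((1 + ln 4) / \<theta>)) * (smoothed_ratio 1 (\<theta> * x) - 1 / 4) \<le> metropolis_ratio x"
proof (cases "x \<ge> - ((1 + ln 4) / \<theta>)")
  case True
  have "smoothed_ratio 1 (\<theta> * x) - 1 / 4 \<le> 1"
    using smoothed_ratio_between(2)[of 1 "\<theta> * x"] metropolis_ratio_bounds(2)[of "\<theta> * x + 1"] by simp
  then have "exp (- ((1 + ln 4) / \<theta>)) * (smoothed_ratio 1 (\<theta> * x) - 1 / 4) \<le> exp (- ((1 + ln 4) / \<theta>))"
    by simp
  also have "\<dots> \<le> metropolis_ratio x"
    using True assms by (auto simp: metropolis_ratio_def)
  finally show ?thesis .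
next
  case False
  then have "\<theta> * x + 1 \<le> - ln 4" using assms by (simp add: field_simps)
  then have "exp (\<theta> * x + 1) \<le> exp (- ln 4)" by simp
  also have "\<dots> = 1 / 4" by (simp add: exp_minus)
  finally have "smoothed_ratio 1 (\<theta> * x) - 1 / 4 \<le> 0"
    using smoothed_ratio_between(2)[of 1 "\<theta> * x"] by (simp add: metropolis_ratio_def)
  then show ?thesis using metropolis_ratio_bounds(1)[of x]
    by (meson exp_ge_zero mult_nonneg_nonpos order_trans)
qed

section \<open>Independent sites: mean and variance of acceptance probabilities\<close>

lemma (in prob_space) abs_integral_le:
  assumes "\<And>x. x \<in> space M \<Longrightarrow> \<bar>f x\<bar> \<le> B" "B \<ge> 0"
  shows "\<bar>\<integral>x. f x \<partial>M\<bar> \<le> (B::real)"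
proof (cases "integrable M f")
  case True
  have "\<bar>\<integral>x. f x \<partial>M\<bar> \<le> (\<integral>x. \<bar>f x\<bar> \<partial>M)" by simp
  also have "\<dots> \<le> (\<integral>x. B \<partial>M)" using True assms by (intro integral_mono) auto
  finally show ?thesis by (simp add: prob_space)
\<comment> \<open>The integral of a non-integrable function is 0, which is why B \<ge> 0 is
  assumed.\<close>
qed (use assms in \<open>simp add: not_integrable_integral_eq\<close>)

lemma (in prob_space) square_integral_le:
  assumes "integrable M (\<lambda>x. (f x)\<^sup>2)" "f \<in> borel_measurable M"
  shows "(\<integral>x. f x \<partial>M)\<^sup>2 \<le> (\<integral>x. (f x :: real)\<^sup>2 \<partial>M)"
proof -
  have i: "integrable M f" using square_integrable_imp_integrable[OF assms(2,1)] .
  have "0 \<le> variance f" by simp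
  also have "\<dots> = (\<integral>x. (f x)\<^sup>2 \<partial>M) - (\<integral>x. f x \<partial>M)\<^sup>2"
    using i assms by (intro variance_eq)
  finally show ?thesis by simp
qed

text \<open>One coordinate: \<open>H\<close> is the law of its state, \<open>N\<close> the law of
  its noise, and \<open>w\<close> its contribution to the log acceptance ratio. Different
  coordinates are independent copies.\<close>

locale site_model = H: prob_space H + N: prob_space N
  for H :: "'a measure" and N :: "'b measure" +
  fixes w :: "'a \<Rightarrow> 'b \<Rightarrow> real"
  assumes w_measurable: "(\<lambda>(x, \<xi>). w x \<xi>) \<in> borel_measurable (H \<Otimes>\<^sub>M N)"
    and w_square: "\<And>x. x \<in> space H \<Longrightarrow> integrable N (\<lambda>\<xi>. (w x \<xi>)\<^sup>2)"
begin

lemma w_measurable' [measurable (raw)]: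
  "f \<in> measurable K H \<Longrightarrow> g \<in> measurable K N \<Longrightarrow> (\<lambda>x. w (f x) (g x)) \<in> borel_measurable K"
  using measurable_compose[OF measurable_Pair w_measurable, of f K g] by simp

sublocale HP: product_prob_space "\<lambda>_. H" UNIV
  by (rule product_prob_spaceI) unfold_locales

sublocale NP: product_prob_space "\<lambda>_. N" UNIV
  by (rule product_prob_spaceI) unfold_locales

lemma prob_space_HP: "prob_space (PiM I (\<lambda>_. H))" and prob_space_NP: "prob_space (PiM I (\<lambda>_. N))"
  by (auto intro!: prob_space_PiM) unfold_locales

text \<open>Integrates out the noise of one site in state x, while the other sites contribute s.
  Removing a site thus becomes a change of the test function \<phi>.\<close>

definition step :: "(real \<Rightarrow> real) \<Rightarrow> 'a \<Rightarrow> real \<Rightarrow> real" where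
  "step \<phi> x s = (\<integral>\<xi>. \<phi> (s + w x \<xi>) \<partial>N)"

definition acc :: "nat set \<Rightarrow> (real \<Rightarrow> real) \<Rightarrow> (nat \<Rightarrow> 'a) \<Rightarrow> real" where
  "acc I \<phi> z = (\<integral>\<xi>. \<phi> (\<Sum>i\<in>I. w (z i) (\<xi> i)) \<partial>PiM I (\<lambda>_. N))"

definition mean :: "nat set \<Rightarrow> (real \<Rightarrow> real) \<Rightarrow> real" where
  "mean I \<phi> = (\<integral>z. acc I \<phi> z \<partial>PiM I (\<lambda>_. H))"

definition drift :: "'a \<Rightarrow> real" where "drift x = (\<integral>\<xi>. w x \<xi> \<partial>N)"
text \<open>The raw second moment, not the variance: it is what multiplies the quadratic Taylor
  remainder.\<close>

definition spread :: "'a \<Rightarrow> real" where "spread x = (\<integral>\<xi>. (w x \<xi>)\<^sup>2 \<partial>N)"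

lemma drift_measurable [measurable]: "drift \<in> borel_measurable H"
  unfolding drift_def[abs_def] by measurable

lemma spread_measurable [measurable]: "spread \<in> borel_measurable H"
  unfolding spread_def[abs_def] by measurable

lemma spread_nonneg: "spread x \<ge> 0"
  unfolding spread_def by simp

lemma step_measurable [measurable (raw)]:
  assumes [measurable]: "\<phi> \<in> borel_measurable borel" "f \<in> measurable K H" "g \<in> borel_measurable K"
  shows "(\<lambda>x. step \<phi> (f x) (g x)) \<in> borel_measurable K"
  unfolding step_def by measurable

lemma acc_measurable [measurable (raw)]:
  assumes [measurable]: "\<phi> \<in> borel_measurable borel"
    and f [measurable]: "\<And>i. i \<in> I \<Longrightarrow> (\<lambda>x. f x i) \<in> measurable K H"
  shows "(\<lambda>x. acc I \<phi> (f x)) \<in> borel_measurable K"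
proof -
  interpret NI: prob_space "PiM I (\<lambda>_. N)" by (rule prob_space_NP)
  show ?thesis unfolding acc_def by measurable
qed

lemma acc_step_measurable:
  assumes [measurable]: "\<phi> \<in> borel_measurable borel"
  shows "(\<lambda>(x, z). acc I (step \<phi> x) z) \<in> borel_measurable (H \<Otimes>\<^sub>M PiM I (\<lambda>_. H))"
proof -
  interpret NI: prob_space "PiM I (\<lambda>_. N)" by (rule prob_space_NP)
  show ?thesis unfolding acc_def by measurable
qed

lemma abs_step_le:
  assumes "\<And>x. \<bar>\<phi> x\<bar> \<le> 1" shows "\<bar>step \<phi> x s\<bar> \<le> 1"
  unfolding step_def by (rule N.abs_integral_le) (use assms in auto)

lemma abs_acc_le:
  assumes "\<And>x. \<bar>\<phi> x\<bar> \<le> 1" shows "\<bar>acc I \<phi> z\<bar> \<le> 1"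
  unfolding acc_def by (rule prob_space.abs_integral_le[OF prob_space_NP]) (use assms in auto)

lemma abs_mean_le:
  assumes "\<And>x. \<bar>\<phi> x\<bar> \<le> 1" shows "\<bar>mean I \<phi>\<bar> \<le> 1"
  unfolding mean_def by (rule prob_space.abs_integral_le[OF prob_space_HP]) (use abs_acc_le[OF assms] in auto)

lemma integrable_bounded:
  fixes f :: "'c \<Rightarrow> real"
  assumes "prob_space K" "f \<in> borel_measurable K" "\<And>x. x \<in> space K \<Longrightarrow> \<bar>f x\<bar> \<le> (B::real)"
  shows "integrable K f"
proof -
  interpret prob_space K by fact
  show ?thesis using assms by (intro integrable_const_bound[where B=B]) auto
qed

lemma integrable_acc:
  fixes \<phi> :: "real \<Rightarrow> real"
  assumes [measurable]: "\<phi> \<in> borel_measurable borel" and b: "\<And>x. \<bar>\<phi> x\<bar> \<le> 1" and "z \<in> space (PiM I (\<lambda>_. H))"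
  shows "integrable (PiM I (\<lambda>_. N)) (\<lambda>\<xi>. \<phi> (\<Sum>i\<in>I. w (z i) (\<xi> i)))"
proof (rule integrable_bounded[OF prob_space_NP])
  have [measurable]: "i \<in> I \<Longrightarrow> (\<lambda>\<xi>. z i) \<in> measurable (PiM I (\<lambda>_. N)) H" for i
    using assms(3) by (intro measurable_const) (auto simp: space_PiM PiE_mem)
  show "(\<lambda>\<xi>. \<phi> (\<Sum>i\<in>I. w (z i) (\<xi> i))) \<in> borel_measurable (PiM I (\<lambda>_. N))" by measurable
qed (use b in auto)

text \<open>By Fubini the noise of site j can be integrated first. Every induction over sites rests
  on this exchange of a site for a new test function.\<close>

lemma acc_insert:
  assumes [measurable]: "\<phi> \<in> borel_measurable borel" and b: "\<And>x. \<bar>\<phi> x\<bar> \<le> 1"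
    and I: "finite I" "j \<notin> I" and z: "z \<in> space (PiM (insert j I) (\<lambda>_. H))"
  shows "acc (insert j I) \<phi> z = acc I (step \<phi> (z j)) z"
proof -
  have "acc (insert j I) \<phi> z =
      (\<integral>\<xi>. (\<integral>y. \<phi> (\<Sum>i\<in>insert j I. w (z i) ((\<xi>(j := y)) i)) \<partial>N) \<partial>PiM I (\<lambda>_. N))"
    unfolding acc_def by (rule NP.product_integral_insert[OF I integrable_acc[OF assms(1) b z]])
  also have "\<dots> = (\<integral>\<xi>. (\<integral>y. \<phi> ((\<Sum>i\<in>I. w (z i) (\<xi> i)) + w (z j) y) \<partial>N) \<partial>PiM I (\<lambda>_. N))"
  proof -
    have "(\<Sum>i\<in>insert j I. w (z i) ((\<xi>(j := y)) i)) = (\<Sum>i\<in>I. w (z i) (\<xi> i)) + w (z j) y" for \<xi> y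
      using I by (simp add: add.commute cong: sum.cong) (intro sum.cong, auto)
    then show ?thesis by simp
  qed
  finally show ?thesis unfolding acc_def step_def .
qed

lemma acc_cong: "(\<And>i. i \<in> I \<Longrightarrow> z i = z' i) \<Longrightarrow> acc I \<phi> z = acc I \<phi> z'"
  unfolding acc_def by (simp cong: sum.cong)

lemma acc_insert_upd:
  assumes [measurable]: "\<phi> \<in> borel_measurable borel" and b: "\<And>x. \<bar>\<phi> x\<bar> \<le> 1"
    and I: "finite I" "j \<notin> I" and z: "z \<in> space (PiM I (\<lambda>_. H))" "x \<in> space H"
  shows "acc (insert j I) \<phi> (z(j := x)) = acc I (step \<phi> x) z"
proof -
  have "z(j := x) \<in> space (PiM (insert j I) (\<lambda>_. H))"
    using z by (auto simp: space_PiM PiE_def extensional_def)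
  from acc_insert[OF assms(1) b I this] show ?thesis
    using I by (auto intro!: acc_cong)
qed

lemma pair_prob_HI: "pair_prob_space H (PiM I (\<lambda>_. H))"
proof -
  interpret HI: prob_space "PiM I (\<lambda>_. H)" by (rule prob_space_HP)
  show ?thesis by unfold_locales
qed

text \<open>The outer function \<psi> is the identity for means and the square for second
  moments.\<close>

lemma integral_acc_insert:
  assumes [measurable]: "\<phi> \<in> borel_measurable borel" "\<psi> \<in> borel_measurable borel"
    and b: "\<And>x. \<bar>\<phi> x\<bar> \<le> 1" and b': "\<And>x. \<bar>x\<bar> \<le> 1 \<Longrightarrow> \<bar>\<psi> x\<bar> \<le> (1::real)"
    and I: "finite I" "j \<notin> I"
  shows "(\<integral>z. \<psi> (acc (insert j I) \<phi> z) \<partial>PiM (insert j I) (\<lambda>_. H)) =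
    (\<integral>x. (\<integral>z. \<psi> (acc I (step \<phi> x) z) \<partial>PiM I (\<lambda>_. H)) \<partial>H)"
proof -
  interpret HI: pair_prob_space H "PiM I (\<lambda>_. H)" by (rule pair_prob_HI)
  have "integrable (PiM (insert j I) (\<lambda>_. H)) (\<lambda>z. \<psi> (acc (insert j I) \<phi> z))"
    by (rule integrable_bounded[OF prob_space_HP _ b'[OF abs_acc_le[OF b]]]) measurable
  then have "(\<integral>z. \<psi> (acc (insert j I) \<phi> z) \<partial>PiM (insert j I) (\<lambda>_. H)) =
     (\<integral>z. (\<integral>x. \<psi> (acc (insert j I) \<phi> (z(j := x))) \<partial>H) \<partial>PiM I (\<lambda>_. H))"
    by (rule HP.product_integral_insert[OF I])
  also have "\<dots> = (\<integral>z. (\<integral>x. \<psi> (acc I (step \<phi> x) z) \<partial>H) \<partial>PiM I (\<lambda>_. H))"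
    by (intro Bochner_Integration.integral_cong refl) (simp add: acc_insert_upd[OF assms(1) b I])
  also have "\<dots> = (\<integral>x. (\<integral>z. \<psi> (acc I (step \<phi> x) z) \<partial>PiM I (\<lambda>_. H)) \<partial>H)"
  proof (rule HI.Fubini_integral)
    have m: "(\<lambda>(x, z). \<psi> (acc I (step \<phi> x) z)) \<in> borel_measurable (H \<Otimes>\<^sub>M PiM I (\<lambda>_. H))"
      using measurable_compose[OF acc_step_measurable[OF assms(1)] assms(2)] by (simp add: split_beta')
    show "integrable (H \<Otimes>\<^sub>M PiM I (\<lambda>_. H)) (\<lambda>(x, z). \<psi> (acc I (step \<phi> x) z))"
      by (rule integrable_bounded[where B=1, OF _ m])
         (auto intro!: b' abs_acc_le abs_step_le b HI.prob_space_axioms)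
  qed
  finally show ?thesis .
qed

lemma mean_insert:
  assumes "\<phi> \<in> borel_measurable borel" "\<And>x. \<bar>\<phi> x\<bar> \<le> 1" "finite I" "j \<notin> I"
  shows "mean (insert j I) \<phi> = (\<integral>x. mean I (step \<phi> x) \<partial>H)"
  unfolding mean_def by (rule integral_acc_insert[where \<psi>="\<lambda>x. x"]) (use assms in auto)

lemma mean_diff_le:
  assumes m: "\<phi> \<in> borel_measurable borel" "\<psi> \<in> borel_measurable borel"
    and b: "\<And>x. \<bar>\<phi> x\<bar> \<le> 1" "\<And>x. \<bar>\<psi> x\<bar> \<le> 1" and d: "\<And>x. \<bar>\<phi> x - \<psi> x\<bar> \<le> e"
  shows acc_diff_le: "z \<in> space (PiM I (\<lambda>_. H)) \<Longrightarrow> \<bar>acc I \<phi> z - acc I \<psi> z\<bar> \<le> e"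
    and "\<bar>mean I \<phi> - mean I \<psi>\<bar> \<le> e"
proof -
  have e: "e \<ge> 0" using d[of 0] by linarith
  show 1: "\<bar>acc I \<phi> z - acc I \<psi> z\<bar> \<le> e" if z: "z \<in> space (PiM I (\<lambda>_. H))" for z
    unfolding acc_def
    by (subst Bochner_Integration.integral_diff[symmetric])
       (auto intro!: integrable_acc m b z prob_space.abs_integral_le[OF prob_space_NP] d e)
  show "\<bar>mean I \<phi> - mean I \<psi>\<bar> \<le> e"
    unfolding mean_def
    by (subst Bochner_Integration.integral_diff[symmetric])
       (auto intro!: integrable_bounded[OF prob_space_HP] acc_measurable m abs_acc_le b
          prob_space.abs_integral_le[OF prob_space_HP] 1 e)
qed

lemma integrable_w:
  assumes [measurable]: "x \<in> space H" shows "integrable N (\<lambda>\<xi>. w x \<xi>)"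
  by (rule N.square_integrable_imp_integrable[OF _ w_square[OF assms]]) measurable

lemma integrable_step:
  fixes \<phi> :: "real \<Rightarrow> real"
  assumes [measurable]: "\<phi> \<in> borel_measurable borel" and b: "\<And>x. \<bar>\<phi> x\<bar> \<le> B" and [measurable]: "x \<in> space H"
  shows "integrable N (\<lambda>\<xi>. \<phi> (s + w x \<xi>))"
  by (rule integrable_bounded[where B=B, OF N.prob_space_axioms _ b]) measurable

text \<open>Integrating the Taylor expansion of \<phi> over the noise: to first order one site
  shifts \<phi> by its derivative times the drift. One \<open>D\<close> serves all s and x, as it is
  the derivative of \<phi> itself.\<close>

lemma step_sub_le:
  assumes "taylor1 L \<kappa> \<phi>" and x: "x \<in> space H"
  obtains D where "D \<in> borel_measurable borel" "\<And>x. \<bar>D x\<bar> \<le> L"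
    "\<And>s x. x \<in> space H \<Longrightarrow> \<bar>step \<phi> x s - \<phi> s - D s * drift x\<bar> \<le> \<kappa> * spread x"
proof -
  obtain D where D: "D \<in> borel_measurable borel" "\<And>x. \<bar>D x\<bar> \<le> L"
      "\<And>x t. \<bar>\<phi> (x + t) - \<phi> x - D x * t\<bar> \<le> \<kappa> * t\<^sup>2"
    and m [measurable]: "\<phi> \<in> borel_measurable borel" and b: "\<And>x. \<bar>\<phi> x\<bar> \<le> 1"
    using assms by (auto simp: taylor1_def)
  show thesis
  proof (rule that[OF D(1,2)])
    fix s x assume x: "x \<in> space H"
    note i = integrable_step[OF m b x, of s] integrable_w[OF x] w_square[OF x]
    have "step \<phi> x s - \<phi> s - D s * drift x = (\<integral>\<xi>. \<phi> (s + w x \<xi>) - \<phi> s - D s * w x \<xi> \<partial>N)"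
      unfolding step_def drift_def using i by (simp add: N.prob_space)
    also have "\<bar>\<dots>\<bar> \<le> (\<integral>\<xi>. \<bar>\<phi> (s + w x \<xi>) - \<phi> s - D s * w x \<xi>\<bar> \<partial>N)"
      by simp
    also have "\<dots> \<le> (\<integral>\<xi>. \<kappa> * (w x \<xi>)\<^sup>2 \<partial>N)"
      using i D(3) by (intro integral_mono) auto
    also have "\<dots> = \<kappa> * spread x" by (simp add: spread_def)
    finally show "\<bar>step \<phi> x s - \<phi> s - D s * drift x\<bar> \<le> \<kappa> * spread x" .
  qed
qed

lemma step_dist_le:
  assumes "taylor1 L \<kappa> \<phi>" and x: "x \<in> space H"
  shows "\<bar>step \<phi> x s - \<phi> s\<bar> \<le> L * \<bar>drift x\<bar> + \<kappa> * spread x"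
proof -
  obtain D where D: "\<And>x. \<bar>D x\<bar> \<le> L" "\<bar>step \<phi> x s - \<phi> s - D s * drift x\<bar> \<le> \<kappa> * spread x"
    using step_sub_le[OF assms] x by metis
  have "\<bar>D s * drift x\<bar> \<le> L * \<bar>drift x\<bar>" using D(1)[of s] by (auto simp: abs_mult intro: mult_right_mono)
  then show ?thesis using D(2) by linarith
qed

text \<open>Averages of \<phi> have derivative \<open>step D x\<close> with the same bounds. The
  constants therefore do not deteriorate when sites are integrated out one after another.\<close>

lemma taylor1_step:
  assumes "taylor1 L \<kappa> \<phi>" and x: "x \<in> space H"
  shows "taylor1 L \<kappa> (step \<phi> x)"
proof -
  obtain D where D [measurable]: "D \<in> borel_measurable borel" and D': "\<And>x. \<bar>D x\<bar> \<le> L"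
      "\<And>x t. \<bar>\<phi> (x + t) - \<phi> x - D x * t\<bar> \<le> \<kappa> * t\<^sup>2"
    and m [measurable]: "\<phi> \<in> borel_measurable borel" and b: "\<And>x. \<bar>\<phi> x\<bar> \<le> 1"
    using assms by (auto simp: taylor1_def)
  have L: "L \<ge> 0" and \<kappa>: "\<kappa> \<ge> 0" using D'(1)[of 0] D'(2)[of 0 1] by auto
  show ?thesis unfolding taylor1_def
  proof (intro conjI allI bexI[of _ "step D x"])
    fix s t
    show "\<bar>step \<phi> x s\<bar> \<le> 1" by (rule abs_step_le[OF b])
    show "\<bar>step D x s\<bar> \<le> L" unfolding step_def by (rule N.abs_integral_le) (use D' L in auto)
    have "step \<phi> x (s + t) - step \<phi> x s - step D x s * t =
       (\<integral>\<xi>. \<phi> (s + w x \<xi> + t) - \<phi> (s + w x \<xi>) - D (s + w x \<xi>) * t \<partial>N)"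
      unfolding step_def
      using integrable_step[OF m b x, of "s + t"] integrable_step[OF m b x, of s] integrable_step[OF D D'(1) x, of s]
      by (simp add: add_ac)
    also have "\<bar>\<dots>\<bar> \<le> \<kappa> * t\<^sup>2"
      by (rule N.abs_integral_le) (use D' \<kappa> in auto)
    finally show "\<bar>step \<phi> x (s + t) - step \<phi> x s - step D x s * t\<bar> \<le> \<kappa> * t\<^sup>2" .
  qed (use x in measurable)
qed

text \<open>The law of total variance, one site at a time. Given the state x of the new site, the
  induction hypothesis applies to \<open>step \<phi> x\<close>, hence the arbitrary \<phi>; the
  conditional mean then varies with x only by the influence of a single site.\<close>

lemma second_moment_acc_le:
  assumes "taylor1 L \<kappa> \<phi>" "finite I"
    and \<rho>: "integrable H (\<lambda>x. (L * \<bar>drift x\<bar> + \<kappa> * spread x)\<^sup>2)"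
  shows "(\<integral>z. (acc I \<phi> z)\<^sup>2 \<partial>PiM I (\<lambda>_. H)) \<le>
    (mean I \<phi>)\<^sup>2 + real (card I) * (\<integral>x. (L * \<bar>drift x\<bar> + \<kappa> * spread x)\<^sup>2 \<partial>H)"
  using assms(2,1)
proof (induction I arbitrary: \<phi> rule: finite_induct)
  case empty
  interpret E: prob_space "PiM {} (\<lambda>_. H)" by (rule prob_space_HP)
  interpret E': prob_space "PiM {} (\<lambda>_. N)" by (rule prob_space_NP)
  have "acc {} \<phi> z = \<phi> 0" for z by (simp add: acc_def E'.prob_space)
  then show ?case by (simp add: mean_def E.prob_space)
next
  case (insert j I)
  let ?\<rho> = "\<integral>x. (L * \<bar>drift x\<bar> + \<kappa> * spread x)\<^sup>2 \<partial>H"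
  from insert.prems have m: "\<phi> \<in> borel_measurable borel" and b: "\<And>x. \<bar>\<phi> x\<bar> \<le> 1"
    by (auto simp: taylor1_def)
  have b2: "\<bar>x\<bar> \<le> 1 \<Longrightarrow> \<bar>x\<^sup>2\<bar> \<le> 1" for x :: real
    using abs_square_le_1 by auto
  interpret HI: pair_prob_space H "PiM I (\<lambda>_. H)" by (rule pair_prob_HI)
  define F where "F x = mean I (step \<phi> x)" for x
  have Fm [measurable]: "F \<in> borel_measurable H"
    unfolding F_def mean_def using acc_step_measurable[OF m] by measurable
  have Fb: "\<bar>F x\<bar> \<le> 1" for x unfolding F_def by (rule abs_mean_le[OF abs_step_le[OF b]])
  have Fi: "integrable H F" "integrable H (\<lambda>x. (F x)\<^sup>2)"
    by (rule integrable_bounded[where B=1]; use Fb H.prob_space_axioms b2 in auto)+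
  have "(\<integral>z. (acc (insert j I) \<phi> z)\<^sup>2 \<partial>PiM (insert j I) (\<lambda>_. H)) =
     (\<integral>x. (\<integral>z. (acc I (step \<phi> x) z)\<^sup>2 \<partial>PiM I (\<lambda>_. H)) \<partial>H)"
    using integral_acc_insert[OF m, of "\<lambda>x. x\<^sup>2", OF _ b b2 insert.hyps] by simp
  also have "\<dots> \<le> (\<integral>x. (F x)\<^sup>2 + real (card I) * ?\<rho> \<partial>H)"
  proof (rule integral_mono)
    show "integrable H (\<lambda>x. \<integral>z. (acc I (step \<phi> x) z)\<^sup>2 \<partial>PiM I (\<lambda>_. H))"
    proof (rule integrable_bounded[where B=1, OF H.prob_space_axioms])
      show "(\<lambda>x. \<integral>z. (acc I (step \<phi> x) z)\<^sup>2 \<partial>PiM I (\<lambda>_. H)) \<in> borel_measurable H"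
        using acc_step_measurable[OF m, of I] by measurable
    qed (rule prob_space.abs_integral_le[OF prob_space_HP b2[OF abs_acc_le[OF abs_step_le[OF b]]]], simp)
    show "(\<integral>z. (acc I (step \<phi> x) z)\<^sup>2 \<partial>PiM I (\<lambda>_. H)) \<le> (F x)\<^sup>2 + real (card I) * ?\<rho>" if "x \<in> space H" for x
      unfolding F_def by (rule insert.IH[OF taylor1_step[OF insert.prems that]])
  qed (use Fi in auto)
  also have "\<dots> = (\<integral>x. (F x)\<^sup>2 \<partial>H) + real (card I) * ?\<rho>"
    using Fi by (simp add: H.prob_space)
  also have "(\<integral>x. (F x)\<^sup>2 \<partial>H) \<le> (\<integral>x. F x \<partial>H)\<^sup>2 + ?\<rho>"
  proof -
    \<comment> \<open>A variance is at most the second moment about any constant. The mean with the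
      site left out is a constant from which \<open>F x\<close> differs only by the effect of that
      site.\<close>
    define c where "c = mean I \<phi>"
    have "(\<integral>x. F x - c \<partial>H)\<^sup>2 \<ge> 0" by simp
    then have "(\<integral>x. F x \<partial>H)\<^sup>2 \<ge> 2 * c * (\<integral>x. F x \<partial>H) - c\<^sup>2"
      using Fi by (simp add: H.prob_space power2_diff algebra_simps)
    moreover have "(\<integral>x. (F x)\<^sup>2 \<partial>H) = (\<integral>x. (F x - c)\<^sup>2 \<partial>H) + 2 * c * (\<integral>x. F x \<partial>H) - c\<^sup>2"
    proof -
      have "(\<lambda>x. (F x - c)\<^sup>2) = (\<lambda>x. (F x)\<^sup>2 - 2 * c * F x + c\<^sup>2)"
        by (simp add: power2_diff fun_eq_iff algebra_simps)
      then show ?thesis using Fi by (simp add: H.prob_space)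
    qed
    moreover have "(\<integral>x. (F x - c)\<^sup>2 \<partial>H) \<le> ?\<rho>"
    proof (rule integral_mono[OF _ \<rho>])
      have "(\<lambda>x. (F x - c)\<^sup>2) = (\<lambda>x. (F x)\<^sup>2 - 2 * c * F x + c\<^sup>2)"
        by (simp add: power2_diff fun_eq_iff algebra_simps)
      then show "integrable H (\<lambda>x. (F x - c)\<^sup>2)" using Fi by simp
      fix x assume x: "x \<in> space H"
      have "\<bar>F x - c\<bar> \<le> L * \<bar>drift x\<bar> + \<kappa> * spread x"
        unfolding F_def c_def
        by (rule mean_diff_le[OF _ m abs_step_le[OF b] b step_dist_le[OF insert.prems x]])
           (use x m in measurable)
      then show "(F x - c)\<^sup>2 \<le> (L * \<bar>drift x\<bar> + \<kappa> * spread x)\<^sup>2"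
        by (metis abs_ge_zero power2_abs power_mono)
    qed
    ultimately show ?thesis by linarith
  qed
  also have "(\<integral>x. F x \<partial>H) = mean (insert j I) \<phi>"
    unfolding F_def by (rule mean_insert[OF m b insert.hyps, symmetric])
  finally show ?case using insert.hyps by (simp add: algebra_simps)
qed

text \<open>The drift enters through its integral, not through its absolute value. This keeps the
  cancellation over the state: for MALA the mean drift is O(s^6), whereas the drift at a point is
  only O(s^4), too large to be summed over d sites.\<close>

lemma mean_dist_le:
  assumes "taylor1 L \<kappa> \<phi>" "finite I"
    and i: "integrable H drift" "integrable H spread"
  shows "\<bar>mean I \<phi> - \<phi> 0\<bar> \<le> real (card I) * (L * \<bar>\<integral>x. drift x \<partial>H\<bar> + \<kappa> * (\<integral>x. spread x \<partial>H))"
  using assms(2)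
proof (induction I rule: finite_induct)
  case empty
  interpret E: prob_space "PiM {} (\<lambda>_. H)" by (rule prob_space_HP)
  interpret E': prob_space "PiM {} (\<lambda>_. N)" by (rule prob_space_NP)
  have "acc {} \<phi> z = \<phi> 0" for z by (simp add: acc_def E'.prob_space)
  then show ?case by (simp add: mean_def E.prob_space)
next
  case (insert j I)
  let ?e = "L * \<bar>\<integral>x. drift x \<partial>H\<bar> + \<kappa> * (\<integral>x. spread x \<partial>H)"
  from assms(1) have m [measurable]: "\<phi> \<in> borel_measurable borel" and b: "\<And>x. \<bar>\<phi> x\<bar> \<le> 1"
    by (auto simp: taylor1_def)
  obtain x0 where x0: "x0 \<in> space H" using H.not_empty by auto
  obtain D where D: "\<And>x. \<bar>D x\<bar> \<le> L"
    "\<And>s x. x \<in> space H \<Longrightarrow> \<bar>step \<phi> x s - \<phi> s - D s * drift x\<bar> \<le> \<kappa> * spread x"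
    using step_sub_le[OF assms(1) x0] by metis
  interpret HI: prob_space "PiM I (\<lambda>_. H)" by (rule prob_space_HP)
  interpret NI: prob_space "PiM I (\<lambda>_. N)" by (rule prob_space_NP)
  interpret HNI: pair_prob_space H "PiM I (\<lambda>_. N)" by unfold_locales
  interpret HH: pair_prob_space H "PiM I (\<lambda>_. H)" by unfold_locales
  \<comment> \<open>Both the state and the noise of the new site are averaged before the other sites
    are looked at, so that \<open>u\<close> is uniformly close to \<phi> and the induction
    hypothesis for the same \<phi> suffices.\<close>
  define u where "u s = (\<integral>x. step \<phi> x s \<partial>H)" for s
  have um [measurable]: "u \<in> borel_measurable borel" unfolding u_def by measurable
  have ub: "\<bar>u s\<bar> \<le> 1" for s unfolding u_def by (rule H.abs_integral_le[OF abs_step_le[OF b]]) auto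
  have si: "integrable H (\<lambda>x. step \<phi> x s)" for s
    by (rule integrable_bounded[where B=1, OF H.prob_space_axioms]) (auto intro: abs_step_le b)
  have "\<bar>u s - \<phi> s\<bar> \<le> ?e" for s
  proof -
    have "u s - \<phi> s - D s * (\<integral>x. drift x \<partial>H) = (\<integral>x. step \<phi> x s - \<phi> s - D s * drift x \<partial>H)"
      unfolding u_def using si i by (simp add: H.prob_space)
    also have "\<bar>\<dots>\<bar> \<le> (\<integral>x. \<bar>step \<phi> x s - \<phi> s - D s * drift x\<bar> \<partial>H)"
      by simp
    also have "\<dots> \<le> (\<integral>x. \<kappa> * spread x \<partial>H)"
      using si i D(2) by (intro integral_mono) auto
    finally have "\<bar>u s - \<phi> s - D s * (\<integral>x. drift x \<partial>H)\<bar> \<le> \<kappa> * (\<integral>x. spread x \<partial>H)" by simp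
    moreover have "\<bar>D s * (\<integral>x. drift x \<partial>H)\<bar> \<le> L * \<bar>\<integral>x. drift x \<partial>H\<bar>"
      using D(1)[of s] by (auto simp: abs_mult intro: mult_right_mono)
    ultimately show ?thesis by linarith
  qed
  then have 1: "\<bar>mean I u - mean I \<phi>\<bar> \<le> ?e"
    by (intro mean_diff_le um m ub b)
  have "mean (insert j I) \<phi> = (\<integral>x. (\<integral>z. acc I (step \<phi> x) z \<partial>PiM I (\<lambda>_. H)) \<partial>H)"
    using mean_insert[OF m b insert.hyps] by (simp add: mean_def)
  also have "\<dots> = (\<integral>z. (\<integral>x. acc I (step \<phi> x) z \<partial>H) \<partial>PiM I (\<lambda>_. H))"
  proof (rule HH.Fubini_integral[symmetric])
    show "integrable (H \<Otimes>\<^sub>M PiM I (\<lambda>_. H)) (\<lambda>(x, z). acc I (step \<phi> x) z)"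
      by (rule integrable_bounded[where B=1, OF HH.prob_space_axioms acc_step_measurable[OF m]])
         (auto intro!: abs_acc_le abs_step_le b)
  qed
  also have "\<dots> = mean I u"
    unfolding mean_def
  proof (rule Bochner_Integration.integral_cong[OF refl])
    fix z assume z: "z \<in> space (PiM I (\<lambda>_. H))"
    then have [measurable]: "i \<in> I \<Longrightarrow> (\<lambda>\<xi>. z i) \<in> measurable (H \<Otimes>\<^sub>M PiM I (\<lambda>_. N)) H" for i
      by (intro measurable_const) (auto simp: space_PiM PiE_mem)
    have "(\<lambda>p. step \<phi> (fst p) (\<Sum>i\<in>I. w (z i) (snd p i))) \<in> borel_measurable (H \<Otimes>\<^sub>M PiM I (\<lambda>_. N))"
      by measurable
    then have "integrable (H \<Otimes>\<^sub>M PiM I (\<lambda>_. N)) (\<lambda>(x, \<xi>). step \<phi> x (\<Sum>i\<in>I. w (z i) (\<xi> i)))"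
      unfolding split_beta' by (rule integrable_bounded[where B=1, OF HNI.prob_space_axioms]) (rule abs_step_le[OF b])
    from HNI.Fubini_integral[OF this] show "(\<integral>x. acc I (step \<phi> x) z \<partial>H) = acc I u z"
      unfolding acc_def u_def by (rule sym)
  qed
  finally have 2: "mean (insert j I) \<phi> = mean I u" .
  from 1 insert.IH show ?case
    unfolding 2 using insert.hyps by (simp add: algebra_simps)
qed

lemma integrable_acc_HP:
  assumes "\<phi> \<in> borel_measurable borel" "\<And>x. \<bar>\<phi> x\<bar> \<le> 1"
  shows "integrable (PiM I (\<lambda>_. H)) (acc I \<phi>)" "integrable (PiM I (\<lambda>_. H)) (\<lambda>z. (acc I \<phi> z)\<^sup>2)"
proof -
  have [measurable]: "acc I \<phi> \<in> borel_measurable (PiM I (\<lambda>_. H))"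
    by (rule acc_measurable[OF assms(1)]) measurable
  show "integrable (PiM I (\<lambda>_. H)) (acc I \<phi>)"
    by (rule integrable_bounded[where B=1, OF prob_space_HP]) (simp_all add: abs_acc_le assms(2))
  show "integrable (PiM I (\<lambda>_. H)) (\<lambda>z. (acc I \<phi> z)\<^sup>2)"
    by (rule integrable_bounded[where B=1, OF prob_space_HP]) (simp_all add: abs_square_le_1 abs_acc_le assms(2))
qed

text \<open>The kink of the ratio at 0 excludes a quadratic Taylor bound. Smoothing at width
  \<delta> restores it with constant 2 / \<delta>, at a uniform cost \<delta>; the width is kept
  free, to be fixed independently of d.\<close>

lemma variance_acc_le:
  assumes "finite I" "0 < \<delta>"
    and i: "integrable H (\<lambda>x. (drift x)\<^sup>2)" "integrable H (\<lambda>x. (spread x)\<^sup>2)"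
  shows "(\<integral>z. (acc I metropolis_ratio z - mean I metropolis_ratio)\<^sup>2 \<partial>PiM I (\<lambda>_. H)) \<le>
    real (card I) * (4 * (\<integral>x. (drift x)\<^sup>2 \<partial>H) + 16 / \<delta>\<^sup>2 * (\<integral>x. (spread x)\<^sup>2 \<partial>H)) + 8 * \<delta>\<^sup>2"
proof -
  interpret HI: prob_space "PiM I (\<lambda>_. H)" by (rule prob_space_HP)
  let ?f = "smoothed_ratio \<delta>"
  have t: "taylor1 1 (2 / \<delta>) ?f" by (rule taylor1_smoothed_ratio[OF assms(2)])
  then have m: "?f \<in> borel_measurable borel" and b: "\<And>x. \<bar>?f x\<bar> \<le> 1" by (auto simp: taylor1_def)
  have m0: "metropolis_ratio \<in> borel_measurable borel" by measurable
  have ia: "integrable (PiM I (\<lambda>_. H)) (acc I ?f)" "integrable (PiM I (\<lambda>_. H)) (\<lambda>z. (acc I ?f z)\<^sup>2)"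
    "integrable (PiM I (\<lambda>_. H)) (acc I metropolis_ratio)" "integrable (PiM I (\<lambda>_. H)) (\<lambda>z. (acc I metropolis_ratio z)\<^sup>2)"
    by (simp_all add: integrable_acc_HP m b m0 metropolis_ratio_abs_le)
  have isq: "integrable H (\<lambda>x. (1 * \<bar>drift x\<bar> + 2 / \<delta> * spread x)\<^sup>2)"
   and le: "(\<integral>x. (1 * \<bar>drift x\<bar> + 2 / \<delta> * spread x)\<^sup>2 \<partial>H) \<le> (\<integral>x. 2 * (drift x)\<^sup>2 + 8 / \<delta>\<^sup>2 * (spread x)\<^sup>2 \<partial>H)"
  proof -
    have pt: "(1 * \<bar>drift x\<bar> + 2 / \<delta> * spread x)\<^sup>2 \<le> 2 * (drift x)\<^sup>2 + 8 / \<delta>\<^sup>2 * (spread x)\<^sup>2" for x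
    proof -
      have "(a + c)\<^sup>2 \<le> 2 * a\<^sup>2 + 2 * c\<^sup>2" for a c :: real
        using sum_squares_bound[of a c] by (simp add: power2_sum)
      from this[of "\<bar>drift x\<bar>" "2 / \<delta> * spread x"] show ?thesis
        by (simp add: power_mult_distrib power_divide)
    qed
    show *: "integrable H (\<lambda>x. (1 * \<bar>drift x\<bar> + 2 / \<delta> * spread x)\<^sup>2)"
    proof (rule Bochner_Integration.integrable_bound)
      show "integrable H (\<lambda>x. 2 * (drift x)\<^sup>2 + 8 / \<delta>\<^sup>2 * (spread x)\<^sup>2)" using i by simp
    qed (use pt in \<open>auto intro: order_trans[OF _ abs_ge_self]\<close>)
    show "(\<integral>x. (1 * \<bar>drift x\<bar> + 2 / \<delta> * spread x)\<^sup>2 \<partial>H) \<le> (\<integral>x. 2 * (drift x)\<^sup>2 + 8 / \<delta>\<^sup>2 * (spread x)\<^sup>2 \<partial>H)"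
      by (rule integral_mono[OF * _ pt]) (use i in auto)
  qed
  have v: "(\<integral>z. (acc I ?f z - mean I ?f)\<^sup>2 \<partial>PiM I (\<lambda>_. H)) =
      (\<integral>z. (acc I ?f z)\<^sup>2 \<partial>PiM I (\<lambda>_. H)) - (mean I ?f)\<^sup>2"
    unfolding mean_def using ia by (intro HI.variance_eq)
  have "(\<integral>z. (acc I metropolis_ratio z - mean I metropolis_ratio)\<^sup>2 \<partial>PiM I (\<lambda>_. H)) \<le>
     (\<integral>z. 2 * (acc I ?f z - mean I ?f)\<^sup>2 + 8 * \<delta>\<^sup>2 \<partial>PiM I (\<lambda>_. H))"
  proof (rule integral_mono)
    fix z assume z: "z \<in> space (PiM I (\<lambda>_. H))"
    let ?a = "acc I ?f z - mean I ?f" and ?b = "acc I metropolis_ratio z - mean I metropolis_ratio"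
    \<comment> \<open>Smoothing moves \<open>acc\<close> and \<open>mean\<close> by at most \<delta>
      each. Twice the square of 2 \<delta> is the final 8 \<delta>^2.\<close>
    have "\<bar>acc I metropolis_ratio z - acc I ?f z\<bar> \<le> \<delta>" "\<bar>mean I metropolis_ratio - mean I ?f\<bar> \<le> \<delta>"
      using smoothed_ratio_dist[OF assms(2)] z
      by (intro acc_diff_le mean_diff_le(2) m0 m metropolis_ratio_abs_le b; simp add: abs_minus_commute)+
    then have "\<bar>?b - ?a\<bar> \<le> 2 * \<delta>" by linarith
    then have d: "(?b - ?a)\<^sup>2 \<le> (2 * \<delta>)\<^sup>2" by (metis abs_ge_zero power2_abs power_mono)
    have "(a + c)\<^sup>2 \<le> 2 * a\<^sup>2 + 2 * c\<^sup>2" for a c :: real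
      using sum_squares_bound[of a c] by (simp add: power2_sum)
    from this[of ?a "?b - ?a"] d show "?b\<^sup>2 \<le> 2 * ?a\<^sup>2 + 8 * \<delta>\<^sup>2" by (simp add: power_mult_distrib)
  qed (use ia in \<open>auto simp: power2_diff\<close>)
  also have "\<dots> = 2 * ((\<integral>z. (acc I ?f z)\<^sup>2 \<partial>PiM I (\<lambda>_. H)) - (mean I ?f)\<^sup>2) + 8 * \<delta>\<^sup>2"
    unfolding v[symmetric] using ia by (simp add: HI.prob_space power2_diff)
  also have "\<dots> \<le> 2 * (real (card I) * (\<integral>x. (1 * \<bar>drift x\<bar> + 2 / \<delta> * spread x)\<^sup>2 \<partial>H)) + 8 * \<delta>\<^sup>2"
    using second_moment_acc_le[OF t assms(1) isq] by simp
  also have "\<dots> \<le> 2 * (real (card I) * (\<integral>x. 2 * (drift x)\<^sup>2 + 8 / \<delta>\<^sup>2 * (spread x)\<^sup>2 \<partial>H)) + 8 * \<delta>\<^sup>2"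
    using le by (intro add_mono mult_left_mono) auto
  finally show ?thesis using i by (simp add: algebra_simps)
qed

text \<open>For small \<open>\<theta>\<close> the smoothed ratio at \<open>\<theta> x\<close> keeps mean at least 1/2, and where it exceeds 1/4 the
  unscaled ratio exceeds a constant depending on \<open>\<theta>\<close> only.\<close>

lemma mean_acc_ge:
  assumes "finite I" "0 < \<theta>"
    and i: "integrable H drift" "integrable H spread"
    and c: "real (card I) * (\<theta> * \<bar>\<integral>x. drift x \<partial>H\<bar> + 2 * \<theta>\<^sup>2 * (\<integral>x. spread x \<partial>H)) \<le> 1 / 2"
  shows "exp (- ((1 + ln 4) / \<theta>)) / 4 \<le> mean I metropolis_ratio"
proof -
  interpret HI: prob_space "PiM I (\<lambda>_. H)" by (rule prob_space_HP)
  interpret NI: prob_space "PiM I (\<lambda>_. N)" by (rule prob_space_NP)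
  let ?f = "\<lambda>x. smoothed_ratio 1 (\<theta> * x)"
  let ?c = "exp (- ((1 + ln 4) / \<theta>))"
  have t: "taylor1 (1 * \<theta>) (2 / 1 * \<theta>\<^sup>2) ?f"
    using assms(2) by (intro taylor1_scale taylor1_smoothed_ratio) auto
  then have m: "?f \<in> borel_measurable borel" and b: "\<And>x. \<bar>?f x\<bar> \<le> 1" by (auto simp: taylor1_def)
  have m0: "metropolis_ratio \<in> borel_measurable borel" by measurable
  have f0: "?f 0 = 1"
    by (simp add: smoothed_ratio_def metropolis_primitive_def)
  \<comment> \<open>The value at 0 is 1 and assumption \<open>c\<close> allows a deviation of 1/2;
    what exceeds 1/4 after that is the factor 1/4 in the conclusion.\<close>
  have f2: "mean I ?f \<ge> 1 / 2"
    using mean_dist_le[OF t assms(1) i] c f0 by (simp add: algebra_simps)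
  have "?c / 4 \<le> ?c * (mean I ?f - 1 / 4)"
    using f2 by simp
  also have "\<dots> = (\<integral>z. ?c * (acc I ?f z - 1 / 4) \<partial>PiM I (\<lambda>_. H))"
  proof -
    have "integrable (PiM I (\<lambda>_. H)) (acc I ?f)" by (rule integrable_acc_HP[OF m b])
    then show ?thesis unfolding mean_def by (simp add: HI.prob_space)
  qed
  also have "\<dots> \<le> mean I metropolis_ratio"
    unfolding mean_def
  proof (rule integral_mono)
    fix z assume z: "z \<in> space (PiM I (\<lambda>_. H))"
    have "?c * (acc I ?f z - 1 / 4) = (\<integral>\<xi>. ?c * (?f (\<Sum>i\<in>I. w (z i) (\<xi> i)) - 1 / 4) \<partial>PiM I (\<lambda>_. N))"
      unfolding acc_def using integrable_acc[OF m b z] by (simp add: NI.prob_space)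
    also have "\<dots> \<le> acc I metropolis_ratio z"
      unfolding acc_def
      by (rule integral_mono) (use integrable_acc[OF m b z] integrable_acc[OF m0 metropolis_ratio_abs_le z]
          metropolis_ratio_ge_smoothed[OF assms(2)] in auto)
    finally show "?c * (acc I ?f z - 1 / 4) \<le> acc I metropolis_ratio z" .
  next
    show "integrable (PiM I (\<lambda>_. H)) (\<lambda>z. ?c * (acc I ?f z - 1 / 4))"
      using integrable_acc_HP(1)[OF m b, of I] by simp
    show "integrable (PiM I (\<lambda>_. H)) (acc I metropolis_ratio)"
      by (rule integrable_acc_HP[OF m0 metropolis_ratio_abs_le])
  qed
  finally show ?thesis by simp
qed

end

section \<open>Reversibility of Metropolis proposals\<close>

text \<open>\<open>T x \<xi>\<close> is the proposal as a function of the noise, \<open>q\<close>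
  its density and \<open>W\<close> the log acceptance ratio. The locale is used twice: for a single
  coordinate, to estimate the mean of \<open>W\<close>, and for the whole chain, to prove
  reversibility.\<close>

locale metropolis_proposal = M: sigma_finite_measure M + K: prob_space K
  for M :: "'a measure" and K :: "'b measure" +
  fixes p :: "'a \<Rightarrow> real" and q :: "'a \<Rightarrow> 'a \<Rightarrow> real" and T :: "'a \<Rightarrow> 'b \<Rightarrow> 'a"
    and W :: "'a \<Rightarrow> 'a \<Rightarrow> real"
  assumes p_measurable [measurable]: "p \<in> borel_measurable M"
    and q_measurable: "(\<lambda>(x, y). q x y) \<in> borel_measurable (M \<Otimes>\<^sub>M M)"
    and W_measurable: "(\<lambda>(x, y). W x y) \<in> borel_measurable (M \<Otimes>\<^sub>M M)"
    and T_measurable: "(\<lambda>(x, \<xi>). T x \<xi>) \<in> measurable (M \<Otimes>\<^sub>M K) M"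
    and p_nonneg: "\<And>x. p x \<ge> 0" and q_nonneg: "\<And>x y. q x y \<ge> 0"
    and prob_target: "prob_space (density M (\<lambda>x. ennreal (p x)))"
    and proposal: "\<And>x. x \<in> space M \<Longrightarrow> distr K M (T x) = density M (\<lambda>y. ennreal (q x y))"
    and balance: "\<And>x y. x \<in> space M \<Longrightarrow> y \<in> space M \<Longrightarrow> p y * q y x = p x * q x y * exp (W x y)"
begin

abbreviation target :: "'a measure" where "target \<equiv> density M (\<lambda>x. ennreal (p x))"

sublocale target: prob_space target by (rule prob_target)
sublocale MM: pair_sigma_finite M M ..
sublocale TK: pair_prob_space target K ..

lemma q_measurable' [measurable (raw)]:
  "f \<in> measurable L M \<Longrightarrow> g \<in> measurable L M \<Longrightarrow> (\<lambda>x. q (f x) (g x)) \<in> borel_measurable L"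
  using measurable_compose[OF measurable_Pair q_measurable, of f L g] by simp

lemma W_measurable' [measurable (raw)]:
  "f \<in> measurable L M \<Longrightarrow> g \<in> measurable L M \<Longrightarrow> (\<lambda>x. W (f x) (g x)) \<in> borel_measurable L"
  using measurable_compose[OF measurable_Pair W_measurable, of f L g] by simp

lemma T_measurable' [measurable (raw)]:
  "f \<in> measurable L M \<Longrightarrow> g \<in> measurable L K \<Longrightarrow> (\<lambda>x. T (f x) (g x)) \<in> measurable L M"
  using measurable_compose[OF measurable_Pair T_measurable, of f L g] by simp

lemma nn_integral_proposal:
  assumes [measurable]: "f \<in> borel_measurable M" and x [measurable]: "x \<in> space M"
  shows "(\<integral>\<^sup>+\<xi>. f (T x \<xi>) \<partial>K) = (\<integral>\<^sup>+y. ennreal (q x y) * f y \<partial>M)"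
proof -
  have "(\<integral>\<^sup>+\<xi>. f (T x \<xi>) \<partial>K) = (\<integral>\<^sup>+y. f y \<partial>distr K M (T x))"
    by (rule nn_integral_distr[symmetric]) measurable
  also have "\<dots> = (\<integral>\<^sup>+y. ennreal (q x y) * f y \<partial>M)"
    unfolding proposal[OF x] by (rule nn_integral_density) measurable
  finally show ?thesis .
qed

lemma nn_integral_joint:
  assumes F [measurable]: "case_prod F \<in> borel_measurable (M \<Otimes>\<^sub>M M)"
  shows "(\<integral>\<^sup>+(x, \<xi>). F x (T x \<xi>) \<partial>(target \<Otimes>\<^sub>M K)) =
    (\<integral>\<^sup>+x. (\<integral>\<^sup>+y. ennreal (p x * q x y) * F x y \<partial>M) \<partial>M)"
proof -
  have F' [measurable (raw)]: "f \<in> measurable L M \<Longrightarrow> g \<in> measurable L M \<Longrightarrow> (\<lambda>x. F (f x) (g x)) \<in> borel_measurable L"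
    for f g and L :: "('a \<times> 'b) measure"
    using measurable_compose[OF measurable_Pair F, of f L g] by simp
  have F'' [measurable (raw)]: "f \<in> measurable L M \<Longrightarrow> g \<in> measurable L M \<Longrightarrow> (\<lambda>x. F (f x) (g x)) \<in> borel_measurable L"
    for f g and L :: "('a) measure"
    using measurable_compose[OF measurable_Pair F, of f L g] by simp
  have m: "(\<lambda>(x, \<xi>). F x (T x \<xi>)) \<in> borel_measurable (M \<Otimes>\<^sub>M K)" by measurable
  have "sets (target \<Otimes>\<^sub>M K) = sets (M \<Otimes>\<^sub>M K)" by (intro sets_pair_measure_cong) auto
  then have m': "(\<lambda>(x, \<xi>). F x (T x \<xi>)) \<in> borel_measurable (target \<Otimes>\<^sub>M K)"
    using m by (simp cong: measurable_cong_sets)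
  have m'': "(\<lambda>x. \<integral>\<^sup>+\<xi>. F x (T x \<xi>) \<partial>K) \<in> borel_measurable M"
    using K.borel_measurable_nn_integral[OF m] by simp
  have "(\<integral>\<^sup>+(x, \<xi>). F x (T x \<xi>) \<partial>(target \<Otimes>\<^sub>M K)) = (\<integral>\<^sup>+x. (\<integral>\<^sup>+\<xi>. F x (T x \<xi>) \<partial>K) \<partial>target)"
    using K.nn_integral_fst[OF m'] by simp
  also have "\<dots> = (\<integral>\<^sup>+x. ennreal (p x) * (\<integral>\<^sup>+\<xi>. F x (T x \<xi>) \<partial>K) \<partial>M)"
    by (rule nn_integral_density) (use m'' in measurable)
  also have "\<dots> = (\<integral>\<^sup>+x. ennreal (p x) * (\<integral>\<^sup>+y. ennreal (q x y) * F x y \<partial>M) \<partial>M)"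
  proof (rule nn_integral_cong)
    fix x assume x: "x \<in> space M"
    then have "F x \<in> borel_measurable M" using F by measurable
    from nn_integral_proposal[OF this x]
    show "ennreal (p x) * (\<integral>\<^sup>+\<xi>. F x (T x \<xi>) \<partial>K) = ennreal (p x) * (\<integral>\<^sup>+y. ennreal (q x y) * F x y \<partial>M)" by simp
  qed
  also have "\<dots> = (\<integral>\<^sup>+x. (\<integral>\<^sup>+y. ennreal (p x * q x y) * F x y \<partial>M) \<partial>M)"
    by (intro nn_integral_cong)
       (auto simp: nn_integral_cmult[symmetric] ennreal_mult p_nonneg q_nonneg mult.assoc)
  finally show ?thesis .
qed

text \<open>exp W is the density of the swapped pair (proposal, state) relative to the pair (state,
  proposal): \<open>balance\<close> rewrites the joint density, and Tonelli exchanges the two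
  variables.\<close>

lemma nn_integral_swap:
  assumes F [measurable]: "case_prod F \<in> borel_measurable (M \<Otimes>\<^sub>M M)"
  shows "(\<integral>\<^sup>+(x, \<xi>). F x (T x \<xi>) * ennreal (exp (W x (T x \<xi>))) \<partial>(target \<Otimes>\<^sub>M K)) =
    (\<integral>\<^sup>+(x, \<xi>). F (T x \<xi>) x \<partial>(target \<Otimes>\<^sub>M K))"
proof -
  have mF: "(\<lambda>(x, y). F x y * ennreal (exp (W x y))) \<in> borel_measurable (M \<Otimes>\<^sub>M M)"
    "(\<lambda>(x, y). F y x) \<in> borel_measurable (M \<Otimes>\<^sub>M M)" "(\<lambda>(x, y). ennreal (p y * q y x) * F x y) \<in> borel_measurable (M \<Otimes>\<^sub>M M)"
    using measurable_pair_swap[OF F] by (auto simp: split_beta')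
  have "(\<integral>\<^sup>+(x, \<xi>). F x (T x \<xi>) * ennreal (exp (W x (T x \<xi>))) \<partial>(target \<Otimes>\<^sub>M K)) =
     (\<integral>\<^sup>+x. (\<integral>\<^sup>+y. ennreal (p x * q x y) * (F x y * ennreal (exp (W x y))) \<partial>M) \<partial>M)"
    by (rule nn_integral_joint[OF mF(1)])
  also have "\<dots> = (\<integral>\<^sup>+x. (\<integral>\<^sup>+y. ennreal (p y * q y x) * F x y \<partial>M) \<partial>M)"
  proof (intro nn_integral_cong)
    fix x y assume "x \<in> space M" "y \<in> space M"
    from balance[OF this] have "ennreal (p y * q y x) = ennreal (p x * q x y) * ennreal (exp (W x y))"
      by (simp add: ennreal_mult'')
    then show "ennreal (p x * q x y) * (F x y * ennreal (exp (W x y))) = ennreal (p y * q y x) * F x y"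
      by (simp add: mult_ac)
  qed
  also have "\<dots> = (\<integral>\<^sup>+y. (\<integral>\<^sup>+x. ennreal (p y * q y x) * F x y \<partial>M) \<partial>M)"
    using MM.Fubini[OF mF(3)] by simp
  also have "\<dots> = (\<integral>\<^sup>+(x, \<xi>). F (T x \<xi>) x \<partial>(target \<Otimes>\<^sub>M K))"
    by (rule nn_integral_joint[OF mF(2), symmetric])
  finally show ?thesis .
qed

text \<open>The swap as an equality of measures, which transfers integrability along with signed
  integrals.\<close>

lemma distr_swap:
  "distr (density (target \<Otimes>\<^sub>M K) (\<lambda>(x, \<xi>). ennreal (exp (W x (T x \<xi>))))) (M \<Otimes>\<^sub>M M) (\<lambda>(x, \<xi>). (x, T x \<xi>)) =
   distr (target \<Otimes>\<^sub>M K) (M \<Otimes>\<^sub>M M) (\<lambda>(x, \<xi>). (T x \<xi>, x))" (is "?A = ?B")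
proof (rule measure_eqI)
  fix A assume "A \<in> sets ?A"
  then have A [measurable]: "A \<in> sets (M \<Otimes>\<^sub>M M)" by simp
  have s: "sets (target \<Otimes>\<^sub>M K) = sets (M \<Otimes>\<^sub>M K)" by (intro sets_pair_measure_cong) auto
  have m: "(\<lambda>(x, \<xi>). (x, T x \<xi>)) \<in> measurable (M \<Otimes>\<^sub>M K) (M \<Otimes>\<^sub>M M)"
     "(\<lambda>(x, \<xi>). (T x \<xi>, x)) \<in> measurable (M \<Otimes>\<^sub>M K) (M \<Otimes>\<^sub>M M)"
     "(\<lambda>(x, \<xi>). ennreal (exp (W x (T x \<xi>)))) \<in> borel_measurable (M \<Otimes>\<^sub>M K)" by measurable
  have m' [measurable]: "(\<lambda>(x, \<xi>). (x, T x \<xi>)) \<in> measurable (target \<Otimes>\<^sub>M K) (M \<Otimes>\<^sub>M M)"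
     "(\<lambda>(x, \<xi>). (T x \<xi>, x)) \<in> measurable (target \<Otimes>\<^sub>M K) (M \<Otimes>\<^sub>M M)"
     "(\<lambda>(x, \<xi>). ennreal (exp (W x (T x \<xi>)))) \<in> borel_measurable (target \<Otimes>\<^sub>M K)"
    unfolding measurable_cong_sets[OF s refl] by (rule m)+
  have "emeasure ?A A = (\<integral>\<^sup>+z. indicator A z \<partial>?A)" by simp
  also have "\<dots> = (\<integral>\<^sup>+(x, \<xi>). indicator A (x, T x \<xi>) * ennreal (exp (W x (T x \<xi>))) \<partial>(target \<Otimes>\<^sub>M K))"
    by (subst nn_integral_distr) (auto simp: nn_integral_density split_beta' mult.commute)
  also have "\<dots> = (\<integral>\<^sup>+(x, \<xi>). indicator A (T x \<xi>, x) \<partial>(target \<Otimes>\<^sub>M K))"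
    by (rule nn_integral_swap[of "\<lambda>x y. indicator A (x, y)"]) simp
  also have "\<dots> = (\<integral>\<^sup>+z. indicator A z \<partial>?B)"
    by (subst nn_integral_distr) (auto simp: split_beta')
  also have "\<dots> = emeasure ?B A" by simp
  finally show "emeasure ?A A = emeasure ?B A" .
qed simp

lemma integral_swap:
  fixes F :: "'a \<Rightarrow> 'a \<Rightarrow> real"
  assumes F [measurable]: "case_prod F \<in> borel_measurable (M \<Otimes>\<^sub>M M)"
  shows integrable_swap: "integrable (target \<Otimes>\<^sub>M K) (\<lambda>(x, \<xi>). F x (T x \<xi>) * exp (W x (T x \<xi>))) \<longleftrightarrow>
      integrable (target \<Otimes>\<^sub>M K) (\<lambda>(x, \<xi>). F (T x \<xi>) x)"
    and "(\<integral>(x, \<xi>). F x (T x \<xi>) * exp (W x (T x \<xi>)) \<partial>(target \<Otimes>\<^sub>M K)) =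
      (\<integral>(x, \<xi>). F (T x \<xi>) x \<partial>(target \<Otimes>\<^sub>M K))"
proof -
  have s: "sets (target \<Otimes>\<^sub>M K) = sets (M \<Otimes>\<^sub>M K)" by (intro sets_pair_measure_cong) auto
  have F' [measurable (raw)]: "f \<in> measurable L M \<Longrightarrow> g \<in> measurable L M \<Longrightarrow> (\<lambda>x. F (f x) (g x)) \<in> borel_measurable L"
    for f g and L :: "('a \<times> 'b) measure"
    using measurable_compose[OF measurable_Pair F, of f L g] by simp
  have m: "(\<lambda>(x, \<xi>). (x, T x \<xi>)) \<in> measurable (M \<Otimes>\<^sub>M K) (M \<Otimes>\<^sub>M M)"
     "(\<lambda>(x, \<xi>). (T x \<xi>, x)) \<in> measurable (M \<Otimes>\<^sub>M K) (M \<Otimes>\<^sub>M M)"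
     "(\<lambda>(x, \<xi>). exp (W x (T x \<xi>))) \<in> borel_measurable (M \<Otimes>\<^sub>M K)"
     "(\<lambda>(x, \<xi>). F x (T x \<xi>)) \<in> borel_measurable (M \<Otimes>\<^sub>M K)" by measurable
  have m' [measurable]: "(\<lambda>(x, \<xi>). (x, T x \<xi>)) \<in> measurable (target \<Otimes>\<^sub>M K) (M \<Otimes>\<^sub>M M)"
     "(\<lambda>(x, \<xi>). (T x \<xi>, x)) \<in> measurable (target \<Otimes>\<^sub>M K) (M \<Otimes>\<^sub>M M)"
     "(\<lambda>(x, \<xi>). exp (W x (T x \<xi>))) \<in> borel_measurable (target \<Otimes>\<^sub>M K)"
     "(\<lambda>(x, \<xi>). F x (T x \<xi>)) \<in> borel_measurable (target \<Otimes>\<^sub>M K)"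
    unfolding measurable_cong_sets[OF s refl] by (rule m)+
  let ?D = "density (target \<Otimes>\<^sub>M K) (\<lambda>(x, \<xi>). ennreal (exp (W x (T x \<xi>))))"
  have dens: "?D = density (target \<Otimes>\<^sub>M K) (\<lambda>z. ennreal (case z of (x, \<xi>) \<Rightarrow> exp (W x (T x \<xi>))))"
    by (simp add: split_beta')
  have me: "(\<lambda>z. case_prod F (case z of (x, \<xi>) \<Rightarrow> (x, T x \<xi>))) \<in> borel_measurable (target \<Otimes>\<^sub>M K)"
     "(\<lambda>(x, \<xi>). exp (W x (T x \<xi>))) \<in> borel_measurable (target \<Otimes>\<^sub>M K)"
     "AE z in target \<Otimes>\<^sub>M K. 0 \<le> (case z of (x, \<xi>) \<Rightarrow> exp (W x (T x \<xi>)))"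
    using m'(4) m'(3) by (auto simp: split_beta')
  have m2: "(\<lambda>(x, \<xi>). (x, T x \<xi>)) \<in> measurable ?D (M \<Otimes>\<^sub>M M)" by simp
  have "integrable (target \<Otimes>\<^sub>M K) (\<lambda>(x, \<xi>). F (T x \<xi>) x) \<longleftrightarrow>
      integrable (distr (target \<Otimes>\<^sub>M K) (M \<Otimes>\<^sub>M M) (\<lambda>(x, \<xi>). (T x \<xi>, x))) (case_prod F)"
    by (subst integrable_distr_eq) (auto simp: split_beta')
  also have "\<dots> \<longleftrightarrow> integrable ?D (\<lambda>z. case_prod F (case z of (x, \<xi>) \<Rightarrow> (x, T x \<xi>)))"
    unfolding distr_swap[symmetric] by (rule integrable_distr_eq[OF m2 F])
  also have "\<dots> \<longleftrightarrow> integrable (target \<Otimes>\<^sub>M K) (\<lambda>(x, \<xi>). F x (T x \<xi>) * exp (W x (T x \<xi>)))"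
    using integrable_density[OF me(1) me(2) me(3)] unfolding dens by (simp add: split_beta' mult.commute)
  finally show "integrable (target \<Otimes>\<^sub>M K) (\<lambda>(x, \<xi>). F x (T x \<xi>) * exp (W x (T x \<xi>))) \<longleftrightarrow>
      integrable (target \<Otimes>\<^sub>M K) (\<lambda>(x, \<xi>). F (T x \<xi>) x)" ..
  have "(\<integral>(x, \<xi>). F (T x \<xi>) x \<partial>(target \<Otimes>\<^sub>M K)) =
      integral\<^sup>L (distr (target \<Otimes>\<^sub>M K) (M \<Otimes>\<^sub>M M) (\<lambda>(x, \<xi>). (T x \<xi>, x))) (case_prod F)"
    by (subst integral_distr) (auto simp: split_beta')
  also have "\<dots> = (\<integral>z. case_prod F (case z of (x, \<xi>) \<Rightarrow> (x, T x \<xi>)) \<partial>?D)"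
    unfolding distr_swap[symmetric] by (rule integral_distr[OF m2 F])
  also have "\<dots> = (\<integral>(x, \<xi>). F x (T x \<xi>) * exp (W x (T x \<xi>)) \<partial>(target \<Otimes>\<^sub>M K))"
    using integral_density[OF me(1) me(2) me(3)] unfolding dens by (simp add: split_beta' mult.commute)
  finally show "(\<integral>(x, \<xi>). F x (T x \<xi>) * exp (W x (T x \<xi>)) \<partial>(target \<Otimes>\<^sub>M K)) =
      (\<integral>(x, \<xi>). F (T x \<xi>) x \<partial>(target \<Otimes>\<^sub>M K))" ..
qed

text \<open>Antisymmetry and the swap give E[w exp w] = - E[w] and E[w^2 exp w] = E[w^2]. Hence 2
  |E[w]| = |E[w (exp w - 1)]| \<le> E[w^2 (1 + exp w)] = 2 E[w^2].\<close>

lemma abs_integral_log_ratio_le: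
  assumes anti: "\<And>x y. W y x = - W x y"
    and i: "integrable (target \<Otimes>\<^sub>M K) (\<lambda>(x, \<xi>). W x (T x \<xi>))"
      "integrable (target \<Otimes>\<^sub>M K) (\<lambda>(x, \<xi>). (W x (T x \<xi>))\<^sup>2)"
  shows "\<bar>\<integral>(x, \<xi>). W x (T x \<xi>) \<partial>(target \<Otimes>\<^sub>M K)\<bar> \<le> (\<integral>(x, \<xi>). (W x (T x \<xi>))\<^sup>2 \<partial>(target \<Otimes>\<^sub>M K))"
proof -
  let ?J = "target \<Otimes>\<^sub>M K"
  define w where "w = (\<lambda>(x, \<xi>). W x (T x \<xi>))"
  have m1: "case_prod W \<in> borel_measurable (M \<Otimes>\<^sub>M M)" "(\<lambda>(x, y). (W x y)\<^sup>2) \<in> borel_measurable (M \<Otimes>\<^sub>M M)"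
    by measurable
  have swap: "W (T x \<xi>) x = - W x (T x \<xi>)" for x \<xi> by (rule anti)
  have i0: "integrable ?J w" "integrable ?J (\<lambda>z. (w z)\<^sup>2)"
    using i by (simp_all add: w_def split_beta')
  have i1: "integrable ?J (\<lambda>z. w z * exp (w z))" and e1: "(\<integral>z. w z * exp (w z) \<partial>?J) = - (\<integral>z. w z \<partial>?J)"
    using integrable_swap[OF m1(1)] integral_swap(2)[OF m1(1)] i0 by (simp_all add: w_def split_beta' swap)
  have i2: "integrable ?J (\<lambda>z. (w z)\<^sup>2 * exp (w z))" and e2: "(\<integral>z. (w z)\<^sup>2 * exp (w z) \<partial>?J) = (\<integral>z. (w z)\<^sup>2 \<partial>?J)"
    using integrable_swap[OF m1(2)] integral_swap(2)[OF m1(2)] i0 by (simp_all add: w_def split_beta' swap)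
  have pt: "\<bar>w z * (exp (w z) - 1)\<bar> \<le> (w z)\<^sup>2 + (w z)\<^sup>2 * exp (w z)" for z
  proof -
    let ?u = "w z"
    have a: "?u \<le> exp ?u - 1" using exp_ge_add_one_self[of ?u] by linarith
    have "exp ?u * (1 - ?u) \<le> exp ?u * exp (- ?u)"
      using exp_ge_add_one_self[of "- ?u"] by (intro mult_left_mono) auto
    then have c: "exp ?u - 1 \<le> ?u * exp ?u" by (simp add: exp_minus algebra_simps)
    \<comment> \<open>The increment of exp from 0 to u is at most |u| times the larger end value,
      which is below 1 + exp u.\<close>
    have "\<bar>exp ?u - 1\<bar> \<le> \<bar>?u\<bar> * (1 + exp ?u)"
    proof (cases "?u \<ge> 0")
      case True
      then have "exp ?u - 1 \<ge> 0" by simp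
      then show ?thesis using c True by (simp add: algebra_simps)
    next
      case False
      then have "exp ?u - 1 \<le> 0" by simp
      moreover have "\<bar>?u\<bar> * exp ?u \<ge> 0" by simp
      moreover have "\<bar>?u\<bar> * (1 + exp ?u) = \<bar>?u\<bar> + \<bar>?u\<bar> * exp ?u" by (simp add: algebra_simps)
      ultimately show ?thesis using a False by linarith
    qed
    then have "\<bar>?u\<bar> * \<bar>exp ?u - 1\<bar> \<le> \<bar>?u\<bar> * (\<bar>?u\<bar> * (1 + exp ?u))"
      by (rule mult_left_mono) simp
    also have "\<bar>?u\<bar> * (\<bar>?u\<bar> * (1 + exp ?u)) = ?u\<^sup>2 * (1 + exp ?u)"
      by (simp only: mult.assoc[symmetric] abs_mult_self_eq power2_eq_square)
    finally show ?thesis by (simp only: abs_mult distrib_left mult_1_right)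
  qed
  have "\<bar>- 2 * (\<integral>z. w z \<partial>?J)\<bar> = \<bar>\<integral>z. w z * (exp (w z) - 1) \<partial>?J\<bar>"
    using i0 i1 e1 by (simp add: right_diff_distrib)
  also have "\<dots> \<le> (\<integral>z. \<bar>w z * (exp (w z) - 1)\<bar> \<partial>?J)"
    by simp
  also have "\<dots> \<le> (\<integral>z. (w z)\<^sup>2 + (w z)\<^sup>2 * exp (w z) \<partial>?J)"
    using i0 i1 i2 pt by (intro integral_mono) (auto simp: right_diff_distrib)
  also have "\<dots> = 2 * (\<integral>z. (w z)\<^sup>2 \<partial>?J)"
    using i0 i2 e2 by simp
  finally show ?thesis by (simp add: w_def split_beta')
qed

end

section \<open>Expansion of the one-site log ratio\<close>

text \<open>\<open>deriv\<close> is total and returns some value even where no derivative exists, so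
  differentiability has to be recorded at every order. A finite order n allows induction.\<close>

definition differentiable_times :: "nat \<Rightarrow> (real \<Rightarrow> real) \<Rightarrow> bool" where
  "differentiable_times n f \<longleftrightarrow> (\<forall>k<n. \<forall>x. (deriv ^^ k) f field_differentiable (at x))"

lemma differentiable_times_0 [simp]: "differentiable_times 0 f"
  by (simp add: differentiable_times_def)

lemma differentiable_times_Suc:
  "differentiable_times (Suc n) f \<longleftrightarrow> (\<forall>x. f field_differentiable (at x)) \<and> differentiable_times n (deriv f)"
proof -
  have *: "(deriv ^^ Suc k) f = (deriv ^^ k) (deriv f)" for k
    by (simp add: funpow_swap1)
  show ?thesis
    unfolding differentiable_times_def All_less_Suc2 * by (simp add: fun_eq_iff)
qed

lemma differentiable_times_le: "differentiable_times n f \<Longrightarrow> m \<le> n \<Longrightarrow> differentiable_times m f"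
  by (auto simp: differentiable_times_def)

lemma differentiable_times_add:
  "differentiable_times n f \<Longrightarrow> differentiable_times n g \<Longrightarrow> differentiable_times n (\<lambda>x. f x + g x)"
proof (induction n arbitrary: f g)
  case (Suc n)
  then have d: "f field_differentiable (at x)" "g field_differentiable (at x)" for x
    by (auto simp: differentiable_times_Suc)
  have "deriv (\<lambda>x. f x + g x) = (\<lambda>x. deriv f x + deriv g x)"
    by (rule ext, rule deriv_add[OF d])
  with Suc d show ?case by (auto simp: differentiable_times_Suc intro: field_differentiable_add)
qed simp

lemma differentiable_times_mult:
  "differentiable_times n f \<Longrightarrow> differentiable_times n g \<Longrightarrow> differentiable_times n (\<lambda>x. f x * g x)"
proof (induction n arbitrary: f g)
  case (Suc n)
  then have d: "f field_differentiable (at x)" "g field_differentiable (at x)" for x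
    by (auto simp: differentiable_times_Suc)
  have "deriv (\<lambda>x. f x * g x) = (\<lambda>x. f x * deriv g x + deriv f x * g x)"
    by (rule ext, rule deriv_mult[OF d])
  moreover have "differentiable_times n f" "differentiable_times n g"
    using Suc.prems differentiable_times_le by (meson le_SucI order_refl)+
  ultimately show ?case
    using Suc.prems Suc.IH d
    by (auto simp: differentiable_times_Suc intro!: field_differentiable_mult differentiable_times_add)
qed simp

text \<open>The derivative of 1/f is - f' (1/f)^2, which involves only f' and 1/f again, one order
  lower; so the induction closes with the product rule.\<close>

lemma differentiable_times_inverse:
  assumes "\<And>x. f x \<noteq> 0"
  shows "differentiable_times n f \<Longrightarrow> differentiable_times n (\<lambda>x. inverse (f x))"
proof (induction n)
  case (Suc n)
  then have d: "f field_differentiable (at x)" for x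
    by (auto simp: differentiable_times_Suc)
  have D: "((\<lambda>x. inverse (f x)) has_field_derivative ((- 1) * deriv f x * (inverse (f x) * inverse (f x)))) (at x)" for x
    using DERIV_inverse_fun[OF DERIV_deriv_iff_field_differentiable[THEN iffD2, OF d] assms]
    by (simp add: mult_ac numeral_2_eq_2)
  have "deriv (\<lambda>x. inverse (f x)) = (\<lambda>x. (- 1) * deriv f x * (inverse (f x) * inverse (f x)))"
    by (rule ext, rule DERIV_imp_deriv[OF D])
  moreover have "differentiable_times n (\<lambda>x. (- 1) * deriv f x * (inverse (f x) * inverse (f x)))"
  proof (intro differentiable_times_mult)
    show "differentiable_times n (\<lambda>x. - 1)"
    proof -
      have "deriv (\<lambda>x. c) = (\<lambda>x. 0)" for c :: real by (rule ext) simp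
      then have "differentiable_times n (\<lambda>x. c)" for c :: real
        by (induction n arbitrary: c) (auto simp: differentiable_times_Suc)
      then show ?thesis .
    qed
    show "differentiable_times n (\<lambda>x. inverse (f x))" "differentiable_times n (deriv f)"
      using Suc differentiable_times_le[of "Suc n" f n] by (auto simp: differentiable_times_Suc)
    then show "differentiable_times n (\<lambda>x. inverse (f x))" by simp
  qed
  ultimately show ?case
    using D by (auto simp: differentiable_times_Suc field_differentiable_def)
qed simp

section \<open>Polynomial growth and orders in s\<close>

definition poly_bounded :: "(real \<Rightarrow> real) \<Rightarrow> bool" where
  "poly_bounded f \<longleftrightarrow> (\<exists>C n. \<forall>x. \<bar>f x\<bar> \<le> C * (1 + \<bar>x\<bar>) ^ n)"

lemma poly_bounded_poly: "poly_bounded (poly p)"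
proof (induction p)
  case 0
  show ?case unfolding poly_bounded_def by (intro exI[of _ 0]) simp
next
  case (pCons a p)
  then obtain C n where C: "\<And>x. \<bar>poly p x\<bar> \<le> C * (1 + \<bar>x\<bar>) ^ n" by (auto simp: poly_bounded_def)
  show ?case unfolding poly_bounded_def
  proof (intro exI allI)
    fix x :: real
    let ?u = "1 + \<bar>x\<bar>"
    have "\<bar>x * poly p x\<bar> \<le> ?u * (C * ?u ^ n)"
      unfolding abs_mult using C[of x] by (intro mult_mono) auto
    moreover have "\<bar>a\<bar> * 1 \<le> \<bar>a\<bar> * ?u ^ Suc n"
      by (intro mult_left_mono one_le_power) auto
    ultimately show "\<bar>poly (pCons a p) x\<bar> \<le> (\<bar>a\<bar> + C) * ?u ^ Suc n"
      using abs_triangle_ineq[of a "x * poly p x"] by (simp add: algebra_simps)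
  qed
qed

text \<open>\<open>dom_order k F\<close> means \<open>F s x \<xi> = O(s\<^sup>k)\<close> up to factors of polynomial growth in \<open>x\<close> and \<open>\<xi>\<close>.\<close>

definition dom_order :: "nat \<Rightarrow> (real \<Rightarrow> real \<Rightarrow> real \<Rightarrow> real) \<Rightarrow> bool" where
  "dom_order k F \<longleftrightarrow> (\<exists>C\<ge>0. \<exists>n. \<forall>s x \<xi>. 0 < s \<longrightarrow> s \<le> 1 \<longrightarrow>
     \<bar>F s x \<xi>\<bar> \<le> C * s ^ k * ((1 + \<bar>x\<bar>) * (1 + \<bar>\<xi>\<bar>)) ^ n)"

lemma weight_ge_1: "1 \<le> (1 + \<bar>x\<bar>) * (1 + \<bar>\<xi>\<bar>)" for x \<xi> :: real
  by (simp add: algebra_simps)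

lemma dom_orderE:
  assumes "dom_order k F"
  obtains C n where "C \<ge> 0"
    "\<And>s x \<xi>. 0 < s \<Longrightarrow> s \<le> 1 \<Longrightarrow> \<bar>F s x \<xi>\<bar> \<le> C * s ^ k * ((1 + \<bar>x\<bar>) * (1 + \<bar>\<xi>\<bar>)) ^ n"
  using assms unfolding dom_order_def by blast

lemma dom_order_le:
  assumes "dom_order k G" "\<And>s x \<xi>. 0 < s \<Longrightarrow> s \<le> 1 \<Longrightarrow> \<bar>F s x \<xi>\<bar> \<le> \<bar>G s x \<xi>\<bar>"
  shows "dom_order k F"
  using assms unfolding dom_order_def by (meson order_trans)

lemma dom_order_add:
  assumes "dom_order k F" "dom_order k G"
  shows "dom_order k (\<lambda>s x \<xi>. F s x \<xi> + G s x \<xi>)"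
proof -
  obtain C n where C: "C \<ge> 0" "\<And>s x \<xi>. 0 < s \<Longrightarrow> s \<le> 1 \<Longrightarrow> \<bar>F s x \<xi>\<bar> \<le> C * s ^ k * ((1 + \<bar>x\<bar>) * (1 + \<bar>\<xi>\<bar>)) ^ n"
    by (rule dom_orderE[OF assms(1)]) blast
  obtain D m where D: "D \<ge> 0" "\<And>s x \<xi>. 0 < s \<Longrightarrow> s \<le> 1 \<Longrightarrow> \<bar>G s x \<xi>\<bar> \<le> D * s ^ k * ((1 + \<bar>x\<bar>) * (1 + \<bar>\<xi>\<bar>)) ^ m"
    by (rule dom_orderE[OF assms(2)]) blast
  show ?thesis unfolding dom_order_def
  proof (intro exI[of _ "C + D"] exI[of _ "n + m"] conjI allI impI)
    fix s x \<xi> :: real assume s: "0 < s" "s \<le> 1"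
    let ?u = "(1 + \<bar>x\<bar>) * (1 + \<bar>\<xi>\<bar>)"
    have "\<bar>F s x \<xi>\<bar> \<le> C * s ^ k * ?u ^ (n + m)"
      using C(1) s by (intro order_trans[OF C(2)[OF s]] mult_left_mono power_increasing weight_ge_1) auto
    moreover have "\<bar>G s x \<xi>\<bar> \<le> D * s ^ k * ?u ^ (n + m)"
      using D(1) s by (intro order_trans[OF D(2)[OF s]] mult_left_mono power_increasing weight_ge_1) auto
    ultimately show "\<bar>F s x \<xi> + G s x \<xi>\<bar> \<le> (C + D) * s ^ k * ?u ^ (n + m)"
      unfolding distrib_right by linarith
  qed (use C D in auto)
qed

lemma dom_order_mult:
  assumes "dom_order k F" "dom_order l G"
  shows "dom_order (k + l) (\<lambda>s x \<xi>. F s x \<xi> * G s x \<xi>)"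
proof -
  obtain C n where C: "C \<ge> 0" "\<And>s x \<xi>. 0 < s \<Longrightarrow> s \<le> 1 \<Longrightarrow> \<bar>F s x \<xi>\<bar> \<le> C * s ^ k * ((1 + \<bar>x\<bar>) * (1 + \<bar>\<xi>\<bar>)) ^ n"
    by (rule dom_orderE[OF assms(1)]) blast
  obtain D m where D: "D \<ge> 0" "\<And>s x \<xi>. 0 < s \<Longrightarrow> s \<le> 1 \<Longrightarrow> \<bar>G s x \<xi>\<bar> \<le> D * s ^ l * ((1 + \<bar>x\<bar>) * (1 + \<bar>\<xi>\<bar>)) ^ m"
    by (rule dom_orderE[OF assms(2)]) blast
  show ?thesis unfolding dom_order_def
  proof (intro exI[of _ "C * D"] exI[of _ "n + m"] conjI allI impI)
    fix s x \<xi> :: real assume s: "0 < s" "s \<le> 1"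
    let ?u = "(1 + \<bar>x\<bar>) * (1 + \<bar>\<xi>\<bar>)"
    have "\<bar>F s x \<xi> * G s x \<xi>\<bar> \<le> (C * s ^ k * ?u ^ n) * (D * s ^ l * ?u ^ m)"
      unfolding abs_mult using C D s by (intro mult_mono C(2) D(2)) auto
    then show "\<bar>F s x \<xi> * G s x \<xi>\<bar> \<le> C * D * s ^ (k + l) * ?u ^ (n + m)"
      by (simp add: power_add mult_ac)
  qed (use C D in auto)
qed

lemma dom_order_mono:
  assumes "dom_order k F" "l \<le> k" shows "dom_order l F"
proof -
  obtain C n where C: "C \<ge> 0" "\<And>s x \<xi>. 0 < s \<Longrightarrow> s \<le> 1 \<Longrightarrow> \<bar>F s x \<xi>\<bar> \<le> C * s ^ k * ((1 + \<bar>x\<bar>) * (1 + \<bar>\<xi>\<bar>)) ^ n"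
    by (rule dom_orderE[OF assms(1)]) blast
  show ?thesis unfolding dom_order_def
  proof (intro exI[of _ C] exI[of _ n] conjI allI impI C)
    fix s x \<xi> :: real assume s: "0 < s" "s \<le> 1"
    show "\<bar>F s x \<xi>\<bar> \<le> C * s ^ l * ((1 + \<bar>x\<bar>) * (1 + \<bar>\<xi>\<bar>)) ^ n"
      using C(1) s assms(2) by (intro order_trans[OF C(2)[OF s]] mult_right_mono mult_left_mono power_decreasing) auto
  qed
qed

lemma dom_order_mult': "dom_order k F \<Longrightarrow> dom_order l G \<Longrightarrow> m \<le> k + l \<Longrightarrow>
    dom_order m (\<lambda>s x \<xi>. F s x \<xi> * G s x \<xi>)"
  using dom_order_mult dom_order_mono by blast

lemma dom_order_power: "dom_order k F \<Longrightarrow> dom_order (k * j) (\<lambda>s x \<xi>. F s x \<xi> ^ j)"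
proof (induction j)
  case 0
  show ?case unfolding dom_order_def by (intro exI[of _ 1] conjI exI[of _ 0]) auto
qed (use dom_order_mult in auto)

lemma dom_order_power': "dom_order k F \<Longrightarrow> m \<le> k * j \<Longrightarrow> dom_order m (\<lambda>s x \<xi>. F s x \<xi> ^ j)"
  using dom_order_power dom_order_mono by blast

lemma dom_order_const: "dom_order 0 (\<lambda>s x \<xi>. c)"
  unfolding dom_order_def by (intro exI[of _ "\<bar>c\<bar>"] conjI exI[of _ 0]) auto

lemma dom_order_cmult: "dom_order k F \<Longrightarrow> dom_order k (\<lambda>s x \<xi>. c * F s x \<xi>)"
  using dom_order_mult[OF dom_order_const, of k F c] by simp

lemma dom_order_diff: "dom_order k F \<Longrightarrow> dom_order k G \<Longrightarrow> dom_order k (\<lambda>s x \<xi>. F s x \<xi> - G s x \<xi>)"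
  using dom_order_add[OF _ dom_order_cmult, of k F G "- 1"] by simp

lemma dom_order_abs: "dom_order k F \<Longrightarrow> dom_order k (\<lambda>s x \<xi>. \<bar>F s x \<xi>\<bar>)"
  by (rule dom_order_le) auto

lemma dom_order_scale: "dom_order 1 (\<lambda>s x \<xi>. s)"
  unfolding dom_order_def by (intro exI[of _ "1"] conjI exI[of _ 0]) auto

lemma dom_order_poly_bounded:
  assumes "poly_bounded f" shows "dom_order 0 (\<lambda>s x \<xi>. f x)"
proof -
  obtain C n where C: "\<And>x. \<bar>f x\<bar> \<le> C * (1 + \<bar>x\<bar>) ^ n" using assms by (auto simp: poly_bounded_def)
  have "C \<ge> 0" using C[of 0] by simp
  show ?thesis unfolding dom_order_def
  proof (intro exI[of _ C] exI[of _ n] conjI allI impI \<open>C \<ge> 0\<close>)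
    fix s x \<xi> :: real
    have "(1 + \<bar>x\<bar>) * 1 \<le> (1 + \<bar>x\<bar>) * (1 + \<bar>\<xi>\<bar>)" by (intro mult_left_mono) auto
    then show "\<bar>f x\<bar> \<le> C * s ^ 0 * ((1 + \<bar>x\<bar>) * (1 + \<bar>\<xi>\<bar>)) ^ n"
      using \<open>C \<ge> 0\<close> by (simp, intro order_trans[OF C] mult_left_mono power_mono) auto
  qed
qed

lemma dom_order_space: "dom_order 0 (\<lambda>s x \<xi>. x)"
  by (rule dom_order_poly_bounded) (auto simp: poly_bounded_def intro!: exI[of _ 1])

lemma dom_order_noise: "dom_order 0 (\<lambda>s x \<xi>. \<xi>)"
proof -
  have "\<bar>\<xi>\<bar> \<le> (1 + \<bar>x\<bar>) * (1 + \<bar>\<xi>\<bar>)" for x \<xi> :: real by (simp add: algebra_simps)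
  then show ?thesis unfolding dom_order_def by (intro exI[of _ 1] conjI exI[of _ 1]) auto
qed

lemma taylor_bound:
  fixes f :: "nat \<Rightarrow> real \<Rightarrow> real"
  assumes d: "\<And>m x. m < n \<Longrightarrow> (f m has_real_derivative f (Suc m) x) (at x)"
    and K: "\<And>t. \<bar>t\<bar> \<le> \<bar>\<delta>\<bar> \<Longrightarrow> \<bar>f n (x + t)\<bar> \<le> K"
  shows "\<bar>f 0 (x + \<delta>) - (\<Sum>m<n. f m x / fact m * \<delta> ^ m)\<bar> \<le> K * \<bar>\<delta>\<bar> ^ n / fact n"
proof -
  have "\<exists>t. \<bar>t\<bar> \<le> \<bar>\<delta>\<bar> \<and> f 0 (x + \<delta>) =
     (\<Sum>m<n. f m (x + 0) / fact m * \<delta> ^ m) + f n (x + t) / fact n * \<delta> ^ n"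
  proof (rule Maclaurin_bi_le[of "\<lambda>m t. f m (x + t)" "\<lambda>t. f 0 (x + t)"])
    show "\<forall>m t. m < n \<and> \<bar>t\<bar> \<le> \<bar>\<delta>\<bar> \<longrightarrow> ((\<lambda>t. f m (x + t)) has_real_derivative f (Suc m) (x + t)) (at t)"
      using d by (auto simp: DERIV_shift[symmetric] add.commute)
  qed simp
  then obtain t where t: "\<bar>t\<bar> \<le> \<bar>\<delta>\<bar>"
    "f 0 (x + \<delta>) - (\<Sum>m<n. f m x / fact m * \<delta> ^ m) = f n (x + t) / fact n * \<delta> ^ n" by auto
  have "\<bar>f n (x + t) / fact n * \<delta> ^ n\<bar> = \<bar>f n (x + t)\<bar> * \<bar>\<delta>\<bar> ^ n / fact n"
    by (simp add: abs_mult power_abs)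
  also have "\<dots> \<le> K * \<bar>\<delta>\<bar> ^ n / fact n"
    by (intro divide_right_mono mult_right_mono K t) auto
  finally show ?thesis unfolding t(2) .
qed

text \<open>Lagrange remainders are evaluated at an unknown point between x and x + \<delta>; this
  majorant does not depend on that point.\<close>

lemma dom_order_bounded_shift:
  assumes f: "poly_bounded f" and \<delta>: "dom_order 0 \<delta>"
  obtains K where "dom_order 0 K" "\<And>s x \<xi> t. \<bar>t\<bar> \<le> \<bar>\<delta> s x \<xi>\<bar> \<Longrightarrow> \<bar>f (x + t)\<bar> \<le> K s x \<xi>"
proof -
  obtain C n where C: "\<And>x. \<bar>f x\<bar> \<le> C * (1 + \<bar>x\<bar>) ^ n" using f by (auto simp: poly_bounded_def)
  have C0: "C \<ge> 0" using C[of 0] by simp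
  show thesis
  proof
    show "dom_order 0 (\<lambda>s x \<xi>. C * (1 + \<bar>x\<bar> + \<bar>\<delta> s x \<xi>\<bar>) ^ n)"
      by (intro dom_order_cmult dom_order_power'[of 0] dom_order_add dom_order_const dom_order_abs dom_order_space \<delta>) auto
    fix s x \<xi> t assume "\<bar>t\<bar> \<le> \<bar>\<delta> s x \<xi>\<bar>"
    then show "\<bar>f (x + t)\<bar> \<le> C * (1 + \<bar>x\<bar> + \<bar>\<delta> s x \<xi>\<bar>) ^ n"
      using C0 by (intro order_trans[OF C] mult_left_mono power_mono) auto
  qed
qed

section \<open>The standard Gaussian noise\<close>

definition gauss :: "real measure" where "gauss = density lborel (\<lambda>x. ennreal (std_normal_density x))"

lemma prob_space_gauss: "prob_space gauss"
  unfolding gauss_def by (rule prob_space_normal_density) simp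

interpretation gauss: prob_space gauss by (rule prob_space_gauss)

lemma sets_gauss [simp, measurable_cong]: "sets gauss = sets borel" and space_gauss [simp]: "space gauss = UNIV"
  by (simp_all add: gauss_def)

lemma gauss_integrable: "f \<in> borel_measurable borel \<Longrightarrow> integrable gauss f \<longleftrightarrow> integrable lborel (\<lambda>x. std_normal_density x * f x)"
  for f :: "real \<Rightarrow> real"
  unfolding gauss_def by (subst integrable_density) auto

lemma gauss_integral: "f \<in> borel_measurable borel \<Longrightarrow> integral\<^sup>L gauss f = (\<integral>x. std_normal_density x * f x \<partial>lborel)"
  for f :: "real \<Rightarrow> real"
  unfolding gauss_def by (subst integral_density) auto

lemma weight_power_le: "(1 + \<bar>x\<bar>) ^ n \<le> 2 ^ n * (1 + \<bar>x\<bar> ^ n)" for x :: real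
proof -
  have "(1 + \<bar>x\<bar>) ^ n \<le> (2 * max 1 \<bar>x\<bar>) ^ n" by (intro power_mono) auto
  also have "\<dots> = 2 ^ n * max 1 \<bar>x\<bar> ^ n" by (rule power_mult_distrib)
  also have "max 1 \<bar>x\<bar> ^ n \<le> 1 + \<bar>x\<bar> ^ n" by (cases "1 \<le> \<bar>x\<bar>") (auto simp: max_def)
  finally show ?thesis by simp
qed

lemma integrable_weight:
  fixes M :: "real measure"
  assumes "prob_space M" and [measurable_cong]: "sets M = sets borel" and "integrable M (\<lambda>x. \<bar>x\<bar> ^ n)"
  shows "integrable M (\<lambda>x. (1 + \<bar>x\<bar>) ^ n)"
proof (rule Bochner_Integration.integrable_bound)
  interpret prob_space M by fact
  show "integrable M (\<lambda>x. 2 ^ n * (1 + \<bar>x\<bar> ^ n))" using assms by simp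
  show "(\<lambda>x. (1 + \<bar>x\<bar>) ^ n) \<in> borel_measurable M" by measurable
  have "\<bar>(1 + \<bar>x\<bar>) ^ n\<bar> \<le> \<bar>2 ^ n * (1 + \<bar>x\<bar> ^ n)\<bar>" for x :: real
    using weight_power_le[of x n] by (auto simp: abs_mult)
  then show "AE x in M. norm ((1 + \<bar>x\<bar>) ^ n) \<le> norm (2 ^ n * (1 + \<bar>x\<bar> ^ n))" by simp
qed

lemma gauss_weight: "integrable gauss (\<lambda>\<xi>. (1 + \<bar>\<xi>\<bar>) ^ n)"
  by (rule integrable_weight[OF prob_space_gauss]) (simp_all add: gauss_integrable integrable_std_normal_moment_abs)

lemma gauss_moments:
  shows "(\<integral>\<xi>. \<xi> \<partial>gauss) = 0" "(\<integral>\<xi>. \<xi>\<^sup>2 \<partial>gauss) = 1" "(\<integral>\<xi>. \<xi> ^ 3 \<partial>gauss) = 0"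
    "integrable gauss (\<lambda>\<xi>. \<xi> ^ k)"
  using integral_std_normal_moment_odd[of 0] integral_std_normal_moment_odd[of 1]
    integral_std_normal_moment_even[of 1] integrable_std_normal_moment[of k]
  by (simp_all add: gauss_integral gauss_integrable eval_nat_numeral)

lemma dom_order_integrable:
  assumes "dom_order k F" "0 < s" "s \<le> 1" and [measurable]: "F s x \<in> borel_measurable borel"
  shows "integrable gauss (F s x)"
proof -
  obtain C n where C: "C \<ge> 0" "\<And>s x \<xi>. 0 < s \<Longrightarrow> s \<le> 1 \<Longrightarrow> \<bar>F s x \<xi>\<bar> \<le> C * s ^ k * ((1 + \<bar>x\<bar>) * (1 + \<bar>\<xi>\<bar>)) ^ n"
    by (rule dom_orderE[OF assms(1)]) blast
  show ?thesis
  proof (rule Bochner_Integration.integrable_bound)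
    show "integrable gauss (\<lambda>\<xi>. C * s ^ k * (1 + \<bar>x\<bar>) ^ n * (1 + \<bar>\<xi>\<bar>) ^ n)"
      using gauss_weight by simp
    have "\<bar>F s x \<xi>\<bar> \<le> \<bar>C * s ^ k * (1 + \<bar>x\<bar>) ^ n * (1 + \<bar>\<xi>\<bar>) ^ n\<bar>" for \<xi>
      using C(2)[OF assms(2,3), of x \<xi>] by (simp add: power_mult_distrib mult_ac)
    then show "AE \<xi> in gauss. norm (F s x \<xi>) \<le> norm (C * s ^ k * (1 + \<bar>x\<bar>) ^ n * (1 + \<bar>\<xi>\<bar>) ^ n)" by simp
  qed measurable
qed

lemma dom_order_integral:
  assumes "dom_order k F"
  shows "dom_order k (\<lambda>s x \<xi>. \<integral>\<eta>. F s x \<eta> \<partial>gauss)"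
proof -
  obtain C n where C: "C \<ge> 0" "\<And>s x \<xi>. 0 < s \<Longrightarrow> s \<le> 1 \<Longrightarrow> \<bar>F s x \<xi>\<bar> \<le> C * s ^ k * ((1 + \<bar>x\<bar>) * (1 + \<bar>\<xi>\<bar>)) ^ n"
    by (rule dom_orderE[OF assms(1)]) blast
  define m where "m = (\<integral>\<eta>. (1 + \<bar>\<eta>\<bar>) ^ n \<partial>gauss)"
  have m: "m \<ge> 0" by (simp add: m_def)
  show ?thesis unfolding dom_order_def
  proof (intro exI[of _ "C * m"] exI[of _ n] conjI allI impI)
    show "0 \<le> C * m" using C m by simp
    fix s x \<xi> :: real assume s: "0 < s" "s \<le> 1"
    have w: "(1 + \<bar>x\<bar>) * 1 \<le> (1 + \<bar>x\<bar>) * (1 + \<bar>\<xi>\<bar>)" by (intro mult_left_mono) auto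
    have "\<bar>\<integral>\<eta>. F s x \<eta> \<partial>gauss\<bar> \<le> C * s ^ k * (1 + \<bar>x\<bar>) ^ n * m"
    proof (cases "integrable gauss (F s x)")
      case True
      have "\<bar>\<integral>\<eta>. F s x \<eta> \<partial>gauss\<bar> \<le> (\<integral>\<eta>. \<bar>F s x \<eta>\<bar> \<partial>gauss)" by simp
      also have "\<dots> \<le> (\<integral>\<eta>. C * s ^ k * (1 + \<bar>x\<bar>) ^ n * (1 + \<bar>\<eta>\<bar>) ^ n \<partial>gauss)"
        using True gauss_weight C(2)[OF s, of x]
        by (intro integral_mono) (auto simp: power_mult_distrib mult_ac)
      finally show ?thesis by (simp add: m_def)
    qed (use C m s in \<open>simp add: not_integrable_integral_eq\<close>)
    also have "\<dots> \<le> C * s ^ k * ((1 + \<bar>x\<bar>) * (1 + \<bar>\<xi>\<bar>)) ^ n * m"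
      using C m s w by (intro mult_right_mono mult_left_mono power_mono) auto
    finally show "\<bar>\<integral>\<eta>. F s x \<eta> \<partial>gauss\<bar> \<le> C * m * s ^ k * ((1 + \<bar>x\<bar>) * (1 + \<bar>\<xi>\<bar>)) ^ n"
      by (simp add: mult_ac)
  qed
qed

locale langevin_density =
  fixes h :: "real \<Rightarrow> real"
  assumes h_pos: "\<And>x. 0 < h x"
    and h_density: "has_bochner_integral lborel h 1"
    and h_smooth: "\<And>k. (deriv ^^ k) h differentiable_on UNIV"
    and log_h_derivs: "\<And>k::nat. k \<ge> 1 \<Longrightarrow>
          \<exists>P :: real poly. \<forall>x. \<bar>(deriv ^^ k) (\<lambda>u. ln (h u)) x\<bar> \<le> poly P x"
    and h_moments: "\<And>k::nat. integrable lborel (\<lambda>x. \<bar>x\<bar> ^ k * h x)"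
    and h_score_lipschitz: "\<exists>L. L-lipschitz_on UNIV (\<lambda>x. deriv h x / h x)"
begin

text \<open>\<open>V 0\<close> is ln h, for which no growth bound is assumed; it occurs below only
  through differences and their Taylor remainders.\<close>

definition V :: "nat \<Rightarrow> real \<Rightarrow> real" where "V k = (deriv ^^ k) (\<lambda>u. ln (h u))"

definition score :: "real \<Rightarrow> real" where "score x = deriv h x / h x"

lemma h_DERIV: "((deriv ^^ k) h has_real_derivative (deriv ^^ Suc k) h x) (at x)"
  using h_smooth[of k] by (auto simp: differentiable_on_def DERIV_deriv_iff_real_differentiable)

lemma h_DERIV1: "(h has_real_derivative deriv h x) (at x)"
  using h_DERIV[of 0] by simp

lemma ln_h_DERIV: "((\<lambda>u. ln (h u)) has_real_derivative score x) (at x)"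
  unfolding score_def using DERIV_ln_divide[OF h_pos] h_DERIV1
  by (auto intro!: derivative_eq_intros simp: h_pos divide_simps)

lemma V_0: "V 0 x = ln (h x)" by (simp add: V_def)

lemma V_1: "V (Suc 0) = score"
  by (rule ext) (simp add: V_def DERIV_imp_deriv[OF ln_h_DERIV])

text \<open>The assumed bounds on iterated \<open>deriv\<close> of ln h do not by themselves give
  differentiability. It comes from the smoothness of h, by writing (ln h)' = h' (1/h) with h
  positive.\<close>

lemma V_DERIV: "(V k has_real_derivative V (Suc k) x) (at x)"
proof -
  have h: "differentiable_times n h" for n
    using h_DERIV by (auto simp: differentiable_times_def field_differentiable_def)
  have "deriv (\<lambda>u. ln (h u)) = (\<lambda>x. deriv h x * inverse (h x))"
    using V_1 by (simp add: V_def score_def[abs_def] divide_inverse)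
  moreover have "differentiable_times n (\<lambda>x. deriv h x * inverse (h x))" for n
    using h[of n] h[of "Suc n"] h_pos
    by (intro differentiable_times_mult differentiable_times_inverse) (auto simp: differentiable_times_Suc less_imp_neq[symmetric])
  ultimately have "differentiable_times (Suc n) (\<lambda>u. ln (h u))" for n
    using ln_h_DERIV by (auto simp: differentiable_times_Suc field_differentiable_def)
  from this[of k] have "V k field_differentiable (at x)"
    by (auto simp: differentiable_times_def V_def)
  then show ?thesis
    using DERIV_deriv_iff_field_differentiable by (auto simp: V_def)
qed

lemma V_poly_bounded: assumes "k \<ge> 1" shows "poly_bounded (V k)"
proof -
  obtain P where P: "\<And>x. \<bar>V k x\<bar> \<le> poly P x" using log_h_derivs[OF assms] by (auto simp: V_def)
  obtain C n where C: "\<And>x. \<bar>poly P x\<bar> \<le> C * (1 + \<bar>x\<bar>) ^ n"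
    using poly_bounded_poly[of P] by (auto simp: poly_bounded_def)
  have "\<bar>V k x\<bar> \<le> C * (1 + \<bar>x\<bar>) ^ n" for x
    using P[of x] C[of x] by linarith
  then show ?thesis by (auto simp: poly_bounded_def)
qed

lemma score_poly_bounded: "poly_bounded score"
  using V_poly_bounded[of "Suc 0"] by (simp add: V_1)

lemma V_measurable [measurable]: "V k \<in> borel_measurable borel"
  by (intro borel_measurable_continuous_onI DERIV_continuous_on[OF DERIV_subset[OF V_DERIV]]) auto

lemma score_measurable [measurable]: "score \<in> borel_measurable borel"
  using V_measurable[of "Suc 0"] by (simp only: V_1)

lemma h_measurable [measurable]: "h \<in> borel_measurable borel"
  by (intro borel_measurable_continuous_onI DERIV_continuous_on[OF DERIV_subset[OF h_DERIV1]]) auto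

definition H :: "real measure" where "H = density lborel (\<lambda>x. ennreal (h x))"

lemma sets_H [simp, measurable_cong]: "sets H = sets borel" and space_H [simp]: "space H = UNIV"
  by (simp_all add: H_def)

sublocale H: prob_space H
proof
  have "emeasure H (space H) = (\<integral>\<^sup>+x. ennreal (h x) \<partial>lborel)"
    unfolding H_def by (subst emeasure_density) auto
  also have "\<dots> = 1"
    using h_density h_pos by (subst nn_integral_eq_integral) (auto simp: has_bochner_integral_iff less_imp_le)
  finally show "emeasure H (space H) = 1" .
qed

lemma H_integrable: "f \<in> borel_measurable borel \<Longrightarrow> integrable H f \<longleftrightarrow> integrable lborel (\<lambda>x. h x * f x)"
  for f :: "real \<Rightarrow> real"
  unfolding H_def using h_pos by (subst integrable_density) (auto simp: less_imp_le)

lemma H_integral: "f \<in> borel_measurable borel \<Longrightarrow> integral\<^sup>L H f = (\<integral>x. h x * f x \<partial>lborel)"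
  for f :: "real \<Rightarrow> real"
  unfolding H_def using h_pos by (subst integral_density) (auto simp: less_imp_le)

lemma H_weight: "integrable H (\<lambda>x. (1 + \<bar>x\<bar>) ^ n)"
  by (rule integrable_weight[OF H.prob_space_axioms]) (use h_moments in \<open>simp_all add: H_integrable mult.commute\<close>)

text \<open>Turns an order in s into a bound on the mean under \<open>H\<close> with a constant
  uniform in s. The moments of h enter here, through \<open>H_weight\<close>.\<close>

lemma dom_order_H:
  assumes "dom_order k (\<lambda>s x \<xi>. f s x)" and [measurable]: "\<And>s. f s \<in> borel_measurable borel"
  obtains C where "C \<ge> 0" "\<And>s. 0 < s \<Longrightarrow> s \<le> 1 \<Longrightarrow> integrable H (f s) \<and> \<bar>\<integral>x. f s x \<partial>H\<bar> \<le> C * s ^ k"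
proof -
  obtain C n where C: "C \<ge> 0" "\<And>s x \<xi>. 0 < s \<Longrightarrow> s \<le> 1 \<Longrightarrow> \<bar>f s x\<bar> \<le> C * s ^ k * ((1 + \<bar>x\<bar>) * (1 + \<bar>\<xi>\<bar>)) ^ n"
    by (rule dom_orderE[OF assms(1)]) blast
  define m where "m = (\<integral>x. (1 + \<bar>x\<bar>) ^ n \<partial>H)"
  have m: "m \<ge> 0" by (simp add: m_def)
  show thesis
  proof (rule that[of "C * m"])
    show "C * m \<ge> 0" using C m by simp
    fix s :: real assume s: "0 < s" "s \<le> 1"
    have b: "\<bar>f s x\<bar> \<le> C * s ^ k * (1 + \<bar>x\<bar>) ^ n" for x using C(2)[OF s, of x 0] by simp
    have i: "integrable H (f s)"
    proof (rule Bochner_Integration.integrable_bound)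
      show "integrable H (\<lambda>x. C * s ^ k * (1 + \<bar>x\<bar>) ^ n)" using H_weight by simp
      show "AE x in H. norm (f s x) \<le> norm (C * s ^ k * (1 + \<bar>x\<bar>) ^ n)"
        using b C(1) s by (auto simp: abs_mult intro!: AE_I2)
    qed measurable
    have "\<bar>\<integral>x. f s x \<partial>H\<bar> \<le> (\<integral>x. \<bar>f s x\<bar> \<partial>H)" by simp
    also have "\<dots> \<le> (\<integral>x. C * s ^ k * (1 + \<bar>x\<bar>) ^ n \<partial>H)"
      using i H_weight b by (intro integral_mono) auto
    finally show "integrable H (f s) \<and> \<bar>\<integral>x. f s x \<partial>H\<bar> \<le> C * m * s ^ k"
      using i by (simp add: m_def mult_ac)
  qed
qed

end

lemma measure_gauss_UNIV [simp]: "measure gauss UNIV = 1"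
  using gauss.prob_space by simp

lemma poly_bounded_of_dom_order:
  assumes "dom_order 0 (\<lambda>s x \<xi>. f x)" shows "poly_bounded f"
proof -
  obtain C n where "\<And>s x \<xi>. 0 < s \<Longrightarrow> s \<le> 1 \<Longrightarrow> \<bar>f x\<bar> \<le> C * s ^ 0 * ((1 + \<bar>x\<bar>) * (1 + \<bar>\<xi>\<bar>)) ^ n"
    by (rule dom_orderE[OF assms]) blast
  from this[of 1 _ 0] show ?thesis by (auto simp: poly_bounded_def)
qed

lemma lipschitz_poly_bounded:
  fixes f :: "real \<Rightarrow> real"
  assumes "L-lipschitz_on UNIV f" shows "poly_bounded f"
  unfolding poly_bounded_def
proof (intro exI allI)
  fix x
  have "\<bar>f x - f 0\<bar> \<le> L * \<bar>x - 0\<bar>"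
    using lipschitz_onD[OF assms, of x 0] by (simp add: dist_real_def)
  moreover have "L \<ge> 0" using lipschitz_on_nonneg[OF assms] .
  moreover have "\<bar>f 0\<bar> * \<bar>x\<bar> \<ge> 0" by simp
  ultimately show "\<bar>f x\<bar> \<le> (\<bar>f 0\<bar> + L) * (1 + \<bar>x\<bar>) ^ 1"
    unfolding power_one_right distrib_left distrib_right mult_1_right diff_0_right by linarith
qed

section \<open>The log ratio of one coordinate and its moments\<close>

context langevin_density
begin

definition disp :: "real \<Rightarrow> real \<Rightarrow> real \<Rightarrow> real" where
  "disp s x \<xi> = s\<^sup>2 / 2 * score x + s * \<xi>"

definition move :: "real \<Rightarrow> real \<Rightarrow> real \<Rightarrow> real" where
  "move s x \<xi> = x + disp s x \<xi>"

text \<open>ln (h y q(y,x) / (h x q(x,y))) after expanding the two Gaussian exponents: their (y -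
  x)^2 terms cancel, and the mixed terms form the trapezoidal rule for the integral of the score
  from x to y.\<close>

definition log_ratio :: "real \<Rightarrow> real \<Rightarrow> real \<Rightarrow> real" where
  "log_ratio s x y = ln (h y) - ln (h x) - (y - x) * (score y + score x) / 2
     - s\<^sup>2 / 8 * ((score y)\<^sup>2 - (score x)\<^sup>2)"

definition w :: "real \<Rightarrow> real \<Rightarrow> real \<Rightarrow> real" where
  "w s x \<xi> = log_ratio s x (move s x \<xi>)"

text \<open>With \<delta> = \<open>disp s x \<xi>\<close>, the part odd in \<xi> of - V 3 x
  \<delta>^3 / 12 - s^2 score x V 2 x \<delta> / 4. All odd terms are kept, also the one of order
  s^5, so that the Gaussian mean is exactly 0.\<close>

definition w_odd :: "real \<Rightarrow> real \<Rightarrow> real \<Rightarrow> real" where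
  "w_odd s x \<xi> = - (V 3 x / 12 * s ^ 3) * \<xi> ^ 3
     - (V 3 x / 4 * (s\<^sup>2 / 2 * score x)\<^sup>2 * s + s ^ 3 / 4 * score x * V 2 x) * \<xi>"

lemma disp_measurable [measurable (raw)]:
  assumes [measurable]: "f \<in> borel_measurable K" "g \<in> borel_measurable K"
  shows "(\<lambda>x. disp s (f x) (g x)) \<in> borel_measurable K"
  unfolding disp_def by measurable

lemma move_measurable [measurable (raw)]:
  assumes [measurable]: "f \<in> borel_measurable K" "g \<in> borel_measurable K"
  shows "(\<lambda>x. move s (f x) (g x)) \<in> borel_measurable K"
  unfolding move_def by measurable

lemma log_ratio_measurable [measurable (raw)]:
  assumes [measurable]: "f \<in> borel_measurable K" "g \<in> borel_measurable K"
  shows "(\<lambda>x. log_ratio s (f x) (g x)) \<in> borel_measurable K"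
  unfolding log_ratio_def by measurable

lemma w_measurable [measurable (raw)]:
  assumes [measurable]: "f \<in> borel_measurable K" "g \<in> borel_measurable K"
  shows "(\<lambda>x. w s (f x) (g x)) \<in> borel_measurable K"
  unfolding w_def by measurable

lemma w_odd_measurable [measurable (raw)]:
  assumes [measurable]: "f \<in> borel_measurable K" "g \<in> borel_measurable K"
  shows "(\<lambda>x. w_odd s (f x) (g x)) \<in> borel_measurable K"
  unfolding w_odd_def by measurable

lemma dom_order_V: "k \<ge> 1 \<Longrightarrow> dom_order 0 (\<lambda>s x \<xi>. V k x)"
  by (intro dom_order_poly_bounded V_poly_bounded)

lemma dom_order_score: "dom_order 0 (\<lambda>s x \<xi>. score x)"
  by (intro dom_order_poly_bounded score_poly_bounded)

lemma dom_order_center: "dom_order 2 (\<lambda>s x \<xi>. s\<^sup>2 / 2 * score x)"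
proof -
  have "dom_order 2 (\<lambda>s x \<xi>. (1 / 2) * (s\<^sup>2 * score x))"
    by (intro dom_order_cmult dom_order_mult'[OF dom_order_power'[OF dom_order_scale order_refl] dom_order_score]) auto
  then show ?thesis by simp
qed

lemma dom_order_s_noise: "dom_order 1 (\<lambda>s x \<xi>. s * \<xi>)"
  by (rule dom_order_mult'[OF dom_order_scale dom_order_noise]) simp

lemma dom_order_disp: "dom_order 1 disp"
  unfolding disp_def[abs_def]
  by (intro dom_order_add dom_order_s_noise dom_order_mono[OF dom_order_center]) simp

lemma dom_order_w_odd: "dom_order 3 w_odd"
proof -
  have s3: "dom_order 3 (\<lambda>s x \<xi>. s ^ 3)" by (rule dom_order_power'[OF dom_order_scale]) simp
  have c2: "dom_order 4 (\<lambda>s x \<xi>. (s\<^sup>2 / 2 * score x)\<^sup>2)" by (rule dom_order_power'[OF dom_order_center]) simp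
  have n3: "dom_order 0 (\<lambda>s x \<xi>. \<xi> ^ 3)" by (rule dom_order_power'[OF dom_order_noise]) simp
  have 1: "dom_order 3 (\<lambda>s x \<xi>. (V 3 x * s ^ 3) * \<xi> ^ 3)"
    using dom_order_mult[OF dom_order_mult[OF dom_order_V[of 3] s3] n3] by simp
  have 2: "dom_order 3 (\<lambda>s x \<xi>. (V 3 x * (s\<^sup>2 / 2 * score x)\<^sup>2) * (s * \<xi>))"
    using dom_order_mult'[OF dom_order_mult[OF dom_order_V[of 3] c2] dom_order_s_noise, of 3] by simp
  have 3: "dom_order 3 (\<lambda>s x \<xi>. ((s ^ 3 * score x) * V 2 x) * \<xi>)"
    using dom_order_mult[OF dom_order_mult[OF dom_order_mult[OF s3 dom_order_score] dom_order_V[of 2]] dom_order_noise] by simp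
  have "dom_order 3 (\<lambda>s x \<xi>. (- 1 / 12) * ((V 3 x * s ^ 3) * \<xi> ^ 3) -
     ((1 / 4) * ((V 3 x * (s\<^sup>2 / 2 * score x)\<^sup>2) * (s * \<xi>)) + (1 / 4) * (((s ^ 3 * score x) * V 2 x) * \<xi>)))"
    by (intro dom_order_diff dom_order_add dom_order_cmult 1 2 3)
  moreover have "w_odd = (\<lambda>s x \<xi>. (- 1 / 12) * ((V 3 x * s ^ 3) * \<xi> ^ 3) -
     ((1 / 4) * ((V 3 x * (s\<^sup>2 / 2 * score x)\<^sup>2) * (s * \<xi>)) + (1 / 4) * (((s ^ 3 * score x) * V 2 x) * \<xi>)))"
    by (simp add: w_odd_def fun_eq_iff algebra_simps)
  ultimately show ?thesis by simp
qed

text \<open>The trapezoidal rule has error \<open>- V''' \<delta>\<^sup>3 / 12 + O(\<delta>\<^sup>4)\<close>; this is why \<open>w\<close> has size \<open>s\<^sup>3\<close>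
  and, up to \<open>O(s\<^sup>4)\<close>, is odd in the Gaussian noise.\<close>

lemma dom_order_w_sub_odd: "dom_order 4 (\<lambda>s x \<xi>. w s x \<xi> - w_odd s x \<xi>)"
proof -
  let ?c = "\<lambda>s x. s\<^sup>2 / 2 * score x"
  have \<delta>0: "dom_order 0 disp" by (rule dom_order_mono[OF dom_order_disp]) simp
  obtain K where K: "dom_order 0 K" "\<And>s x \<xi> t. \<bar>t\<bar> \<le> \<bar>disp s x \<xi>\<bar> \<Longrightarrow> \<bar>V 4 (x + t)\<bar> \<le> K s x \<xi>"
    using dom_order_bounded_shift[OF V_poly_bounded[of 4] \<delta>0] by auto
  \<comment> \<open>The second derivative of the squared score.\<close>
  define D where "D x = 2 * ((V 2 x)\<^sup>2 + score x * V 3 x)" for x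
  have "poly_bounded D"
    unfolding D_def
    by (intro poly_bounded_of_dom_order dom_order_cmult dom_order_add dom_order_power'[OF dom_order_V]
         dom_order_mult'[OF dom_order_score dom_order_V]) auto
  then obtain K' where K': "dom_order 0 K'" "\<And>s x \<xi> t. \<bar>t\<bar> \<le> \<bar>disp s x \<xi>\<bar> \<Longrightarrow> \<bar>D (x + t)\<bar> \<le> K' s x \<xi>"
    using dom_order_bounded_shift[OF _ \<delta>0] by auto
  \<comment> \<open>\<open>B\<close> collects the Taylor remainders, with 1/24 from ln h plus 1/12
    from the score giving 1/8. \<open>E\<close> below collects the leading terms that are even in
    \<xi>; each contains the factor s^2 score / 2 and at least two further powers of s.\<close>
  define B where "B = (\<lambda>s x \<xi>. (1 / 8) * (K s x \<xi> * disp s x \<xi> ^ 4) + (1 / 16) * (K' s x \<xi> * (s\<^sup>2 * disp s x \<xi> ^ 2)))"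
  define E where "E = (\<lambda>s x \<xi>. (- 1 / 12) * (V 3 x * (?c s x ^ 3 + 3 * (?c s x * (s * \<xi>)\<^sup>2)))
      - (1 / 4) * (score x * V 2 x * (s\<^sup>2 * ?c s x)))"
  have dB: "dom_order 4 B"
    unfolding B_def
    by (intro dom_order_add dom_order_cmult dom_order_mult'[OF K(1) dom_order_power'[OF dom_order_disp order_refl]]
        dom_order_mult'[OF K'(1) dom_order_mult'[OF dom_order_power'[OF dom_order_scale order_refl] dom_order_power'[OF dom_order_disp order_refl] order_refl]]) auto
  have dE: "dom_order 4 E"
    unfolding E_def
    by (intro dom_order_diff dom_order_cmult
          dom_order_mult'[OF dom_order_V[of 3], of 4]
          dom_order_mult'[OF dom_order_mult'[OF dom_order_score dom_order_V order_refl], of _ 4]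
          dom_order_add dom_order_power'[OF dom_order_center]
          dom_order_mult'[OF dom_order_center dom_order_power'[OF dom_order_s_noise order_refl]]
          dom_order_mult'[OF dom_order_power'[OF dom_order_scale order_refl] dom_order_center]) auto
  have bound: "\<bar>w s x \<xi> - w_odd s x \<xi> - E s x \<xi>\<bar> \<le> B s x \<xi>" for s x \<xi>
  proof -
    let ?d = "disp s x \<xi>" and ?y = "x + disp s x \<xi>"
    have sums: "(\<Sum>m<4. f m) = f 0 + f 1 + f 2 + f 3" "(\<Sum>m<3. f m) = f 0 + f 1 + f 2" "(\<Sum>m<2. f m) = f 0 + f 1"
      for f :: "nat \<Rightarrow> real" by (simp_all add: eval_nat_numeral)
    define R1 where "R1 = V 0 ?y - (V 0 x + score x * ?d + V 2 x / 2 * ?d ^ 2 + V 3 x / 6 * ?d ^ 3)"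
    define R2 where "R2 = score ?y - (score x + V 2 x * ?d + V 3 x / 2 * ?d ^ 2)"
    define R3 where "R3 = (score ?y)\<^sup>2 - ((score x)\<^sup>2 + 2 * score x * V 2 x * ?d)"
    have V1': "V 1 = score" using V_1 by simp
    have T1: "\<bar>R1\<bar> \<le> K s x \<xi> * \<bar>?d\<bar> ^ 4 / 24"
      using taylor_bound[of 4 V ?d x "K s x \<xi>", OF V_DERIV K(2)]
      by (simp add: sums V_1 R1_def fact_numeral)
    \<comment> \<open>With the index shifted by one, the third-order remainder for the score is
      controlled by the same \<open>V 4\<close>.\<close>
    have "\<bar>V (Suc 0) (x + ?d) - (\<Sum>m<3. V (Suc m) x / fact m * ?d ^ m)\<bar> \<le> K s x \<xi> * \<bar>?d\<bar> ^ 3 / fact 3"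
      by (rule taylor_bound[of 3 "\<lambda>m. V (Suc m)", OF V_DERIV]) (use K(2) in \<open>simp add: eval_nat_numeral\<close>)
    then have T2: "\<bar>R2\<bar> \<le> K s x \<xi> * \<bar>?d\<bar> ^ 3 / 6"
      by (simp add: sums R2_def fact_numeral V_1 flip: numeral_eq_Suc) (simp add: eval_nat_numeral V_1)
    define f where "f m = (if m = 0 then (\<lambda>x. (score x)\<^sup>2) else if m = Suc 0 then (\<lambda>x. 2 * (score x * V 2 x)) else D)" for m :: nat
    have sD: "(score has_real_derivative V 2 x) (at x)" for x
      using V_DERIV[of "Suc 0"] by (simp add: V_1 numeral_2_eq_2)
    have vD: "(V 2 has_real_derivative V 3 x) (at x)" for x
      using V_DERIV[of 2] by simp
    have "\<bar>f 0 (x + ?d) - (\<Sum>m<2. f m x / fact m * ?d ^ m)\<bar> \<le> K' s x \<xi> * \<bar>?d\<bar> ^ 2 / fact 2"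
    proof (rule taylor_bound)
      fix m x assume "m < (2::nat)"
      then consider "m = 0" | "m = Suc 0" by linarith
      then show "(f m has_real_derivative f (Suc m) x) (at x)"
        by cases (auto simp: f_def D_def power2_eq_square intro!: derivative_eq_intros sD vD)
    qed (use K'(2) in \<open>simp add: f_def\<close>)
    then have T3: "\<bar>R3\<bar> \<le> K' s x \<xi> * ?d ^ 2 / 2"
      by (simp add: sums f_def R3_def algebra_simps)
    have eq: "w s x \<xi> - w_odd s x \<xi> - E s x \<xi> = R1 - ?d / 2 * R2 - s\<^sup>2 / 8 * R3"
    proof -
      define c where "c = ?c s x"
      have d: "?d = c + s * \<xi>" by (simp add: disp_def c_def)
      have w: "w s x \<xi> = V 0 ?y - V 0 x - ?d * (score ?y + score x) / 2 - s\<^sup>2 / 8 * ((score ?y)\<^sup>2 - (score x)\<^sup>2)"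
        by (simp add: w_def log_ratio_def move_def V_0)
      have o: "w_odd s x \<xi> = - (V 3 x / 12 * s ^ 3) * \<xi> ^ 3 - (V 3 x / 4 * c\<^sup>2 * s + s ^ 3 / 4 * score x * V 2 x) * \<xi>"
        by (simp add: w_odd_def c_def)
      have e: "E s x \<xi> = (- 1 / 12) * (V 3 x * (c ^ 3 + 3 * (c * (s * \<xi>)\<^sup>2))) - (1 / 4) * (score x * V 2 x * (s\<^sup>2 * c))"
        by (simp add: E_def c_def)
      \<comment> \<open>First and second order cancel between ln h and the trapezoidal rule; at
        third order 1/6 - 1/4 leaves - 1/12.\<close>
      have "w s x \<xi> - (R1 - ?d / 2 * R2 - s\<^sup>2 / 8 * R3) = - (V 3 x / 12) * ?d ^ 3 - s\<^sup>2 / 4 * score x * V 2 x * ?d"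
        unfolding w R1_def R2_def R3_def by (simp add: field_simps power2_eq_square power3_eq_cube)
      also have "\<dots> = w_odd s x \<xi> + E s x \<xi>"
        unfolding o e d by (simp add: field_simps power2_eq_square power3_eq_cube)
      finally show ?thesis by simp
    qed
    have "\<bar>?d / 2 * R2\<bar> \<le> \<bar>?d\<bar> / 2 * (K s x \<xi> * \<bar>?d\<bar> ^ 3 / 6)"
      unfolding abs_mult using T2 by (intro mult_mono) auto
    also have "\<dots> = K s x \<xi> * \<bar>?d\<bar> ^ 4 / 12" by (simp add: eval_nat_numeral)
    finally have T2': "\<bar>?d / 2 * R2\<bar> \<le> K s x \<xi> * \<bar>?d\<bar> ^ 4 / 12" .
    have "\<bar>s\<^sup>2 / 8 * R3\<bar> \<le> s\<^sup>2 / 8 * (K' s x \<xi> * ?d ^ 2 / 2)"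
      unfolding abs_mult using T3 by (intro mult_mono) auto
    then have T3': "\<bar>s\<^sup>2 / 8 * R3\<bar> \<le> (1 / 16) * (K' s x \<xi> * (s\<^sup>2 * ?d ^ 2))" by (simp add: mult_ac)
    have p4: "\<bar>?d\<bar> ^ 4 = ?d ^ 4" by simp
    show ?thesis unfolding eq B_def using T1[unfolded p4] T2'[unfolded p4] T3' by linarith
  qed
  have "dom_order 4 (\<lambda>s x \<xi>. (w s x \<xi> - w_odd s x \<xi> - E s x \<xi>))"
    by (rule dom_order_le[OF dB]) (rule order_trans[OF bound abs_ge_self])
  from dom_order_add[OF this dE] show ?thesis by simp
qed

lemma dom_order_w: "dom_order 3 w"
  using dom_order_add[OF dom_order_mono[OF dom_order_w_sub_odd, of 3] dom_order_w_odd] by simp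

lemma site: assumes "0 < s" "s \<le> 1" shows "site_model H gauss (w s)"
proof
  have "(\<lambda>p. w s (fst p) (snd p)) \<in> borel_measurable (H \<Otimes>\<^sub>M gauss)" by measurable
  then show "(\<lambda>(x, \<xi>). w s x \<xi>) \<in> borel_measurable (H \<Otimes>\<^sub>M gauss)" by (simp add: split_beta')
  show "integrable gauss (\<lambda>\<xi>. (w s x \<xi>)\<^sup>2)" for x
    by (rule dom_order_integrable[OF dom_order_power[OF dom_order_w, of 2] assms]) measurable
qed

abbreviation "w_drift s \<equiv> site_model.drift gauss (w s)"
abbreviation "w_spread s \<equiv> site_model.spread gauss (w s)"

text \<open>The odd part integrates to 0, so the drift inherits the order s^4 of the remainder
  instead of the order s^3 of \<open>w\<close>.\<close>

lemma drift_eq: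
  assumes "0 < s" "s \<le> 1"
  shows "w_drift s x = (\<integral>\<xi>. w s x \<xi> - w_odd s x \<xi> \<partial>gauss)"
proof -
  have "integrable gauss (w s x)" by (rule dom_order_integrable[OF dom_order_w assms]) measurable
  moreover have "integrable gauss (w_odd s x)" by (rule dom_order_integrable[OF dom_order_w_odd assms]) measurable
  moreover have "(\<integral>\<xi>. w_odd s x \<xi> \<partial>gauss) = 0"
    unfolding w_odd_def using gauss_moments(1,3) gauss_moments(4)[of 1] gauss_moments(4)[of 3] by simp
  ultimately show ?thesis
    unfolding site_model.drift_def[OF site[OF assms]] by simp
qed

lemma one_site_proposal:
  assumes "0 < s"
  shows "metropolis_proposal lborel gauss h (\<lambda>x y. normal_density (x + s\<^sup>2 / 2 * score x) s y) (move s) (log_ratio s)"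
proof (intro metropolis_proposal.intro metropolis_proposal_axioms.intro)
  show "sigma_finite_measure (lborel :: real measure)" by (rule lborel.sigma_finite_measure_axioms)
  show "prob_space gauss" by (rule prob_space_gauss)
  show "prob_space (density lborel (\<lambda>x. ennreal (h x)))"
    using H.prob_space_axioms by (simp add: H_def)
  show "distr gauss lborel (move s x) = density lborel (\<lambda>y. ennreal (normal_density (x + s\<^sup>2 / 2 * score x) s y))" for x
  proof -
    have "distributed gauss lborel (\<lambda>\<xi>. \<xi>) (normal_density 0 1)"
      unfolding distributed_def gauss_def by (auto simp: distr_id2 distr_cong[OF refl] )
    from gauss.normal_density_affine[OF this, of s "x + s\<^sup>2 / 2 * score x"] assms
    have "distributed gauss lborel (\<lambda>\<xi>. x + s\<^sup>2 / 2 * score x + s * \<xi>) (normal_density (x + s\<^sup>2 / 2 * score x) s)"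
      by simp
    moreover have "(\<lambda>\<xi>. x + s\<^sup>2 / 2 * score x + s * \<xi>) = move s x"
      by (simp add: move_def disp_def fun_eq_iff add_ac)
    ultimately show ?thesis by (simp add: distributed_def)
  qed
  show "h y * normal_density (y + s\<^sup>2 / 2 * score y) s x =
     h x * normal_density (x + s\<^sup>2 / 2 * score x) s y * exp (log_ratio s x y)" for x y
  proof -
    have e: "- (x - (y + s\<^sup>2 / 2 * score y))\<^sup>2 / (2 * s\<^sup>2) + ln (h y) =
       - (y - (x + s\<^sup>2 / 2 * score x))\<^sup>2 / (2 * s\<^sup>2) + ln (h x) + log_ratio s x y"
      using assms by (simp add: log_ratio_def field_simps power2_eq_square)
    have "exp (- (x - (y + s\<^sup>2 / 2 * score y))\<^sup>2 / (2 * s\<^sup>2)) * h y =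
       exp (- (y - (x + s\<^sup>2 / 2 * score x))\<^sup>2 / (2 * s\<^sup>2)) * h x * exp (log_ratio s x y)"
      using arg_cong[OF e, of exp] by (simp only: exp_add exp_ln h_pos)
    then show ?thesis by (simp add: normal_density_def mult_ac)
  qed
  show "(\<lambda>(x, y). normal_density (x + s\<^sup>2 / 2 * score x) s y) \<in> borel_measurable (lborel \<Otimes>\<^sub>M lborel)"
    unfolding normal_density_def by measurable
  show "(\<lambda>(x, \<xi>). move s x \<xi>) \<in> measurable (lborel \<Otimes>\<^sub>M gauss) lborel"
    by measurable
  show "(\<lambda>(x, y). log_ratio s x y) \<in> borel_measurable (lborel \<Otimes>\<^sub>M lborel)"
    by measurable
qed (use h_pos in \<open>auto simp: less_imp_le\<close>)

lemma log_ratio_swap: "log_ratio s y x = - log_ratio s x y"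
  by (simp add: log_ratio_def field_simps)

lemma dom_order_spread: "dom_order 6 (\<lambda>s x \<xi>. \<integral>\<eta>. (w s x \<eta>)\<^sup>2 \<partial>gauss)"
  by (intro dom_order_integral dom_order_power'[OF dom_order_w]) simp

text \<open>The drift is O(s^4) at each point up to growth in x, whence s^8 for its square. Its mean
  is better, O(s^6), because reversibility bounds it by the mean spread. These exponents are what d,
  of order s^(-6), has to be multiplied with.\<close>

lemma site_moments:
  obtains C where "C \<ge> 0"
    "\<And>s. 0 < s \<Longrightarrow> s \<le> 1 \<Longrightarrow> integrable H (w_drift s) \<and> integrable H (w_spread s)
      \<and> integrable H (\<lambda>x. (w_drift s x)\<^sup>2) \<and> integrable H (\<lambda>x. (w_spread s x)\<^sup>2)
      \<and> \<bar>\<integral>x. w_drift s x \<partial>H\<bar> \<le> C * s ^ 6 \<and> (\<integral>x. w_spread s x \<partial>H) \<le> C * s ^ 6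
      \<and> (\<integral>x. (w_drift s x)\<^sup>2 \<partial>H) \<le> C * s ^ 8 \<and> (\<integral>x. (w_spread s x)\<^sup>2 \<partial>H) \<le> C * s ^ 12"
proof -
  define sp where "sp s x = (\<integral>\<eta>. (w s x \<eta>)\<^sup>2 \<partial>gauss)" for s x
  define dr where "dr s x = (\<integral>\<xi>. w s x \<xi> - w_odd s x \<xi> \<partial>gauss)" for s x
  have [measurable]: "sp s \<in> borel_measurable borel" "dr s \<in> borel_measurable borel" for s
    unfolding sp_def dr_def by measurable
  have d: "dom_order 6 (\<lambda>s x \<xi>. sp s x)" "dom_order 4 (\<lambda>s x \<xi>. dr s x)"
    unfolding sp_def dr_def by (intro dom_order_spread dom_order_integral dom_order_w_sub_odd)+
  obtain C1 where C1: "C1 \<ge> 0" "\<And>s. 0 < s \<Longrightarrow> s \<le> 1 \<Longrightarrow> integrable H (sp s) \<and> \<bar>\<integral>x. sp s x \<partial>H\<bar> \<le> C1 * s ^ 6"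
    by (rule dom_order_H[OF d(1)]) auto
  obtain C2 where C2: "C2 \<ge> 0" "\<And>s. 0 < s \<Longrightarrow> s \<le> 1 \<Longrightarrow> integrable H (dr s) \<and> \<bar>\<integral>x. dr s x \<partial>H\<bar> \<le> C2 * s ^ 4"
    by (rule dom_order_H[OF d(2)]) auto
  obtain C3 where C3: "C3 \<ge> 0" "\<And>s. 0 < s \<Longrightarrow> s \<le> 1 \<Longrightarrow> integrable H (\<lambda>x. (sp s x)\<^sup>2) \<and> \<bar>\<integral>x. (sp s x)\<^sup>2 \<partial>H\<bar> \<le> C3 * s ^ 12"
    by (rule dom_order_H[OF dom_order_power'[OF d(1), of 12 2]]) auto
  obtain C4 where C4: "C4 \<ge> 0" "\<And>s. 0 < s \<Longrightarrow> s \<le> 1 \<Longrightarrow> integrable H (\<lambda>x. (dr s x)\<^sup>2) \<and> \<bar>\<integral>x. (dr s x)\<^sup>2 \<partial>H\<bar> \<le> C4 * s ^ 8"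
    by (rule dom_order_H[OF dom_order_power'[OF d(2), of 8 2]]) auto
  \<comment> \<open>\<open>C2\<close> supplies integrability of the drift; the bound on its mean
    comes from the spread, that is from \<open>C1\<close>.\<close>
  let ?C = "C1 + C3 + C4"
  show thesis
  proof (rule that[of ?C])
    show "?C \<ge> 0" using C1 C3 C4 by simp
    fix s :: real assume s: "0 < s" "s \<le> 1"
    have sp: "w_spread s = sp s" and dr: "w_drift s = dr s"
      by (auto simp: fun_eq_iff sp_def dr_def drift_eq[OF s] site_model.spread_def[OF site[OF s]])
    interpret site_model H gauss "w s" by (rule site[OF s])
    interpret P: metropolis_proposal lborel gauss h "\<lambda>x y. normal_density (x + s\<^sup>2 / 2 * score x) s y" "move s" "log_ratio s"
      by (rule one_site_proposal[OF s(1)])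
    interpret HG: pair_prob_space H gauss ..
    have m: "(\<lambda>(x, \<xi>). w s x \<xi>) \<in> borel_measurable (H \<Otimes>\<^sub>M gauss)" "(\<lambda>(x, \<xi>). (w s x \<xi>)\<^sup>2) \<in> borel_measurable (H \<Otimes>\<^sub>M gauss)"
      by measurable
    have i2: "integrable (H \<Otimes>\<^sub>M gauss) (\<lambda>(x, \<xi>). (w s x \<xi>)\<^sup>2)"
    proof (rule HG.Fubini_integrable[OF m(2)])
      show "integrable H (\<lambda>x. \<integral>\<xi>. norm (case (x, \<xi>) of (x, \<xi>) \<Rightarrow> (w s x \<xi>)\<^sup>2) \<partial>gauss)"
        using C1(2)[OF s] by (simp add: sp_def[abs_def])
    qed (use w_square in auto)
    have i1: "integrable (H \<Otimes>\<^sub>M gauss) (\<lambda>(x, \<xi>). w s x \<xi>)"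
      by (rule HG.square_integrable_imp_integrable[OF m(1)]) (use i2 in \<open>simp add: split_beta'\<close>)
    \<comment> \<open>Reversibility of the one-dimensional proposal raises the mean from order s^4
      to order s^6.\<close>
    have "\<bar>\<integral>(x, \<xi>). w s x \<xi> \<partial>(H \<Otimes>\<^sub>M gauss)\<bar> \<le> (\<integral>(x, \<xi>). (w s x \<xi>)\<^sup>2 \<partial>(H \<Otimes>\<^sub>M gauss))"
      using P.abs_integral_log_ratio_le[OF log_ratio_swap] i1 i2
      by (simp add: H_def[symmetric] w_def[symmetric])
    moreover have "(\<integral>(x, \<xi>). w s x \<xi> \<partial>(H \<Otimes>\<^sub>M gauss)) = (\<integral>x. w_drift s x \<partial>H)"
      using HG.integral_fst'[OF i1] by (simp add: drift_def)
    moreover have "(\<integral>(x, \<xi>). (w s x \<xi>)\<^sup>2 \<partial>(H \<Otimes>\<^sub>M gauss)) = (\<integral>x. w_spread s x \<partial>H)"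
      using HG.integral_fst'[OF i2] by (simp add: spread_def)
    ultimately have dsp: "\<bar>\<integral>x. w_drift s x \<partial>H\<bar> \<le> (\<integral>x. w_spread s x \<partial>H)" by simp
    have le: "C1 * s ^ k \<le> ?C * s ^ k" "C3 * s ^ k \<le> ?C * s ^ k" "C4 * s ^ k \<le> ?C * s ^ k" for k
      using C1 C3 C4 s by (auto intro!: mult_right_mono)
    show "integrable H (w_drift s) \<and> integrable H (w_spread s)
      \<and> integrable H (\<lambda>x. (w_drift s x)\<^sup>2) \<and> integrable H (\<lambda>x. (w_spread s x)\<^sup>2)
      \<and> \<bar>\<integral>x. w_drift s x \<partial>H\<bar> \<le> ?C * s ^ 6 \<and> (\<integral>x. w_spread s x \<partial>H) \<le> ?C * s ^ 6
      \<and> (\<integral>x. (w_drift s x)\<^sup>2 \<partial>H) \<le> ?C * s ^ 8 \<and> (\<integral>x. (w_spread s x)\<^sup>2 \<partial>H) \<le> ?C * s ^ 12"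
      using dsp C1(2)[OF s] C2(2)[OF s] C3(2)[OF s] C4(2)[OF s] le[of 6] le[of 8] le[of 12]
      unfolding sp dr by (intro conjI) (blast, blast, blast, blast, linarith+)
  qed
qed

text \<open>A second-order expansion of g along the proposal. The Gaussian moments of the
  displacement give the Langevin generator times s^2, and a Lipschitz second derivative replaces a
  bounded third one, so the error is O(s^3) and its square O(s^6).\<close>

lemma generator_error:
  assumes g: "\<And>x. (g has_real_derivative g1 x) (at x)" "\<And>x. (g1 has_real_derivative g2 x) (at x)"
    and L: "L-lipschitz_on UNIV g2"
  obtains C where "C \<ge> 0" "\<And>s. 0 < s \<Longrightarrow> s \<le> 1 \<Longrightarrow>
      (\<integral>x. ((\<integral>\<xi>. g (move s x \<xi>) - g x \<partial>gauss) - s\<^sup>2 * ((score x * g1 x + g2 x) / 2))\<^sup>2 \<partial>H) \<le> C * s ^ 6"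
    "\<And>s. 0 < s \<Longrightarrow> s \<le> 1 \<Longrightarrow>
      integrable H (\<lambda>x. ((\<integral>\<xi>. g (move s x \<xi>) - g x \<partial>gauss) - s\<^sup>2 * ((score x * g1 x + g2 x) / 2))\<^sup>2)"
proof -
  have [measurable]: "g \<in> borel_measurable borel" "g1 \<in> borel_measurable borel" "g2 \<in> borel_measurable borel"
    by (auto intro!: borel_measurable_continuous_onI DERIV_continuous_on[OF DERIV_subset[OF g(1)]]
        DERIV_continuous_on[OF DERIV_subset[OF g(2)]] lipschitz_on_continuous_on[OF L])
  have L0: "L \<ge> 0" by (rule lipschitz_on_nonneg[OF L])
  define r where "r s x \<xi> = g (move s x \<xi>) - g x - g1 x * disp s x \<xi> - g2 x / 2 * (disp s x \<xi>)\<^sup>2" for s x \<xi>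
  have r: "\<bar>r s x \<xi>\<bar> \<le> L * \<bar>disp s x \<xi>\<bar> ^ 3" for s x \<xi>
  proof -
    let ?d = "disp s x \<xi>"
    define f where "f m = (if m = 0 then g else if m = Suc 0 then g1 else g2)" for m :: nat
    \<comment> \<open>Subtracting the quadratic Taylor term makes the second derivative vanish at x;
      the Lipschitz bound on \<open>g2\<close> then controls it by L |\<delta>| along the
      step.\<close>
    define f' where "f' m y = f m y - (if m = 0 then g2 x / 2 * (y - x)\<^sup>2 else if m = Suc 0 then g2 x * (y - x) else g2 x)" for m :: nat and y
    have "\<bar>f' 0 (x + ?d) - (\<Sum>m<2. f' m x / fact m * ?d ^ m)\<bar> \<le> (L * \<bar>?d\<bar>) * \<bar>?d\<bar> ^ 2 / fact 2"
    proof (rule taylor_bound)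
      fix m y assume "m < (2::nat)"
      then consider "m = 0" | "m = Suc 0" by linarith
      then show "(f' m has_real_derivative f' (Suc m) y) (at y)"
        by cases (auto simp: f'_def[abs_def] f_def power2_eq_square intro!: derivative_eq_intros g)
    next
      fix t assume "\<bar>t\<bar> \<le> \<bar>?d\<bar>"
      have "\<bar>f' 2 (x + t)\<bar> \<le> L * \<bar>t\<bar>"
        using lipschitz_onD[OF L, of "x + t" x] by (simp add: f'_def f_def dist_real_def)
      also have "\<dots> \<le> L * \<bar>?d\<bar>" using L0 \<open>\<bar>t\<bar> \<le> \<bar>?d\<bar>\<close> by (rule mult_left_mono[rotated])
      finally show "\<bar>f' 2 (x + t)\<bar> \<le> L * \<bar>?d\<bar>" .
    qed
    moreover have "(\<Sum>m<2. f' m x / fact m * ?d ^ m) = g x + g1 x * ?d"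
      by (simp add: eval_nat_numeral f'_def f_def)
    moreover have "(L * \<bar>?d\<bar>) * \<bar>?d\<bar> ^ 2 / fact 2 \<le> L * \<bar>?d\<bar> ^ 3"
    proof -
      have "(L * \<bar>?d\<bar>) * \<bar>?d\<bar> ^ 2 = L * \<bar>?d\<bar> ^ 3" by (simp only: power2_eq_square power3_eq_cube mult_ac)
      moreover have "L * \<bar>?d\<bar> ^ 3 \<ge> 0" using L0 by simp
      ultimately show ?thesis by (simp only: fact_2)
    qed
    ultimately show ?thesis by (simp add: r_def f'_def f_def move_def algebra_simps)
  qed
  have dr: "dom_order 3 r"
    by (rule dom_order_le[OF dom_order_cmult[OF dom_order_power'[OF dom_order_disp, of 3 3], of L]])
       (use r L0 in \<open>auto simp: abs_mult power_abs\<close>)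
  \<comment> \<open>Besides the remainder there is the square of the deterministic part of the
    displacement, which is of order s^4.\<close>
  define e where "e s x = (\<integral>\<xi>. r s x \<xi> \<partial>gauss) + g2 x / 2 * (s\<^sup>2 / 2 * score x)\<^sup>2" for s x
  have [measurable]: "(\<lambda>x. r s (fst x) (snd x)) \<in> borel_measurable (borel \<Otimes>\<^sub>M borel)" for s
    unfolding r_def by measurable
  have [measurable]: "(\<lambda>x. r s (fst x) (snd x)) \<in> borel_measurable (borel \<Otimes>\<^sub>M gauss)" for s
    unfolding r_def by measurable
  have rm [measurable]: "r s x \<in> borel_measurable borel" for s x unfolding r_def[abs_def] by measurable
  have em [measurable]: "e s \<in> borel_measurable borel" for s
    unfolding e_def[abs_def] by measurable
  have de: "dom_order 3 (\<lambda>s x \<xi>. e s x)"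
  proof -
    have "dom_order 3 (\<lambda>s x \<xi>. (\<integral>\<xi>. r s x \<xi> \<partial>gauss) + (1 / 2) * (g2 x * (s\<^sup>2 / 2 * score x)\<^sup>2))"
      by (intro dom_order_add dom_order_integral dr dom_order_cmult
          dom_order_mult'[OF dom_order_poly_bounded[OF lipschitz_poly_bounded[OF L]] dom_order_power'[OF dom_order_center order_refl]]) simp
    then show ?thesis by (simp add: e_def)
  qed
  have eq: "(\<integral>\<xi>. g (move s x \<xi>) - g x \<partial>gauss) - s\<^sup>2 * ((score x * g1 x + g2 x) / 2) = e s x"
    if s: "0 < s" "s \<le> 1" for s x
  proof -
    have i: "integrable gauss (r s x)" by (rule dom_order_integrable[OF dr s rm])
    have i1: "integrable gauss (\<lambda>\<xi>. disp s x \<xi>)" "integrable gauss (\<lambda>\<xi>. (disp s x \<xi>)\<^sup>2)"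
      by (rule dom_order_integrable[OF dom_order_disp s] dom_order_integrable[OF dom_order_power[OF dom_order_disp, of 2] s]; measurable)+
    have m1: "(\<integral>\<xi>. disp s x \<xi> \<partial>gauss) = s\<^sup>2 / 2 * score x"
      unfolding disp_def using gauss_moments(1) gauss_moments(4)[of 1] by (simp add: gauss.prob_space)
    have m2: "(\<integral>\<xi>. (disp s x \<xi>)\<^sup>2 \<partial>gauss) = (s\<^sup>2 / 2 * score x)\<^sup>2 + s\<^sup>2"
    proof -
      have "(\<lambda>\<xi>. (disp s x \<xi>)\<^sup>2) = (\<lambda>\<xi>. (s\<^sup>2 / 2 * score x)\<^sup>2 + 2 * (s\<^sup>2 / 2 * score x) * s * \<xi> + s\<^sup>2 * \<xi>\<^sup>2)"
        by (simp add: disp_def fun_eq_iff power2_eq_square algebra_simps)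
      then show ?thesis using gauss_moments(1,2) gauss_moments(4)[of 1] gauss_moments(4)[of 2] by (simp add: gauss.prob_space)
    qed
    have "(\<integral>\<xi>. g (move s x \<xi>) - g x \<partial>gauss) = (\<integral>\<xi>. r s x \<xi> + g1 x * disp s x \<xi> + g2 x / 2 * (disp s x \<xi>)\<^sup>2 \<partial>gauss)"
      by (simp add: r_def)
    also have "\<dots> = (\<integral>\<xi>. r s x \<xi> \<partial>gauss) + g1 x * (s\<^sup>2 / 2 * score x) + g2 x / 2 * ((s\<^sup>2 / 2 * score x)\<^sup>2 + s\<^sup>2)"
      using i i1 by (simp add: m1 m2)
    finally show ?thesis by (simp add: e_def field_simps)
  qed
  obtain C where C: "C \<ge> 0" "\<And>s. 0 < s \<Longrightarrow> s \<le> 1 \<Longrightarrow> integrable H (\<lambda>x. (e s x)\<^sup>2) \<and> \<bar>\<integral>x. (e s x)\<^sup>2 \<partial>H\<bar> \<le> C * s ^ 6"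
    by (rule dom_order_H[OF dom_order_power'[OF de, of 6 2]]) auto
  show thesis
    by (rule that[OF C(1)]; simp only: eq) (use C(2) in fastforce)+
qed

lemma square_disp_moment:
  obtains C where "C \<ge> 0" "\<And>s. 0 < s \<Longrightarrow> s \<le> 1 \<Longrightarrow> integrable H (\<lambda>x. \<integral>\<xi>. (disp s x \<xi>)\<^sup>2 \<partial>gauss)
      \<and> (\<integral>x. (\<integral>\<xi>. (disp s x \<xi>)\<^sup>2 \<partial>gauss) \<partial>H) \<le> C * s\<^sup>2"
    "\<And>s x. 0 < s \<Longrightarrow> s \<le> 1 \<Longrightarrow> integrable gauss (\<lambda>\<xi>. (disp s x \<xi>)\<^sup>2)"
proof -
  have d: "dom_order 2 (\<lambda>s x \<xi>. (disp s x \<xi>)\<^sup>2)" by (rule dom_order_power'[OF dom_order_disp]) simp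
  obtain C where C: "C \<ge> 0" "\<And>s. 0 < s \<Longrightarrow> s \<le> 1 \<Longrightarrow> integrable H (\<lambda>x. \<integral>\<xi>. (disp s x \<xi>)\<^sup>2 \<partial>gauss) \<and>
      \<bar>\<integral>x. (\<integral>\<xi>. (disp s x \<xi>)\<^sup>2 \<partial>gauss) \<partial>H\<bar> \<le> C * s\<^sup>2"
    by (rule dom_order_H[OF dom_order_integral[OF d]]) auto
  show thesis
  proof (rule that[OF C(1)])
    show "integrable gauss (\<lambda>\<xi>. (disp s x \<xi>)\<^sup>2)" if "0 < s" "s \<le> 1" for s x
      by (rule dom_order_integrable[OF d that]) measurable
  qed (use C(2) in fastforce)
qed

end

section \<open>The one-dimensional generator equation\<close>

lemma compact_support_bounded:
  fixes u :: "real \<Rightarrow> real"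
  assumes "continuous_on UNIV u" "\<And>x. \<bar>x\<bar> \<ge> R \<Longrightarrow> u x = 0"
  obtains B where "B \<ge> 0" "\<And>x. \<bar>u x\<bar> \<le> B"
proof -
  have "compact (u ` {- R..R})"
    by (intro compact_continuous_image continuous_on_subset[OF assms(1)]) auto
  then obtain B where B: "\<And>y. y \<in> u ` {- R..R} \<Longrightarrow> \<bar>y\<bar> \<le> B"
    using compact_imp_bounded bounded_iff by (metis real_norm_def)
  show thesis
  proof (rule that[of "\<bar>B\<bar>"])
    fix x show "\<bar>u x\<bar> \<le> \<bar>B\<bar>"
    proof (cases "\<bar>x\<bar> \<ge> R")
      case False
      then have "u x \<in> u ` {- R..R}" by (intro imageI) auto
      then show ?thesis using B[of "u x"] by linarith
    qed (simp add: assms(2))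
  qed simp
qed

lemma compact_support_antiderivative:
  fixes u :: "real \<Rightarrow> real"
  assumes c: "continuous_on UNIV u" and u: "\<And>x. \<bar>x\<bar> \<ge> R \<Longrightarrow> u x = 0" and "R > 0"
  obtains U where "\<And>x. (U has_real_derivative u x) (at x)" "\<And>x. x \<le> - R \<Longrightarrow> U x = 0"
    "\<And>x. x \<ge> R \<Longrightarrow> U x = integral UNIV u" "\<exists>B. \<forall>x. \<bar>U x\<bar> \<le> B"
proof -
  \<comment> \<open>Integration starts one unit to the left of the support. Points beyond the start
    are interior, where the fundamental theorem gives a two-sided derivative; at the others
    \<open>U\<close> vanishes on a neighbourhood.\<close>
  define U where "U x = integral {- R - 1..x} u" for x
  have low: "U x = 0" if "x \<le> - R" for x
  proof -
    have "U x = integral {- R - 1..x} (\<lambda>x. 0)"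
      unfolding U_def by (rule integral_cong) (use that \<open>R > 0\<close> in \<open>auto intro!: u\<close>)
    then show ?thesis by simp
  qed
  have high: "U x = integral UNIV u" if "x \<ge> R" for x
  proof -
    have "(\<lambda>y. if y \<in> {- R - 1..x} then u y else 0) = u"
      using that \<open>R > 0\<close> u by (auto simp: fun_eq_iff)
    then show ?thesis unfolding U_def using integral_restrict_UNIV[of "{- R - 1..x}" u] by simp
  qed
  have D: "(U has_real_derivative u x) (at x)" for x
  proof (cases "x > - R - 1")
    case True
    have "(U has_real_derivative u x) (at x within {- R - 1..x + 1})"
      unfolding U_def[abs_def]
      by (rule integral_has_real_derivative) (use True continuous_on_subset[OF c] in auto)
    then show ?thesis using at_within_interior[of x "{- R - 1..x + 1}"] True by simp
  next
    case False
    have "((\<lambda>_. 0) has_real_derivative u x) (at x)" using u[of x] False \<open>R > 0\<close> by auto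
    then show ?thesis
    proof (rule has_field_derivative_transform_within_open[of _ _ _ "{..< - R}"])
      show "x \<in> {..< - R}" using False by simp
    qed (auto simp: low)
  qed
  have cU: "continuous_on UNIV U"
    by (rule DERIV_continuous_on[OF DERIV_subset[OF D]]) auto
  have "compact (U ` {- R..R})"
    by (intro compact_continuous_image continuous_on_subset[OF cU]) auto
  then obtain B where B: "\<And>y. y \<in> U ` {- R..R} \<Longrightarrow> \<bar>y\<bar> \<le> B"
    using compact_imp_bounded bounded_iff by (metis real_norm_def)
  have "\<bar>U x\<bar> \<le> \<bar>B\<bar>" for x
  proof -
    consider "x \<le> - R" | "x \<in> {- R..R}" | "x \<ge> R" by force
    then show ?thesis
    proof cases
      case 2
      then show ?thesis using B[of "U x"] by force
    next
      case 3
      then have "U x = U R" using high[of x] high[of R] by simp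
      then show ?thesis using B[of "U R"] \<open>R > 0\<close> by force
    qed (simp add: low)
  qed
  then show thesis using that[of U] D low high by blast
qed

lemma lipschitz_of_bounded_derivative:
  fixes f :: "real \<Rightarrow> real"
  assumes "\<And>x. (f has_real_derivative f' x) (at x)" "\<And>x. \<bar>f' x\<bar> \<le> B" "B \<ge> 0"
  shows "B-lipschitz_on UNIV f"
proof (rule bounded_derivative_imp_lipschitz[where f' = "\<lambda>x. (*) (f' x)"])
  show "(f has_derivative (*) (f' x)) (at x within UNIV)" for x
    using assms(1)[of x] by (simp add: has_field_derivative_def)
  show "onorm ((*) (f' x)) \<le> B" for x
    by (rule onorm_le) (use assms(2)[of x] in \<open>auto simp: abs_mult intro: mult_right_mono\<close>)
qed (use assms in auto)

text \<open>For a \<le> b the inner maximum is the distance from x to [a, b]. The slope is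
  \<open>Suc n\<close>, so that n = 0 gives flanks of slope 1, used for the widening
  cut-offs.\<close>

definition trapezoid :: "real \<Rightarrow> real \<Rightarrow> nat \<Rightarrow> real \<Rightarrow> real" where
  "trapezoid a b n x = max 0 (1 - real (Suc n) * max 0 (max (a - x) (x - b)))"

lemma trapezoid_bounds: "0 \<le> trapezoid a b n x" "trapezoid a b n x \<le> 1"
  by (auto simp: trapezoid_def)

lemma trapezoid_inside: "a \<le> x \<Longrightarrow> x \<le> b \<Longrightarrow> trapezoid a b n x = 1"
  by (auto simp: trapezoid_def max_def)

lemma trapezoid_measurable [measurable]: "trapezoid a b n \<in> borel_measurable borel"
  unfolding trapezoid_def[abs_def] by measurable

lemma trapezoid_outside: "x \<notin> {a - 1 <..< b + 1} \<Longrightarrow> trapezoid a b n x = 0"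
proof -
  assume "x \<notin> {a - 1 <..< b + 1}"
  then have "1 \<le> max 0 (max (a - x) (x - b))" by auto
  then have "1 * 1 \<le> real (Suc n) * max 0 (max (a - x) (x - b))" by (intro mult_mono) auto
  then show ?thesis by (simp add: trapezoid_def)
qed

lemma trapezoid_lipschitz: "(real (Suc n))-lipschitz_on UNIV (trapezoid a b n)"
proof (rule lipschitz_onI)
  fix x y
  have *: "\<bar>max 0 (max (a - x) (x - b)) - max 0 (max (a - y) (y - b))\<bar> \<le> \<bar>x - y\<bar>"
    by linarith
  have "\<bar>trapezoid a b n x - trapezoid a b n y\<bar> \<le>
     \<bar>real (Suc n) * max 0 (max (a - x) (x - b)) - real (Suc n) * max 0 (max (a - y) (y - b))\<bar>"
    unfolding trapezoid_def by linarith
  also have "\<dots> = real (Suc n) * \<bar>max 0 (max (a - x) (x - b)) - max 0 (max (a - y) (y - b))\<bar>"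
    unfolding right_diff_distrib[symmetric] abs_mult by simp
  also have "\<dots> \<le> real (Suc n) * \<bar>x - y\<bar>" using * by (rule mult_left_mono) simp
  finally show "dist (trapezoid a b n x) (trapezoid a b n y) \<le> real (Suc n) * dist x y"
    by (simp add: dist_real_def)
qed simp

lemma trapezoid_tendsto: "(\<lambda>n. trapezoid a b n x) \<longlonglongrightarrow> indicator {a..b} x"
proof (cases "x \<in> {a..b}")
  case True
  then show ?thesis by (simp add: trapezoid_inside)
next
  case False
  then have m: "max 0 (max (a - x) (x - b)) > 0" by auto
  then obtain N where N: "1 < real N * max 0 (max (a - x) (x - b))"
    using ex_less_of_nat_mult by blast
  have "trapezoid a b n x = 0" if "n \<ge> N" for n
  proof -
    have "real N * max 0 (max (a - x) (x - b)) \<le> real (Suc n) * max 0 (max (a - x) (x - b))"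
      using that by (intro mult_right_mono) auto
    then show ?thesis using N by (simp add: trapezoid_def)
  qed
  then have "eventually (\<lambda>n. trapezoid a b n x = indicator {a..b} x) sequentially"
    using False by (auto simp: eventually_sequentially indicator_def)
  then show ?thesis by (rule tendsto_eventually)
qed

lemma trapezoid_widening_tendsto: "(\<lambda>n. trapezoid (- real n) (real n) 0 x) \<longlonglongrightarrow> 1"
proof (rule tendsto_eventually)
  obtain N where N: "\<bar>x\<bar> \<le> real N" using real_arch_simple by blast
  have "trapezoid (- real n) (real n) 0 x = 1" if "n \<ge> N" for n
    using that N by (intro trapezoid_inside) auto
  then show "eventually (\<lambda>n. trapezoid (- real n) (real n) 0 x = 1) sequentially"
    by (auto simp: eventually_sequentially)
qed

context langevin_density
begin

lemma measure_H_UNIV [simp]: "measure H UNIV = 1"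
  using H.prob_space by simp

lemma H_integrable_bounded:
  fixes f :: "real \<Rightarrow> real"
  assumes "f \<in> borel_measurable borel" "\<And>x. \<bar>f x\<bar> \<le> B"
  shows "integrable H f"
  using assms by (intro H.integrable_const_bound[where B=B]) auto

text \<open>The equation \<open>g'' + score * g' = 2 f\<close> reads \<open>(h g')' = 2 h f\<close>; as \<open>f\<close> has mean zero,
  \<open>g'\<close> inherits the compact support of \<open>f\<close>.\<close>

lemma generator_equation_solution:
  assumes f: "Lf-lipschitz_on UNIV f" and supp: "\<And>x. \<bar>x\<bar> \<ge> R \<Longrightarrow> f x = 0" and R: "R > 0"
    and mean: "(\<integral>x. f x \<partial>H) = 0"
  obtains g g1 g2 L B where "\<And>x. (g has_real_derivative g1 x) (at x)" "\<And>x. (g1 has_real_derivative g2 x) (at x)"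
    "L-lipschitz_on UNIV g2" "\<And>x. \<bar>g x\<bar> \<le> B" "\<And>x. (score x * g1 x + g2 x) / 2 = f x"
proof -
  have cf: "continuous_on UNIV f" by (rule lipschitz_on_continuous_on[OF f])
  have ch: "continuous_on UNIV h" by (rule DERIV_continuous_on[OF DERIV_subset[OF h_DERIV1]]) auto
  obtain Ls where Ls: "Ls-lipschitz_on UNIV score" using h_score_lipschitz by (auto simp: score_def[abs_def])
  have cs: "continuous_on UNIV score" by (rule lipschitz_on_continuous_on[OF Ls])
  have supp': "h x * f x = 0" if "\<bar>x\<bar> \<ge> R" for x using supp[OF that] by simp
  have chf: "continuous_on UNIV (\<lambda>x. h x * f x)" by (intro continuous_on_mult ch cf)
  obtain Bf where Bf: "Bf \<ge> 0" "\<And>x. \<bar>f x\<bar> \<le> Bf" using compact_support_bounded[OF cf supp] by metis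
  have mf [measurable]: "f \<in> borel_measurable borel" by (rule borel_measurable_continuous_onI[OF cf])
  obtain F where F: "\<And>x. (F has_real_derivative h x * f x) (at x)" "\<And>x. x \<le> - R \<Longrightarrow> F x = 0"
    "\<And>x. x \<ge> R \<Longrightarrow> F x = integral UNIV (\<lambda>x. h x * f x)"
    using compact_support_antiderivative[OF chf supp' R] by metis
  have "integrable H f" by (rule H_integrable_bounded[OF mf Bf(2)])
  then have "integrable lborel (\<lambda>x. h x * f x)" using H_integrable[OF mf] by simp
  then have "integral UNIV (\<lambda>x. h x * f x) = (\<integral>x. h x * f x \<partial>lborel)"
    by (simp add: integral_lborel)
  also have "\<dots> = 0" using mean H_integral[OF mf] by simp
  finally have F0: "F x = 0" if "\<bar>x\<bar> \<ge> R" for x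
    using F(2)[of x] F(3)[of x] that by (cases "x \<ge> R") auto
  \<comment> \<open>From (h g')' = 2 h f: \<open>F\<close> is the antiderivative of h f and vanishes
    on both sides of the support, on the right because f has mean zero.\<close>
  define g1 where "g1 x = 2 * F x / h x" for x
  define g2 where "g2 x = 2 * f x - score x * g1 x" for x
  have hn: "h x \<noteq> 0" for x using h_pos[of x] by simp
  have D1: "(g1 has_real_derivative g2 x) (at x)" for x
    unfolding g1_def[abs_def] g2_def score_def
    by (rule derivative_eq_intros F(1) h_DERIV1 hn refl)+ (use hn[of x] in \<open>simp add: g1_def field_simps power2_eq_square\<close>)
  have c1: "continuous_on UNIV g1" by (rule DERIV_continuous_on[OF DERIV_subset[OF D1]]) auto
  have g10: "g1 x = 0" if "\<bar>x\<bar> \<ge> R" for x using F0[OF that] by (simp add: g1_def)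
  have c2: "continuous_on UNIV g2" unfolding g2_def by (intro continuous_intros cf cs c1)
  obtain B1 where B1: "B1 \<ge> 0" "\<And>x. \<bar>g1 x\<bar> \<le> B1" using compact_support_bounded[OF c1 g10] by metis
  obtain B2 where B2: "B2 \<ge> 0" "\<And>x. \<bar>g2 x\<bar> \<le> B2"
    using compact_support_bounded[OF c2, of R] g10 supp by (auto simp: g2_def)
  have L1: "B2-lipschitz_on UNIV g1" by (rule lipschitz_of_bounded_derivative[OF D1 B2(2) B2(1)])
  have "compact (score ` {- R..R})"
    by (intro compact_continuous_image continuous_on_subset[OF cs]) auto
  then obtain S0 where S0: "\<And>y. y \<in> score ` {- R..R} \<Longrightarrow> \<bar>y\<bar> \<le> S0"
    using compact_imp_bounded bounded_iff by (metis real_norm_def)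
  define S where "S = \<bar>S0\<bar>"
  have S: "\<bar>score x\<bar> \<le> S" if "\<bar>x\<bar> \<le> R" for x
    using S0[of "score x"] that unfolding S_def by force
  have S0: "S \<ge> 0" "Ls \<ge> 0" using lipschitz_on_nonneg[OF Ls] by (auto simp: S_def)
  \<comment> \<open>The score is Lipschitz but possibly unbounded, so the product rule for Lipschitz
    functions is applied with one point inside [-R, R]; if both points are outside, the product
    vanishes at both.\<close>
  have *: "\<bar>score x * g1 x - score y * g1 y\<bar> \<le> (S * B2 + B1 * Ls) * \<bar>x - y\<bar>" if x: "\<bar>x\<bar> \<le> R" for x y
  proof -
    have "score x * g1 x - score y * g1 y = score x * (g1 x - g1 y) + g1 y * (score x - score y)"
      by (simp add: algebra_simps)
    also have "\<bar>\<dots>\<bar> \<le> \<bar>score x\<bar> * \<bar>g1 x - g1 y\<bar> + \<bar>g1 y\<bar> * \<bar>score x - score y\<bar>"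
      by (metis abs_mult abs_triangle_ineq)
    also have "\<dots> \<le> S * (B2 * \<bar>x - y\<bar>) + B1 * (Ls * \<bar>x - y\<bar>)"
      using S[OF x] B1 lipschitz_onD[OF L1, of x y] lipschitz_onD[OF Ls, of x y] S0
      by (intro add_mono mult_mono) (auto simp: dist_real_def)
    finally show ?thesis by (simp add: algebra_simps)
  qed
  have L2: "(S * B2 + B1 * Ls)-lipschitz_on UNIV (\<lambda>x. score x * g1 x)"
  proof (rule lipschitz_onI)
    fix x y
    consider "\<bar>x\<bar> \<le> R" | "\<bar>y\<bar> \<le> R" | "\<bar>x\<bar> \<ge> R" "\<bar>y\<bar> \<ge> R" by linarith
    then show "dist (score x * g1 x) (score y * g1 y) \<le> (S * B2 + B1 * Ls) * dist x y"
    proof cases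
      case 2
      then show ?thesis using *[OF 2, of x] by (simp add: dist_real_def abs_minus_commute)
    next
      case 3
      then show ?thesis using B1 B2 S0 by (simp add: g10)
    qed (use * in \<open>simp add: dist_real_def\<close>)
  qed (use B1 B2 S0 in simp)
  have "(\<bar>2\<bar> * Lf + (S * B2 + B1 * Ls))-lipschitz_on UNIV (\<lambda>x. 2 * f x - score x * g1 x)"
    using lipschitz_on_diff[OF lipschitz_on_cmult_real[OF f, of 2] L2] by simp
  then have L: "(\<bar>2\<bar> * Lf + (S * B2 + B1 * Ls))-lipschitz_on UNIV g2" by (simp add: g2_def[abs_def])
  \<comment> \<open>\<open>g\<close> need not have compact support, but it is constant on either
    side of the support of \<open>g1\<close> and hence bounded.\<close>
  obtain g B where g: "\<And>x. (g has_real_derivative g1 x) (at x)" "\<And>x. \<bar>g x\<bar> \<le> B"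
    using compact_support_antiderivative[OF c1 g10 R] by metis
  show thesis by (rule that[OF g(1) D1 L g(2)]) (simp add: g2_def)
qed

lemma AE_H_neq: "AE x in H. x \<noteq> a"
  unfolding H_def by (subst AE_density) (auto intro: AE_mp[OF AE_lborel_singleton[of a]])

text \<open>Subtracting a constant would centre the trapezoid but destroy its compact support; a
  wide trapezoid is subtracted instead, scaled so that the mean is exactly 0. The end point a is a
  null set, so the half-open interval may be approximated as a closed one.\<close>

lemma interval_approximation:
  assumes "\<eta> > 0"
  obtains f Lf R where "Lf-lipschitz_on UNIV f" "\<And>x. \<bar>x\<bar> \<ge> R \<Longrightarrow> f x = 0" "R > 0" "(\<integral>x. f x \<partial>H) = 0"
    "(\<integral>x. (f x - (indicator {a<..b} x - measure H {a<..b}))\<^sup>2 \<partial>H) \<le> \<eta>"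
proof -
  define p where "p = measure H {a<..b}"
  define m where "m n = (\<integral>x. trapezoid a b n x \<partial>H)" for n
  define M where "M n = (\<integral>x. trapezoid (- real n) (real n) 0 x \<partial>H)" for n
  have iT: "integrable H (trapezoid u v n)" for u v n
    using trapezoid_bounds[of u v n] by (intro H_integrable_bounded[where B=1]) (auto simp: abs_le_iff intro: order_trans[of _ 0])
  have ind: "AE x in H. (indicator {a..b} x :: real) = indicator {a<..b} x"
    using AE_H_neq[of a] by eventually_elim (auto simp: indicator_def)
  have "m \<longlonglongrightarrow> (\<integral>x. indicator {a..b} x \<partial>H)"
    unfolding m_def
    by (rule integral_dominated_convergence[where w="\<lambda>_. 1"])
       (use trapezoid_bounds trapezoid_tendsto in auto)
  also have "(\<integral>x. indicator {a..b} x \<partial>H) = (\<integral>x. indicator {a<..b} x \<partial>H :: real)"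
    by (rule integral_cong_AE) (use ind in auto)
  also have "\<dots> = p" by (simp add: p_def)
  finally have m: "m \<longlonglongrightarrow> p" .
  have "M \<longlonglongrightarrow> (\<integral>x. 1 \<partial>H)"
    unfolding M_def
    by (rule integral_dominated_convergence[where w="\<lambda>_. 1"])
       (use trapezoid_bounds trapezoid_widening_tendsto in auto)
  then have M: "M \<longlonglongrightarrow> 1" by simp
  define c where "c n = m n / M n" for n
  have c: "c \<longlonglongrightarrow> p" unfolding c_def using tendsto_divide[OF m M] by simp
  then obtain Kc where Kc: "\<And>n. \<bar>c n\<bar> \<le> Kc"
    using Bseq_def convergent_imp_Bseq convergentI by (metis real_norm_def)
  define f where "f n x = trapezoid a b n x - c n * trapezoid (- real n) (real n) 0 x" for n x
  have fm [measurable]: "f n \<in> borel_measurable borel" for n unfolding f_def[abs_def] by measurable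
  have p01: "0 \<le> p" "p \<le> 1" by (auto simp: p_def)
  have "(\<lambda>n. \<integral>x. (f n x - (indicator {a<..b} x - p))\<^sup>2 \<partial>H) \<longlonglongrightarrow> (\<integral>x. 0 \<partial>H)"
  proof (rule integral_dominated_convergence[where w="\<lambda>_. (Kc + 3)\<^sup>2"])
    have "f n \<in> borel_measurable H" for n by simp
    show "AE x in H. (\<lambda>n. (f n x - (indicator {a<..b} x - p))\<^sup>2) \<longlonglongrightarrow> 0"
      using ind
    proof eventually_elim
      case (elim x)
      have "(\<lambda>n. f n x) \<longlonglongrightarrow> indicator {a..b} x - p * 1"
        unfolding f_def by (intro tendsto_intros trapezoid_tendsto trapezoid_widening_tendsto c)
      then have "(\<lambda>n. (f n x - (indicator {a<..b} x - p))\<^sup>2) \<longlonglongrightarrow> ((indicator {a<..b} x - p * 1) - (indicator {a<..b} x - p))\<^sup>2"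
        unfolding elim by (intro tendsto_intros)
      then show ?case by simp
    qed
    fix n
    have "\<bar>f n x - (indicator {a<..b} x - p)\<bar> \<le> Kc + 3" for x
    proof -
      have "\<bar>c n * trapezoid (- real n) (real n) 0 x\<bar> \<le> Kc * 1"
        unfolding abs_mult using Kc[of n] trapezoid_bounds[of "- real n" "real n" 0 x]
        by (intro mult_mono) auto
      moreover have "\<bar>indicator {a<..b} x :: real\<bar> \<le> 1" by (auto simp: indicator_def)
      ultimately show ?thesis using trapezoid_bounds[of a b n x] p01 unfolding f_def by linarith
    qed
    then show "AE x in H. norm ((f n x - (indicator {a<..b} x - p))\<^sup>2) \<le> (Kc + 3)\<^sup>2"
      by (intro AE_I2) (metis norm_power power2_abs power_mono abs_ge_zero real_norm_def)
  qed auto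
  then have lim: "(\<lambda>n. \<integral>x. (f n x - (indicator {a<..b} x - p))\<^sup>2 \<partial>H) \<longlonglongrightarrow> 0" by simp
  have "eventually (\<lambda>n. (\<integral>x. (f n x - (indicator {a<..b} x - p))\<^sup>2 \<partial>H) < \<eta>) sequentially"
    by (rule order_tendstoD(2)[OF lim assms])
  \<comment> \<open>\<open>c n\<close> is a quotient by \<open>M n\<close>; positivity of
    \<open>M n\<close> makes c n M n equal to m n, hence the mean of \<open>f n\<close> equal to
    0.\<close>
  moreover have "eventually (\<lambda>n. M n > 0) sequentially"
    by (rule order_tendstoD(1)[OF M]) simp
  ultimately have "eventually (\<lambda>n. (\<integral>x. (f n x - (indicator {a<..b} x - p))\<^sup>2 \<partial>H) < \<eta> \<and> M n > 0) sequentially"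
    by eventually_elim auto
  then obtain n where n: "(\<integral>x. (f n x - (indicator {a<..b} x - p))\<^sup>2 \<partial>H) < \<eta>" "M n > 0"
    using eventually_happens'[OF sequentially_bot] by blast
  let ?R = "\<bar>a\<bar> + \<bar>b\<bar> + real n + 1"
  show thesis
  proof (rule that[of _ "f n" ?R])
    have "(real (Suc n) + \<bar>c n\<bar> * real (Suc 0))-lipschitz_on UNIV (\<lambda>x. trapezoid a b n x - c n * trapezoid (- real n) (real n) 0 x)"
      by (intro lipschitz_on_diff lipschitz_on_cmult_real trapezoid_lipschitz)
    then show "(real (Suc n) + \<bar>c n\<bar> * real (Suc 0))-lipschitz_on UNIV (f n)" by (simp add: f_def[abs_def])
    show "f n x = 0" if "?R \<le> \<bar>x\<bar>" for x
      unfolding f_def using that by (subst (1 2) trapezoid_outside) auto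
    show "?R > 0" by simp
    show "(\<integral>x. f n x \<partial>H) = 0"
      unfolding f_def using iT n(2) by (simp add: m_def[symmetric] M_def[symmetric] c_def)
    show "(\<integral>x. (f n x - (indicator {a<..b} x - measure H {a<..b}))\<^sup>2 \<partial>H) \<le> \<eta>"
      using n(1) by (simp add: p_def)
  qed
qed

end

text \<open>Detailed balance of the acceptance rule: the accepted flow from x to y, weighted by the
  density of the swap, is the flow back.\<close>

lemma metropolis_ratio_swap: "metropolis_ratio (- x) * exp x = metropolis_ratio x"
proof (cases "x \<ge> 0")
  case True
  then show ?thesis
    by (simp add: metropolis_ratio_nonneg metropolis_ratio_nonpos exp_minus)
next
  case False
  then show ?thesis
    by (simp add: metropolis_ratio_nonneg metropolis_ratio_nonpos)
qed

section \<open>Finite products of densities and of image measures\<close>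

lemma density_PiM_lborel:
  fixes f :: "nat \<Rightarrow> real \<Rightarrow> real"
  assumes I: "finite I" and m: "\<And>i. f i \<in> borel_measurable borel" and nn: "\<And>i x. 0 \<le> f i x"
    and p: "\<And>i. prob_space (density lborel (\<lambda>x. ennreal (f i x)))"
  shows "density (PiM I (\<lambda>_. lborel)) (\<lambda>x. ennreal (\<Prod>i\<in>I. f i (x i))) =
    PiM I (\<lambda>i. density lborel (\<lambda>x. ennreal (f i x)))"
proof -
  note m [measurable]
  interpret L: product_sigma_finite "\<lambda>_::nat. lborel :: real measure" ..
  interpret P: product_prob_space "\<lambda>i. density lborel (\<lambda>x. ennreal (f i x))" UNIV
    by (rule product_prob_spaceI) (rule p)
  show ?thesis
  proof (rule P.PiM_eqI[OF I])
    show "sets (density (PiM I (\<lambda>_. lborel)) (\<lambda>x. ennreal (\<Prod>i\<in>I. f i (x i)))) =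
        sets (PiM I (\<lambda>i. density lborel (\<lambda>x. ennreal (f i x))))"
      by (simp cong: sets_PiM_cong)
    fix A assume "\<And>i. i \<in> I \<Longrightarrow> A i \<in> sets (density lborel (\<lambda>x. ennreal (f i x)))"
    then have A [measurable]: "i \<in> I \<Longrightarrow> A i \<in> sets borel" for i by simp
    have "emeasure (density (PiM I (\<lambda>_. lborel)) (\<lambda>x. ennreal (\<Prod>i\<in>I. f i (x i)))) (Pi\<^sub>E I A) =
       (\<integral>\<^sup>+x. ennreal (\<Prod>i\<in>I. f i (x i)) * indicator (Pi\<^sub>E I A) x \<partial>PiM I (\<lambda>_. lborel))"
      using I by (intro emeasure_density) auto
    also have "\<dots> = (\<integral>\<^sup>+x. (\<Prod>i\<in>I. ennreal (f i (x i)) * indicator (A i) (x i)) \<partial>PiM I (\<lambda>_. lborel))"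
    proof (rule nn_integral_cong)
      fix x assume "x \<in> space (PiM I (\<lambda>_. lborel :: real measure))"
      then have "indicator (Pi\<^sub>E I A) x = (\<Prod>i\<in>I. indicator (A i) (x i) :: ennreal)"
        using I by (auto simp: space_PiM indicator_def PiE_def Pi_def prod_ennreal prod_zero_iff intro!: prod.neutral[symmetric])
      then show "ennreal (\<Prod>i\<in>I. f i (x i)) * indicator (Pi\<^sub>E I A) x =
          (\<Prod>i\<in>I. ennreal (f i (x i)) * indicator (A i) (x i))"
        by (simp add: prod.distrib prod_ennreal nn)
    qed
    also have "\<dots> = (\<Prod>i\<in>I. \<integral>\<^sup>+x. ennreal (f i x) * indicator (A i) x \<partial>lborel)"
      using I by (intro L.product_nn_integral_prod) auto
    also have "\<dots> = (\<Prod>i\<in>I. emeasure (density lborel (\<lambda>x. ennreal (f i x))) (A i))"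
      by (intro prod.cong refl emeasure_density[symmetric]) auto
    finally show "emeasure (density (PiM I (\<lambda>_. lborel)) (\<lambda>x. ennreal (\<Prod>i\<in>I. f i (x i)))) (Pi\<^sub>E I A) =
      (\<Prod>i\<in>I. emeasure (density lborel (\<lambda>x. ennreal (f i x))) (A i))" .
  qed
qed

lemma distr_PiM_componentwise:
  fixes N :: "'a measure" and f :: "nat \<Rightarrow> 'a \<Rightarrow> 'b" and L :: "'b measure"
  assumes I: "finite I" and N: "prob_space N" and m: "\<And>i. f i \<in> measurable N L"
  shows "distr (PiM I (\<lambda>_. N)) (PiM I (\<lambda>_. L)) (\<lambda>\<xi>. \<lambda>i\<in>I. f i (\<xi> i)) = PiM I (\<lambda>i. distr N L (f i))"
proof -
  note m [measurable]
  interpret N: product_prob_space "\<lambda>_::nat. N" UNIV by (rule product_prob_spaceI) (rule N)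
  interpret P: product_prob_space "\<lambda>i. distr N L (f i)" UNIV
    by (rule product_prob_spaceI) (rule prob_space.prob_space_distr[OF N m])
  have T: "(\<lambda>\<xi>. \<lambda>i\<in>I. f i (\<xi> i)) \<in> measurable (PiM I (\<lambda>_. N)) (PiM I (\<lambda>_. L))" by measurable
  show ?thesis
  proof (rule P.PiM_eqI[OF I])
    show "sets (distr (PiM I (\<lambda>_. N)) (PiM I (\<lambda>_. L)) (\<lambda>\<xi>. \<lambda>i\<in>I. f i (\<xi> i))) = sets (PiM I (\<lambda>i. distr N L (f i)))"
      by (simp cong: sets_PiM_cong)
    fix A assume "\<And>i. i \<in> I \<Longrightarrow> A i \<in> sets (distr N L (f i))"
    then have A [measurable]: "i \<in> I \<Longrightarrow> A i \<in> sets L" for i by simp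
    have "emeasure (distr (PiM I (\<lambda>_. N)) (PiM I (\<lambda>_. L)) (\<lambda>\<xi>. \<lambda>i\<in>I. f i (\<xi> i))) (Pi\<^sub>E I A) =
      emeasure (PiM I (\<lambda>_. N)) ((\<lambda>\<xi>. \<lambda>i\<in>I. f i (\<xi> i)) -` Pi\<^sub>E I A \<inter> space (PiM I (\<lambda>_. N)))"
      using I by (intro emeasure_distr T) auto
    also have "(\<lambda>\<xi>. \<lambda>i\<in>I. f i (\<xi> i)) -` Pi\<^sub>E I A \<inter> space (PiM I (\<lambda>_. N)) = Pi\<^sub>E I (\<lambda>i. f i -` A i \<inter> space N)"
      by (auto simp: space_PiM PiE_def Pi_def)
    also have "emeasure (PiM I (\<lambda>_. N)) \<dots> = (\<Prod>i\<in>I. emeasure N (f i -` A i \<inter> space N))"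
      by (rule N.emeasure_PiM[OF I]) measurable
    also have "\<dots> = (\<Prod>i\<in>I. emeasure (distr N L (f i)) (A i))"
      by (intro prod.cong refl emeasure_distr[symmetric]) auto
    finally show "emeasure (distr (PiM I (\<lambda>_. N)) (PiM I (\<lambda>_. L)) (\<lambda>\<xi>. \<lambda>i\<in>I. f i (\<xi> i))) (Pi\<^sub>E I A) =
      (\<Prod>i\<in>I. emeasure (distr N L (f i)) (A i))" .
  qed
qed

section \<open>The MALA kernel\<close>

text \<open>The second stage of the kernel, with the current state z fixed, as a kernel in the
  proposal y.\<close>

definition accept_reject :: "'a measure \<Rightarrow> ('a \<Rightarrow> real) \<Rightarrow> 'a \<Rightarrow> 'a \<Rightarrow> 'a measure" where
  "accept_reject M a z y = measure_pmf (bernoulli_pmf (a y)) \<bind> (\<lambda>b. return M (if b then y else z))"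

context
  fixes M :: "'a measure" and a :: "'a \<Rightarrow> real" and z :: 'a
  assumes a [measurable]: "a \<in> borel_measurable M" and a01: "\<And>y. 0 \<le> a y" "\<And>y. a y \<le> 1"
    and z: "z \<in> space M"
begin

lemma return_choice_measurable:
  assumes "y \<in> space M"
  shows "(\<lambda>b. return M (if b then y else z)) \<in> measurable (measure_pmf p) (subprob_algebra M)"
  using assms z by (auto simp: space_subprob_algebra subprob_space_return)

lemma emeasure_accept_reject:
  assumes "y \<in> space M" "A \<in> sets M"
  shows "emeasure (accept_reject M a z y) A = indicator A y * ennreal (a y) + indicator A z * ennreal (1 - a y)"
  unfolding accept_reject_def
  by (subst emeasure_bind[OF _ return_choice_measurable]) (use assms a01 in auto)

lemma sets_accept_reject: "y \<in> space M \<Longrightarrow> sets (accept_reject M a z y) = sets M"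
  unfolding accept_reject_def by (subst sets_bind) auto

lemma prob_space_accept_reject: assumes "y \<in> space M" shows "prob_space (accept_reject M a z y)"
proof
  have s: "space (accept_reject M a z y) = space M"
    by (rule sets_eq_imp_space_eq[OF sets_accept_reject[OF assms]])
  show "emeasure (accept_reject M a z y) (space (accept_reject M a z y)) = 1"
    unfolding s using assms z a01[of y]
    by (subst emeasure_accept_reject) (auto simp: ennreal_plus[symmetric] simp del: ennreal_plus)
qed

lemma accept_reject_measurable: "accept_reject M a z \<in> measurable M (subprob_algebra M)"
proof (rule measurable_subprob_algebra)
  fix A assume A [measurable]: "A \<in> sets M"
  have "(\<lambda>y. indicator A y * ennreal (a y) + indicator A z * ennreal (1 - a y)) \<in> borel_measurable M"
    by measurable
  then show "(\<lambda>y. emeasure (accept_reject M a z y) A) \<in> borel_measurable M"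
    by (rule measurable_cong[THEN iffD1, rotated]) (simp add: emeasure_accept_reject)
qed (auto simp: sets_accept_reject prob_space_imp_subprob_space prob_space_accept_reject)

lemma integral_accept_reject:
  fixes f :: "'a \<Rightarrow> real"
  assumes "y \<in> space M" "bdd_fun M f"
  shows "(\<integral>x. f x \<partial>accept_reject M a z y) = a y * f y + (1 - a y) * f z"
proof -
  obtain B where f [measurable]: "f \<in> borel_measurable M" and B: "\<And>x. x \<in> space M \<Longrightarrow> \<bar>f x\<bar> \<le> B"
    using assms(2) by (auto simp: bdd_fun_def)
  have "(\<integral>x. f x \<partial>accept_reject M a z y) =
     (\<integral>b. (\<integral>x. f x \<partial>return M (if b then y else z)) \<partial>measure_pmf (bernoulli_pmf (a y)))"
    unfolding accept_reject_def
    by (rule integral_bind[where B'=1, OF f B return_choice_measurable[OF assms(1)]])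
       (use assms z in \<open>auto intro: measure_pmf.finite_measure_axioms\<close>)
  also have "\<dots> = (\<integral>b. f (if b then y else z) \<partial>measure_pmf (bernoulli_pmf (a y)))"
    using assms z by (intro integral_cong_AE) (auto simp: integral_return)
  also have "\<dots> = a y * f y + (1 - a y) * f z"
    using a01 by (subst integral_bernoulli_pmf) auto
  finally show ?thesis .
qed

end

section \<open>The chain in dimension d with proposal standard deviation s\<close>

locale mala_chain = langevin_density +
  fixes d :: nat and s :: real
  assumes s_pos: "0 < s"
begin

abbreviation LP :: "(nat \<Rightarrow> real) measure" where "LP \<equiv> lebesgue_prod d"
definition HP :: "(nat \<Rightarrow> real) measure" where "HP = PiM {1..d} (\<lambda>_. H)"
definition GP :: "(nat \<Rightarrow> real) measure" where "GP = PiM {1..d} (\<lambda>_. gauss)"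

definition T :: "(nat \<Rightarrow> real) \<Rightarrow> (nat \<Rightarrow> real) \<Rightarrow> nat \<Rightarrow> real" where
  "T z \<xi> = (\<lambda>i\<in>{1..d}. move s (z i) (\<xi> i))"

definition W :: "(nat \<Rightarrow> real) \<Rightarrow> (nat \<Rightarrow> real) \<Rightarrow> real" where
  "W z y = (\<Sum>i\<in>{1..d}. log_ratio s (z i) (y i))"

definition Q :: "(nat \<Rightarrow> real) \<Rightarrow> (nat \<Rightarrow> real) \<Rightarrow> real" where
  "Q z y = (\<Prod>i\<in>{1..d}. normal_density (z i + s\<^sup>2 / 2 * score (z i)) s (y i))"

lemma sets_LP [measurable_cong]: "sets LP = sets (PiM {1..d} (\<lambda>_. borel))"
  unfolding lebesgue_prod_def by (rule sets_PiM_cong) auto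

lemma sets_HP [simp, measurable_cong]: "sets HP = sets LP"
  unfolding HP_def lebesgue_prod_def by (rule sets_PiM_cong) auto

lemma sets_GP [measurable_cong]: "sets GP = sets (PiM {1..d} (\<lambda>_. borel))"
  unfolding GP_def by (rule sets_PiM_cong) auto

lemma space_HP [simp]: "space HP = space LP"
  by (rule sets_eq_imp_space_eq[OF sets_HP])

sublocale HP: prob_space HP
  unfolding HP_def by (intro prob_space_PiM H.prob_space_axioms)

sublocale GP: prob_space GP
  unfolding GP_def by (intro prob_space_PiM prob_space_gauss)

lemma grad_log_prod_target:
  assumes "i \<in> {1..d}"
  shows "grad_log (prod_target h d) z i = score (z i)"
proof -
  have "(\<lambda>u. ln (prod_target h d (z(i := u)))) = (\<lambda>u. ln (h u) + ln (\<Prod>j\<in>{1..d} - {i}. h (z j)))"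
  proof
    fix u
    have "prod_target h d (z(i := u)) = h u * (\<Prod>j\<in>{1..d} - {i}. h (z j))"
      unfolding prod_target_def using assms by (subst prod.remove[of _ i]) (auto intro!: prod.cong)
    then show "ln (prod_target h d (z(i := u))) = ln (h u) + ln (\<Prod>j\<in>{1..d} - {i}. h (z j))"
      using ln_mult_pos[OF h_pos[of u] prod_pos[of "{1..d} - {i}" "\<lambda>j. h (z j)"]] h_pos by simp
  qed
  moreover have "((\<lambda>u. ln (h u) + ln (\<Prod>j\<in>{1..d} - {i}. h (z j))) has_real_derivative score (z i)) (at (z i))"
    using DERIV_add[OF ln_h_DERIV DERIV_const] by simp
  ultimately show ?thesis unfolding grad_log_def by (simp add: DERIV_imp_deriv)
qed

lemma mala_proposal_density_eq: "mala_proposal_density d (s\<^sup>2) (prod_target h d) = Q"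
  using s_pos by (auto simp: mala_proposal_density_def Q_def fun_eq_iff grad_log_prod_target intro!: prod.cong)

lemma T_space: "T z \<xi> \<in> space LP"
  by (auto simp: T_def space_PiM lebesgue_prod_def)

lemma T_component: "i \<in> {1..d} \<Longrightarrow> T z \<xi> i = move s (z i) (\<xi> i)"
  by (simp add: T_def)

lemma W_T: "W z (T z \<xi>) = (\<Sum>i\<in>{1..d}. w s (z i) (\<xi> i))"
  by (auto simp: W_def T_component w_def intro!: sum.cong)

lemma W_swap: "W y z = - W z y"
  unfolding W_def sum_negf[symmetric] by (intro sum.cong refl log_ratio_swap)

lemma Q_pos: "Q z y > 0"
  unfolding Q_def using s_pos by (intro prod_pos) (auto intro!: normal_density_pos)

lemma prod_target_pos: "prod_target h d z > 0"
  unfolding prod_target_def using h_pos by (intro prod_pos) auto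

lemma balance_d: "prod_target h d y * Q y z = prod_target h d z * Q z y * exp (W z y)"
proof -
  interpret P: metropolis_proposal lborel gauss h "\<lambda>x y. normal_density (x + s\<^sup>2 / 2 * score x) s y" "move s" "log_ratio s"
    by (rule one_site_proposal[OF s_pos])
  show ?thesis
    unfolding prod_target_def Q_def W_def exp_sum[OF finite_atLeastAtMost] prod.distrib[symmetric]
    by (intro prod.cong refl P.balance) auto
qed

lemma mala_accept_eq: "mala_accept d (s\<^sup>2) (prod_target h d) z y = metropolis_ratio (W z y)"
proof -
  have "prod_target h d y * Q y z / (prod_target h d z * Q z y) = exp (W z y)"
    by (subst balance_d) (use prod_target_pos[of z] Q_pos[of z y] in simp)
  then show ?thesis
    by (simp only: mala_accept_def mala_proposal_density_eq metropolis_ratio_def)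
qed

sublocale P: metropolis_proposal LP GP "prod_target h d" Q T W
proof (intro metropolis_proposal.intro metropolis_proposal_axioms.intro)
  interpret L: product_sigma_finite "\<lambda>_::nat. lborel :: real measure" ..
  interpret LI: finite_product_sigma_finite "\<lambda>_::nat. lborel :: real measure" "{1..d}" by standard simp
  show "sigma_finite_measure LP" unfolding lebesgue_prod_def by (rule LI.sigma_finite_measure_axioms)
  show "prob_space GP" by (rule GP.prob_space_axioms)
  show "prod_target h d \<in> borel_measurable LP"
    unfolding prod_target_def[abs_def] by measurable
  show "(\<lambda>(x, y). Q x y) \<in> borel_measurable (LP \<Otimes>\<^sub>M LP)"
    unfolding Q_def normal_density_def by measurable
  show "(\<lambda>(x, y). W x y) \<in> borel_measurable (LP \<Otimes>\<^sub>M LP)"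
    unfolding W_def by measurable
  show "(\<lambda>(x, \<xi>). T x \<xi>) \<in> measurable (LP \<Otimes>\<^sub>M GP) LP"
    unfolding T_def lebesgue_prod_def by measurable
  have dens: "density LP (\<lambda>x. ennreal (prod_target h d x)) = HP"
    unfolding prod_target_def HP_def H_def lebesgue_prod_def
    by (rule density_PiM_lborel) (use h_pos H.prob_space_axioms in \<open>auto simp: H_def less_imp_le\<close>)
  then show "prob_space (density LP (\<lambda>x. ennreal (prod_target h d x)))" using HP.prob_space_axioms by simp
  show "distr GP LP (T x) = density LP (\<lambda>y. ennreal (Q x y))" for x
  proof -
    interpret P: metropolis_proposal lborel gauss h "\<lambda>x y. normal_density (x + s\<^sup>2 / 2 * score x) s y" "move s" "log_ratio s"
      by (rule one_site_proposal[OF s_pos])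
    have "distr GP LP (T x) = PiM {1..d} (\<lambda>i. distr gauss lborel (move s (x i)))"
      unfolding GP_def T_def[abs_def] lebesgue_prod_def by (rule distr_PiM_componentwise) (auto intro: prob_space_gauss)
    also have "\<dots> = PiM {1..d} (\<lambda>i. density lborel (\<lambda>y. ennreal (normal_density (x i + s\<^sup>2 / 2 * score (x i)) s y)))"
      by (intro PiM_cong refl P.proposal) simp
    also have "\<dots> = density LP (\<lambda>y. ennreal (Q x y))"
      unfolding Q_def lebesgue_prod_def using s_pos
      by (intro density_PiM_lborel[symmetric]) (auto intro: prob_space_normal_density)
    finally show ?thesis .
  qed
qed (rule less_imp_le[OF prod_target_pos] less_imp_le[OF Q_pos] balance_d)+

lemma target_eq: "P.target = HP"
  unfolding prod_target_def HP_def H_def lebesgue_prod_def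
  by (rule density_PiM_lborel) (use h_pos H.prob_space_axioms in \<open>auto simp: H_def less_imp_le\<close>)

text \<open>The transition operator as an integral over the noise, in increment form since a
  rejection changes nothing. It is meaningful for every z, even outside the space, so linearity is
  an equality of functions.\<close>

definition MP :: "((nat \<Rightarrow> real) \<Rightarrow> real) \<Rightarrow> (nat \<Rightarrow> real) \<Rightarrow> real" where
  "MP f z = f z + (\<integral>\<xi>. metropolis_ratio (W z (T z \<xi>)) * (f (T z \<xi>) - f z) \<partial>GP)"

lemma WT_measurable [measurable]: "(\<lambda>\<xi>. W z (T z \<xi>)) \<in> borel_measurable GP"
  unfolding W_T by measurable

lemma T_measurable1 [measurable]: "T z \<in> measurable GP LP"
  unfolding T_def[abs_def] lebesgue_prod_def by measurable

lemma bdd_fun_HP: "bdd_fun HP f \<longleftrightarrow> bdd_fun LP f"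
  by (simp add: bdd_fun_def measurable_cong_sets[OF sets_HP refl])

lemma increment_integrable:
  assumes "bdd_fun LP f"
  shows "integrable GP (\<lambda>\<xi>. metropolis_ratio (W z (T z \<xi>)) * (f (T z \<xi>) - c))"
proof -
  obtain B where f [measurable]: "f \<in> borel_measurable LP" and B: "\<And>x. x \<in> space LP \<Longrightarrow> \<bar>f x\<bar> \<le> B"
    using assms by (auto simp: bdd_fun_def)
  show ?thesis
  proof (rule GP.integrable_const_bound[where B="B + \<bar>c\<bar>"])
    show "AE \<xi> in GP. norm (metropolis_ratio (W z (T z \<xi>)) * (f (T z \<xi>) - c)) \<le> B + \<bar>c\<bar>"
    proof (rule AE_I2)
      fix \<xi>
      have "\<bar>metropolis_ratio (W z (T z \<xi>))\<bar> * \<bar>f (T z \<xi>) - c\<bar> \<le> 1 * (B + \<bar>c\<bar>)"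
        using B[OF T_space, of z \<xi>] by (intro mult_mono metropolis_ratio_abs_le) auto
      then show "norm (metropolis_ratio (W z (T z \<xi>)) * (f (T z \<xi>) - c)) \<le> B + \<bar>c\<bar>" by (simp add: abs_mult)
    qed
  qed measurable
qed

lemma MP_linear:
  assumes "bdd_fun LP f" "bdd_fun LP g"
  shows "MP (\<lambda>x. a * f x + b * g x) = (\<lambda>x. a * MP f x + b * MP g x)"
proof
  fix z
  let ?r = "\<lambda>\<xi>. metropolis_ratio (W z (T z \<xi>))"
  have "(\<integral>\<xi>. ?r \<xi> * (a * f (T z \<xi>) + b * g (T z \<xi>) - (a * f z + b * g z)) \<partial>GP) =
     (\<integral>\<xi>. a * (?r \<xi> * (f (T z \<xi>) - f z)) + b * (?r \<xi> * (g (T z \<xi>) - g z)) \<partial>GP)"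
    by (simp add: algebra_simps)
  also have "\<dots> = a * (\<integral>\<xi>. ?r \<xi> * (f (T z \<xi>) - f z) \<partial>GP) + b * (\<integral>\<xi>. ?r \<xi> * (g (T z \<xi>) - g z) \<partial>GP)"
    using increment_integrable[OF assms(1), of z "f z"] increment_integrable[OF assms(2), of z "g z"] by simp
  finally show "MP (\<lambda>x. a * f x + b * g x) z = a * MP f z + b * MP g z"
    by (simp add: MP_def algebra_simps)
qed

lemma MP_const: "MP (\<lambda>_. c) = (\<lambda>_. c)"
  by (simp add: MP_def fun_eq_iff)

lemma MP_bdd:
  assumes "bdd_fun LP f" shows "bdd_fun LP (MP f)"
proof -
  obtain B where f [measurable]: "f \<in> borel_measurable LP" and B: "\<And>x. x \<in> space LP \<Longrightarrow> \<bar>f x\<bar> \<le> B"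
    using assms by (auto simp: bdd_fun_def)
  show ?thesis
  proof (rule bdd_funI[where B="B + 2 * B"])
    show "MP f \<in> borel_measurable LP" unfolding MP_def[abs_def] by measurable
    fix z assume z: "z \<in> space LP"
    have "\<bar>\<integral>\<xi>. metropolis_ratio (W z (T z \<xi>)) * (f (T z \<xi>) - f z) \<partial>GP\<bar> \<le> 2 * B"
    proof (rule GP.abs_integral_le)
      fix \<xi>
      have "\<bar>metropolis_ratio (W z (T z \<xi>))\<bar> * \<bar>f (T z \<xi>) - f z\<bar> \<le> 1 * (2 * B)"
        using B[OF T_space, of z \<xi>] B[OF z] by (intro mult_mono metropolis_ratio_abs_le) auto
      then show "\<bar>metropolis_ratio (W z (T z \<xi>)) * (f (T z \<xi>) - f z)\<bar> \<le> 2 * B" by (simp add: abs_mult)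
    qed (use B[OF z] in auto)
    then show "\<bar>MP f z\<bar> \<le> B + 2 * B" unfolding MP_def using B[OF z] by linarith
  qed
qed

text \<open>The operator is multiplication by one minus the acceptance probability, which is visibly
  symmetric, plus an accepted part. The latter is symmetric because swapping state and proposal
  costs exp W, which \<open>metropolis_ratio_swap\<close> absorbs.\<close>

lemma integral_MP:
  assumes f: "bdd_fun LP f" and g: "bdd_fun LP g"
  shows "(\<integral>z. f z * MP g z \<partial>HP) = (\<integral>z. MP f z * g z \<partial>HP)"
proof -
  obtain A where fm [measurable]: "f \<in> borel_measurable LP" and A: "\<And>x. x \<in> space LP \<Longrightarrow> \<bar>f x\<bar> \<le> A"
    using f by (auto simp: bdd_fun_def)
  obtain B where gm [measurable]: "g \<in> borel_measurable LP" and B: "\<And>x. x \<in> space LP \<Longrightarrow> \<bar>g x\<bar> \<le> B"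
    using g by (auto simp: bdd_fun_def)
  interpret HG: pair_prob_space HP GP ..
  let ?r = "\<lambda>z \<xi>. metropolis_ratio (W z (T z \<xi>))"
  have i: "integrable (HP \<Otimes>\<^sub>M GP) (\<lambda>p. ?r (fst p) (snd p) * (u (fst p) * v (T (fst p) (snd p))))"
    if u: "bdd_fun LP u" and v: "bdd_fun LP v" for u v
  proof -
    obtain A where um [measurable]: "u \<in> borel_measurable LP" and A: "\<And>x. x \<in> space LP \<Longrightarrow> \<bar>u x\<bar> \<le> A"
      using u by (auto simp: bdd_fun_def)
    obtain B where vm [measurable]: "v \<in> borel_measurable LP" and B: "\<And>x. x \<in> space LP \<Longrightarrow> \<bar>v x\<bar> \<le> B"
      using v by (auto simp: bdd_fun_def)
    show ?thesis
    proof (rule HG.integrable_const_bound[where B="1 * (A * B)"])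
      show "AE p in HP \<Otimes>\<^sub>M GP. norm (?r (fst p) (snd p) * (u (fst p) * v (T (fst p) (snd p)))) \<le> 1 * (A * B)"
      proof (rule AE_I2)
        fix p assume "p \<in> space (HP \<Otimes>\<^sub>M GP)"
        then have p: "fst p \<in> space LP" by (auto simp: space_pair_measure)
        have "A \<ge> 0" using A[OF p] by linarith
        then show "norm (?r (fst p) (snd p) * (u (fst p) * v (T (fst p) (snd p)))) \<le> 1 * (A * B)"
          unfolding real_norm_def abs_mult using A[OF p] B[OF T_space, of "fst p" "snd p"]
          by (intro mult_mono metropolis_ratio_abs_le) auto
      qed
    qed measurable
  qed
  have fg: "bdd_fun LP (\<lambda>x. f x * g x)" by (rule bdd_fun_mult[OF f g])
  have c1: "bdd_fun LP (\<lambda>_. 1)" by (rule bdd_fun_const)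
  have split: "(\<integral>z. u z * MP v z \<partial>HP) = (\<integral>z. u z * v z \<partial>HP)
      + (\<integral>p. ?r (fst p) (snd p) * (u (fst p) * v (T (fst p) (snd p))) \<partial>(HP \<Otimes>\<^sub>M GP))
      - (\<integral>p. ?r (fst p) (snd p) * (u (fst p) * v (fst p) * 1) \<partial>(HP \<Otimes>\<^sub>M GP))"
    if u: "bdd_fun LP u" and v: "bdd_fun LP v" for u v
  proof -
    have uv: "bdd_fun LP (\<lambda>x. u x * v x)" by (rule bdd_fun_mult[OF u v])
    note iu = i[OF u v] i[OF uv c1]
    have "(\<integral>z. u z * MP v z \<partial>HP) = (\<integral>z. u z * v z + (\<integral>\<xi>. ?r z \<xi> * (u z * v (T z \<xi>)) - ?r z \<xi> * (u z * v z * 1) \<partial>GP) \<partial>HP)"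
      unfolding MP_def by (simp add: algebra_simps flip: integral_mult_right_zero)
    also have "\<dots> = (\<integral>z. u z * v z \<partial>HP) + (\<integral>z. (\<integral>\<xi>. ?r z \<xi> * (u z * v (T z \<xi>)) - ?r z \<xi> * (u z * v z * 1) \<partial>GP) \<partial>HP)"
      using HP.bdd_fun_integrable[of "\<lambda>z. u z * v z"] uv
        HG.integrable_fst'[OF Bochner_Integration.integrable_diff[OF iu]]
      by (intro Bochner_Integration.integral_add) (simp_all add: bdd_fun_HP)
    also have "(\<integral>z. (\<integral>\<xi>. ?r z \<xi> * (u z * v (T z \<xi>)) - ?r z \<xi> * (u z * v z * 1) \<partial>GP) \<partial>HP) =
       (\<integral>p. ?r (fst p) (snd p) * (u (fst p) * v (T (fst p) (snd p))) - ?r (fst p) (snd p) * (u (fst p) * v (fst p) * 1) \<partial>(HP \<Otimes>\<^sub>M GP))"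
      using HG.integral_fst'[OF Bochner_Integration.integrable_diff[OF iu]] by simp
    also have "\<dots> = (\<integral>p. ?r (fst p) (snd p) * (u (fst p) * v (T (fst p) (snd p))) \<partial>(HP \<Otimes>\<^sub>M GP))
       - (\<integral>p. ?r (fst p) (snd p) * (u (fst p) * v (fst p) * 1) \<partial>(HP \<Otimes>\<^sub>M GP))"
      by (rule Bochner_Integration.integral_diff[OF iu])
    finally show ?thesis by simp
  qed
  \<comment> \<open>The ratio is taken in the reverse direction here: multiplied by exp W in the
    swap formula, it becomes the forward ratio.\<close>
  have "(\<lambda>(x, y). metropolis_ratio (W y x) * (f x * g y)) \<in> borel_measurable (LP \<Otimes>\<^sub>M LP)" by measurable
  from P.integral_swap(2)[OF this]
  have "(\<integral>p. metropolis_ratio (W (T (fst p) (snd p)) (fst p)) * (f (fst p) * g (T (fst p) (snd p))) * exp (W (fst p) (T (fst p) (snd p))) \<partial>(HP \<Otimes>\<^sub>M GP)) =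
      (\<integral>p. ?r (fst p) (snd p) * (f (T (fst p) (snd p)) * g (fst p)) \<partial>(HP \<Otimes>\<^sub>M GP))"
    by (simp add: target_eq split_beta')
  moreover have wr: "metropolis_ratio (W (T z \<xi>) z) * c * exp (W z (T z \<xi>)) = ?r z \<xi> * c" for z \<xi> c
    using metropolis_ratio_swap[of "W z (T z \<xi>)"] W_swap[of "T z \<xi>" z] by (simp add: mult_ac)
  ultimately have sw: "(\<integral>p. ?r (fst p) (snd p) * (f (fst p) * g (T (fst p) (snd p))) \<partial>(HP \<Otimes>\<^sub>M GP)) =
      (\<integral>p. ?r (fst p) (snd p) * (g (fst p) * f (T (fst p) (snd p))) \<partial>(HP \<Otimes>\<^sub>M GP))"
    by (simp only: wr mult.commute[of "g _"])
  show ?thesis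
    unfolding split[OF f g] mult.commute[of "MP f _"] split[OF g f] sw by (simp add: mult_ac)
qed

text \<open>Jensen in two stages: for the choice between accepting and rejecting at fixed noise,
  then for the average over the noise.\<close>

lemma MP_square_le:
  assumes f: "bdd_fun LP f"
  shows "(MP f z)\<^sup>2 \<le> MP (\<lambda>x. (f x)\<^sup>2) z"
proof -
  let ?r = "\<lambda>\<xi>. metropolis_ratio (W z (T z \<xi>))"
  have f2: "bdd_fun LP (\<lambda>x. (f x)\<^sup>2)" by (rule bdd_fun_power2[OF f])
  have fm [measurable]: "f \<in> borel_measurable LP" using f by (rule bdd_fun_measurable)
  have i1: "integrable GP (\<lambda>\<xi>. ?r \<xi> * (f (T z \<xi>) - f z))" by (rule increment_integrable[OF f])
  have i2: "integrable GP (\<lambda>\<xi>. ?r \<xi> * ((f (T z \<xi>))\<^sup>2 - (f z)\<^sup>2))" by (rule increment_integrable[OF f2])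
  have le: "(f z + ?r \<xi> * (f (T z \<xi>) - f z))\<^sup>2 \<le> (f z)\<^sup>2 + ?r \<xi> * ((f (T z \<xi>))\<^sup>2 - (f z)\<^sup>2)" for \<xi>
  proof -
    \<comment> \<open>The Jensen gap of a two-point distribution with weights r and 1 - r.\<close>
    have "?r \<xi> * (1 - ?r \<xi>) * (f (T z \<xi>) - f z)\<^sup>2 \<ge> 0"
      using metropolis_ratio_bounds by (intro mult_nonneg_nonneg) auto
    then show ?thesis by (simp add: power2_eq_square algebra_simps)
  qed
  have i3: "integrable GP (\<lambda>\<xi>. (f z + ?r \<xi> * (f (T z \<xi>) - f z))\<^sup>2)"
  proof (rule Bochner_Integration.integrable_bound)
    show "integrable GP (\<lambda>\<xi>. (f z)\<^sup>2 + ?r \<xi> * ((f (T z \<xi>))\<^sup>2 - (f z)\<^sup>2))" using i2 by simp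
    show "AE \<xi> in GP. norm ((f z + ?r \<xi> * (f (T z \<xi>) - f z))\<^sup>2) \<le> norm ((f z)\<^sup>2 + ?r \<xi> * ((f (T z \<xi>))\<^sup>2 - (f z)\<^sup>2))"
      using le by (intro AE_I2) (auto intro: order_trans[OF _ abs_ge_self])
  qed measurable
  have eq: "MP f z = (\<integral>\<xi>. f z + ?r \<xi> * (f (T z \<xi>) - f z) \<partial>GP)"
    unfolding MP_def using i1 by (simp add: GP.prob_space)
  have "(MP f z)\<^sup>2 \<le> (\<integral>\<xi>. (f z + ?r \<xi> * (f (T z \<xi>) - f z))\<^sup>2 \<partial>GP)"
    unfolding eq by (rule GP.square_integral_le[OF i3]) measurable
  also have "\<dots> \<le> (\<integral>\<xi>. (f z)\<^sup>2 + ?r \<xi> * ((f (T z \<xi>))\<^sup>2 - (f z)\<^sup>2) \<partial>GP)"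
    by (rule integral_mono[OF i3 _ le]) (simp add: i2)
  also have "\<dots> = MP (\<lambda>x. (f x)\<^sup>2) z"
    unfolding MP_def using i2 by (simp add: GP.prob_space)
  finally show ?thesis .
qed

sublocale MP: reversible_operator HP MP
proof (intro reversible_operator.intro reversible_operator_axioms.intro HP.prob_space_axioms)
  fix f :: "(nat \<Rightarrow> real) \<Rightarrow> real" assume "bdd_fun HP f"
  then have f: "bdd_fun LP f" by (simp add: bdd_fun_HP)
  note f2 = bdd_fun_power2[OF f]
  have "(\<integral>z. (MP f z)\<^sup>2 \<partial>HP) \<le> (\<integral>z. MP (\<lambda>x. (f x)\<^sup>2) z \<partial>HP)"
    using MP_square_le[OF f] f f2
    by (intro integral_mono HP.bdd_fun_integrable) (auto simp: bdd_fun_HP intro!: MP_bdd bdd_fun_power2)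
  \<comment> \<open>Invariance of the target is symmetry tested against the constant 1, which
    \<open>MP\<close> fixes.\<close>
  also have "\<dots> = (\<integral>z. (f z)\<^sup>2 \<partial>HP)"
    using integral_MP[OF bdd_fun_const[of LP 1] f2] by (simp add: MP_const)
  finally show "(\<integral>z. (MP f z)\<^sup>2 \<partial>HP) \<le> (\<integral>z. (f z)\<^sup>2 \<partial>HP)" .
qed (unfold bdd_fun_HP, (rule MP_bdd MP_linear integral_MP; assumption)+)

section \<open>From the kernel and its iterates to powers of the operator\<close>

lemma mala_kernel_eq:
  "mala_kernel d (s\<^sup>2) (prod_target h d) z =
    density LP (\<lambda>y. ennreal (Q z y)) \<bind> accept_reject LP (\<lambda>y. metropolis_ratio (W z y)) z"
  unfolding mala_kernel_def mala_proposal_density_eq mala_accept_eq accept_reject_def[abs_def] ..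

context
  fixes z assumes z: "z \<in> space LP"
begin

lemma accept_ratio_measurable: "(\<lambda>y. metropolis_ratio (W z y)) \<in> borel_measurable LP"
  using measurable_compose[OF P.W_measurable'[OF measurable_const[OF z] measurable_ident] metropolis_ratio_measurable] by simp

lemmas accept_reject_facts =
  accept_reject_measurable[OF accept_ratio_measurable metropolis_ratio_bounds(1) metropolis_ratio_bounds(2) z]
  sets_accept_reject[OF accept_ratio_measurable metropolis_ratio_bounds(1) metropolis_ratio_bounds(2) z]
  prob_space_accept_reject[OF accept_ratio_measurable metropolis_ratio_bounds(1) metropolis_ratio_bounds(2) z]
  emeasure_accept_reject[OF accept_ratio_measurable metropolis_ratio_bounds(1) metropolis_ratio_bounds(2) z]
  integral_accept_reject[OF accept_ratio_measurable metropolis_ratio_bounds(1) metropolis_ratio_bounds(2) z]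

lemma proposal_prob: "prob_space (density LP (\<lambda>y. ennreal (Q z y)))"
  unfolding P.proposal[OF z, symmetric] by (rule GP.prob_space_distr) measurable

lemma proposal_kernel_measurable:
  "accept_reject LP (\<lambda>y. metropolis_ratio (W z y)) z \<in> measurable (density LP (\<lambda>y. ennreal (Q z y))) (subprob_algebra LP)"
  by (subst measurable_cong_sets[OF sets_density refl]) (rule accept_reject_facts(1))

lemma mala_kernel_prob: "prob_space (mala_kernel d (s\<^sup>2) (prod_target h d) z)"
proof -
  interpret D: prob_space "density LP (\<lambda>y. ennreal (Q z y))" by (rule proposal_prob)
  show ?thesis
    unfolding mala_kernel_eq
    by (rule D.prob_space_bind[OF _ proposal_kernel_measurable], rule AE_I2, rule accept_reject_facts(3)) simp
qed

lemma mala_kernel_sets: "sets (mala_kernel d (s\<^sup>2) (prod_target h d) z) = sets LP"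
proof -
  have "space LP \<noteq> {}" using z by auto
  then show ?thesis
    unfolding mala_kernel_eq by (intro sets_bind accept_reject_facts(2)) simp_all
qed

text \<open>An explicit formula jointly measurable in y and z, from which measurability of the
  kernel in its starting point follows.\<close>

lemma mala_kernel_emeasure:
  assumes A [measurable]: "A \<in> sets LP"
  shows "emeasure (mala_kernel d (s\<^sup>2) (prod_target h d) z) A =
    (\<integral>\<^sup>+y. ennreal (Q z y) * (indicator A y * ennreal (metropolis_ratio (W z y)) + indicator A z * ennreal (1 - metropolis_ratio (W z y))) \<partial>LP)"
proof -
  have [measurable]: "(\<lambda>y. metropolis_ratio (W z y)) \<in> borel_measurable LP" by (rule accept_ratio_measurable)
  have "emeasure (mala_kernel d (s\<^sup>2) (prod_target h d) z) A =
    (\<integral>\<^sup>+y. emeasure (accept_reject LP (\<lambda>y. metropolis_ratio (W z y)) z y) A \<partial>density LP (\<lambda>y. ennreal (Q z y)))"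
    unfolding mala_kernel_eq by (rule emeasure_bind[OF _ proposal_kernel_measurable A]) (use z in auto)
  also have "\<dots> = (\<integral>\<^sup>+y. (indicator A y * ennreal (metropolis_ratio (W z y)) + indicator A z * ennreal (1 - metropolis_ratio (W z y))) \<partial>density LP (\<lambda>y. ennreal (Q z y)))"
    by (intro nn_integral_cong) (simp add: emeasure_accept_reject[OF accept_ratio_measurable metropolis_ratio_bounds(1) metropolis_ratio_bounds(2) z])
  also have "\<dots> = (\<integral>\<^sup>+y. ennreal (Q z y) * (indicator A y * ennreal (metropolis_ratio (W z y)) + indicator A z * ennreal (1 - metropolis_ratio (W z y))) \<partial>LP)"
    using z by (intro nn_integral_density) measurable
  finally show ?thesis .
qed

lemma mala_kernel_integral:
  assumes f: "bdd_fun LP f"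
  shows "(\<integral>x. f x \<partial>mala_kernel d (s\<^sup>2) (prod_target h d) z) = MP f z"
proof -
  obtain B where fm [measurable]: "f \<in> borel_measurable LP" and B: "\<And>x. x \<in> space LP \<Longrightarrow> \<bar>f x\<bar> \<le> B"
    using f by (auto simp: bdd_fun_def)
  have [measurable]: "(\<lambda>y. metropolis_ratio (W z y)) \<in> borel_measurable LP" by (rule accept_ratio_measurable)
  interpret D: prob_space "density LP (\<lambda>y. ennreal (Q z y))" by (rule proposal_prob)
  have "(\<integral>x. f x \<partial>mala_kernel d (s\<^sup>2) (prod_target h d) z) =
     (\<integral>y. (\<integral>x. f x \<partial>accept_reject LP (\<lambda>y. metropolis_ratio (W z y)) z y) \<partial>density LP (\<lambda>y. ennreal (Q z y)))"
    unfolding mala_kernel_eq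
  proof (rule integral_bind[where B=B and B'=1, OF fm B proposal_kernel_measurable D.finite_measure_axioms])
    show "AE y in density LP (\<lambda>y. ennreal (Q z y)). emeasure (accept_reject LP (\<lambda>y. metropolis_ratio (W z y)) z y)
         (space (accept_reject LP (\<lambda>y. metropolis_ratio (W z y)) z y)) \<le> ennreal 1"
      using prob_space.emeasure_space_1[OF accept_reject_facts(3)] by (intro AE_I2) simp
  qed
  also have "\<dots> = (\<integral>y. metropolis_ratio (W z y) * f y + (1 - metropolis_ratio (W z y)) * f z \<partial>density LP (\<lambda>y. ennreal (Q z y)))"
    by (intro Bochner_Integration.integral_cong refl)
       (simp add: integral_accept_reject[OF accept_ratio_measurable metropolis_ratio_bounds(1) metropolis_ratio_bounds(2) z _ f])
  also have "\<dots> = (\<integral>\<xi>. metropolis_ratio (W z (T z \<xi>)) * f (T z \<xi>) + (1 - metropolis_ratio (W z (T z \<xi>))) * f z \<partial>GP)"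
    unfolding P.proposal[OF z, symmetric] by (rule integral_distr) measurable
  also have "\<dots> = (\<integral>\<xi>. f z + metropolis_ratio (W z (T z \<xi>)) * (f (T z \<xi>) - f z) \<partial>GP)"
    by (simp add: algebra_simps)
  also have "\<dots> = MP f z"
    unfolding MP_def using increment_integrable[OF f, of z "f z"] by (simp add: GP.prob_space)
  finally show ?thesis .
qed

end

lemma mala_kernel_measurable: "mala_kernel d (s\<^sup>2) (prod_target h d) \<in> measurable LP (subprob_algebra LP)"
proof (rule measurable_subprob_algebra)
  fix A assume A [measurable]: "A \<in> sets LP"
  have "(\<lambda>z. \<integral>\<^sup>+y. ennreal (Q z y) * (indicator A y * ennreal (metropolis_ratio (W z y)) + indicator A z * ennreal (1 - metropolis_ratio (W z y))) \<partial>LP) \<in> borel_measurable LP"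
    by measurable
  then show "(\<lambda>z. emeasure (mala_kernel d (s\<^sup>2) (prod_target h d) z) A) \<in> borel_measurable LP"
    by (rule measurable_cong[THEN iffD1, rotated]) (simp add: mala_kernel_emeasure)
qed (rule prob_space_imp_subprob_space[OF mala_kernel_prob] mala_kernel_sets; assumption)+

lemma mala_law_prob:
  assumes z: "z \<in> space LP"
  shows "prob_space (mala_law d (s\<^sup>2) (prod_target h d) z n) \<and> sets (mala_law d (s\<^sup>2) (prod_target h d) z n) = sets LP"
proof (induction n)
  case 0
  show ?case using z by (auto simp: prob_space_return)
next
  case (Suc n)
  let ?L = "mala_law d (s\<^sup>2) (prod_target h d) z n"
  interpret L: prob_space ?L using Suc by simp
  have sp: "space ?L = space LP" using Suc by (auto dest: sets_eq_imp_space_eq)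
  have m: "mala_kernel d (s\<^sup>2) (prod_target h d) \<in> measurable ?L (subprob_algebra LP)"
    using mala_kernel_measurable Suc measurable_cong_sets by blast
  have "prob_space (?L \<bind> mala_kernel d (s\<^sup>2) (prod_target h d))"
    by (rule L.prob_space_bind[OF _ m], rule AE_I2, rule mala_kernel_prob) (simp add: sp)
  moreover have "sets (?L \<bind> mala_kernel d (s\<^sup>2) (prod_target h d)) = sets LP"
    using z by (intro sets_bind) (auto simp: sp mala_kernel_sets)
  ultimately show ?case by simp
qed

text \<open>\<open>mala_law\<close> appends the new step at the end, so the last step acts on f
  first; hence f is arbitrary in the induction and the powers are regrouped by
  \<open>funpow_swap1\<close>.\<close>

lemma mala_law_integral:
  assumes z: "z \<in> space LP"
  shows "bdd_fun LP f \<Longrightarrow> (\<integral>x. f x \<partial>mala_law d (s\<^sup>2) (prod_target h d) z n) = (MP ^^ n) f z"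
proof (induction n arbitrary: f)
  case 0
  have "(\<integral>x. f x \<partial>return LP z) = f z"
    by (rule integral_return[OF z bdd_fun_measurable[OF 0]])
  then show ?case by simp
next
  case (Suc n)
  let ?L = "mala_law d (s\<^sup>2) (prod_target h d) z n"
  interpret L: prob_space ?L using mala_law_prob[OF z] by simp
  have sets: "sets ?L = sets LP" using mala_law_prob[OF z] by simp
  have sp: "space ?L = space LP" using sets by (rule sets_eq_imp_space_eq)
  have m: "mala_kernel d (s\<^sup>2) (prod_target h d) \<in> measurable ?L (subprob_algebra LP)"
    using mala_kernel_measurable measurable_cong_sets[OF sets refl] by blast
  obtain B where fm [measurable]: "f \<in> borel_measurable LP" and B: "\<And>x. x \<in> space LP \<Longrightarrow> \<bar>f x\<bar> \<le> B"
    using Suc.prems by (auto simp: bdd_fun_def)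
  have "(\<integral>x. f x \<partial>mala_law d (s\<^sup>2) (prod_target h d) z (Suc n)) =
      (\<integral>y. (\<integral>x. f x \<partial>mala_kernel d (s\<^sup>2) (prod_target h d) y) \<partial>?L)"
    unfolding mala_law.simps
  proof (rule integral_bind[where B=B and B'=1, OF fm B m L.finite_measure_axioms])
    show "AE y in ?L. emeasure (mala_kernel d (s\<^sup>2) (prod_target h d) y) (space (mala_kernel d (s\<^sup>2) (prod_target h d) y)) \<le> ennreal 1"
      using prob_space.emeasure_space_1[OF mala_kernel_prob] by (intro AE_I2) (simp add: sp)
  qed
  also have "\<dots> = (\<integral>y. MP f y \<partial>?L)"
    by (intro Bochner_Integration.integral_cong refl) (simp add: sp mala_kernel_integral Suc.prems)
  also have "\<dots> = (MP ^^ n) (MP f) z" by (rule Suc.IH[OF MP_bdd[OF Suc.prems]])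
  finally show ?case by (simp add: funpow_swap1)
qed

end

lemma power2_sum3_le: "(a + b + c)\<^sup>2 \<le> 3 * (a\<^sup>2 + b\<^sup>2 + c\<^sup>2)" for a b c :: real
proof -
  have "0 \<le> (a - b)\<^sup>2 + (b - c)\<^sup>2 + (a - c)\<^sup>2" by simp
  then show ?thesis by (simp add: power2_eq_square algebra_simps)
qed

section \<open>Convergence of one coordinate\<close>

locale mala_chain_small = mala_chain +
  assumes s_le_1: "s \<le> 1"
begin

sublocale S: site_model H gauss "w s" by (rule site[OF s_pos s_le_1])

lemma coordinate_H:
  fixes \<phi> :: "real \<Rightarrow> real"
  assumes i: "i \<in> {1..d}" and [measurable]: "\<phi> \<in> borel_measurable borel"
  shows integrable_coordinate_H: "integrable HP (\<lambda>z. \<phi> (z i)) \<longleftrightarrow> integrable H \<phi>"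
    and "(\<integral>z. \<phi> (z i) \<partial>HP) = (\<integral>x. \<phi> x \<partial>H)"
proof -
  have c [measurable]: "(\<lambda>z. z i) \<in> measurable HP H"
    unfolding HP_def by (rule measurable_component_singleton[OF i])
  have D: "distr HP H (\<lambda>z. z i) = H"
    unfolding HP_def using i by (intro distr_PiM_component H.prob_space_axioms)
  have m: "\<phi> \<in> borel_measurable H" by measurable
  show "integrable HP (\<lambda>z. \<phi> (z i)) \<longleftrightarrow> integrable H \<phi>"
    using integrable_distr_eq[OF c m] unfolding D by simp
  show "(\<integral>z. \<phi> (z i) \<partial>HP) = (\<integral>x. \<phi> x \<partial>H)"
    using integral_distr[OF c m] unfolding D by simp
qed

lemma coordinate_G:
  fixes \<phi> :: "real \<Rightarrow> real"
  assumes i: "i \<in> {1..d}" and [measurable]: "\<phi> \<in> borel_measurable borel"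
  shows integrable_coordinate_G: "integrable GP (\<lambda>z. \<phi> (z i)) \<longleftrightarrow> integrable gauss \<phi>"
    and "(\<integral>z. \<phi> (z i) \<partial>GP) = (\<integral>x. \<phi> x \<partial>gauss)"
proof -
  have c [measurable]: "(\<lambda>z. z i) \<in> measurable GP gauss"
    unfolding GP_def by (rule measurable_component_singleton[OF i])
  have D: "distr GP gauss (\<lambda>z. z i) = gauss"
    unfolding GP_def using i by (intro distr_PiM_component prob_space_gauss)
  have m: "\<phi> \<in> borel_measurable gauss" by measurable
  show "integrable GP (\<lambda>z. \<phi> (z i)) \<longleftrightarrow> integrable gauss \<phi>"
    using integrable_distr_eq[OF c m] unfolding D by simp
  show "(\<integral>z. \<phi> (z i) \<partial>GP) = (\<integral>x. \<phi> x \<partial>gauss)"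
    using integral_distr[OF c m] unfolding D by simp
qed

lemma coordinates_H:
  fixes \<Phi> :: "(nat \<Rightarrow> real) \<Rightarrow> real"
  assumes J: "J \<subseteq> {1..d}" and m: "\<Phi> \<in> borel_measurable (PiM J (\<lambda>_. H))"
  shows integrable_coordinates_H: "integrable HP (\<lambda>z. \<Phi> (restrict z J)) \<longleftrightarrow> integrable (PiM J (\<lambda>_. H)) \<Phi>"
    and "(\<integral>z. \<Phi> (restrict z J) \<partial>HP) = (\<integral>z. \<Phi> z \<partial>PiM J (\<lambda>_. H))"
proof -
  interpret D: product_prob_space "\<lambda>_::nat. H" "{1..d}"
    by (rule product_prob_spaceI) (rule H.prob_space_axioms)
  have c: "(\<lambda>z. restrict z J) \<in> measurable HP (PiM J (\<lambda>_. H))"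
    unfolding HP_def by (rule measurable_restrict_subset[OF J])
  have D: "distr HP (PiM J (\<lambda>_. H)) (\<lambda>z. restrict z J) = PiM J (\<lambda>_. H)"
    unfolding HP_def using J by (intro D.distr_PiM_restrict_finite finite_subset[OF J]) auto
  show "integrable HP (\<lambda>z. \<Phi> (restrict z J)) \<longleftrightarrow> integrable (PiM J (\<lambda>_. H)) \<Phi>"
    using integrable_distr_eq[OF c m] unfolding D by simp
  show "(\<integral>z. \<Phi> (restrict z J) \<partial>HP) = (\<integral>z. \<Phi> z \<partial>PiM J (\<lambda>_. H))"
    using integral_distr[OF c m] unfolding D by simp
qed

lemma coordinate_bdd:
  fixes f :: "real \<Rightarrow> real"
  assumes i: "i \<in> {1..d}" and [measurable]: "f \<in> borel_measurable borel" and "\<And>x. \<bar>f x\<bar> \<le> B"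
  shows "bdd_fun LP (\<lambda>z. f (z i))"
proof (rule bdd_funI)
  show "(\<lambda>z. f (z i)) \<in> borel_measurable LP" using i by measurable
qed (rule assms(3))

text \<open>The ratio is 1-Lipschitz, so dropping coordinate i from the log ratio costs at most |w|.
  What remains factors into the acceptance of the other coordinates and a one-dimensional increment.
  The cost is O(s^3), below the s^2 of the generator.\<close>

lemma one_site_increment:
  fixes g :: "real \<Rightarrow> real"
  assumes i: "i \<in> {1..d}" and z: "z \<in> space LP"
    and g [measurable]: "g \<in> borel_measurable borel" and B: "\<And>x. \<bar>g x\<bar> \<le> B"
  shows "\<bar>(MP (\<lambda>z. g (z i)) z - g (z i)) -
      S.acc ({1..d} - {i}) metropolis_ratio z * (\<integral>\<eta>. g (move s (z i) \<eta>) - g (z i) \<partial>gauss)\<bar>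
    \<le> 2 * B * (\<integral>\<eta>. \<bar>w s (z i) \<eta>\<bar> \<partial>gauss)"
proof -
  let ?J = "{1..d} - {i}"
  define \<Delta> where "\<Delta> \<eta> = g (move s (z i) \<eta>) - g (z i)" for \<eta>
  define \<Sigma> where "\<Sigma> \<xi> = (\<Sum>j\<in>?J. w s (z j) (\<xi> j))" for \<xi>
  have [measurable]: "\<Delta> \<in> borel_measurable borel" unfolding \<Delta>_def[abs_def] by measurable
  have [measurable]: "\<Sigma> \<in> borel_measurable (PiM ?J (\<lambda>_. gauss))" unfolding \<Sigma>_def[abs_def] by measurable
  have \<Delta>b: "\<bar>\<Delta> \<eta>\<bar> \<le> 2 * B" for \<eta>
    unfolding \<Delta>_def using B[of "move s (z i) \<eta>"] B[of "z i"] by linarith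
  have B0: "B \<ge> 0" using B[of 0] by linarith
  have ins: "insert i ?J = {1..d}" using i by auto
  interpret J: prob_space "PiM ?J (\<lambda>_. gauss)" by (intro prob_space_PiM prob_space_gauss)
  have iw: "integrable gauss (\<lambda>\<eta>. \<bar>w s (z i) \<eta>\<bar>)" using S.integrable_w[of "z i"] by simp
  have rb: "\<bar>metropolis_ratio t * \<Delta> \<eta>\<bar> \<le> 1 * (2 * B)" for t \<eta>
    unfolding abs_mult using \<Delta>b[of \<eta>] by (intro mult_mono metropolis_ratio_abs_le) auto
  have i1: "integrable gauss (\<lambda>\<eta>. metropolis_ratio (t + w s (z i) \<eta>) * \<Delta> \<eta>)" for t
    by (rule gauss.integrable_const_bound[where B="1 * (2 * B)"]) (use rb in auto)
  have i2: "integrable gauss \<Delta>"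
    by (rule gauss.integrable_const_bound[where B="2 * B"]) (use \<Delta>b in auto)
  define u where "u t = (\<integral>\<eta>. metropolis_ratio (t + w s (z i) \<eta>) * \<Delta> \<eta> \<partial>gauss)" for t
  have um [measurable]: "u \<in> borel_measurable borel" unfolding u_def[abs_def] by measurable
  have "MP (\<lambda>z. g (z i)) z - g (z i) = (\<integral>\<xi>. metropolis_ratio (\<Sum>j\<in>{1..d}. w s (z j) (\<xi> j)) * \<Delta> (\<xi> i) \<partial>PiM (insert i ?J) (\<lambda>_. gauss))"
    unfolding MP_def W_T ins GP_def[symmetric] \<Delta>_def using T_component[OF i] by simp
  also have "\<dots> = (\<integral>\<xi>. (\<integral>\<eta>. metropolis_ratio (\<Sum>j\<in>{1..d}. w s (z j) ((\<xi>(i := \<eta>)) j)) * \<Delta> ((\<xi>(i := \<eta>)) i) \<partial>gauss) \<partial>PiM ?J (\<lambda>_. gauss))"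
  proof (rule S.NP.product_integral_insert)
    show "integrable (PiM (insert i ?J) (\<lambda>_. gauss)) (\<lambda>\<xi>. metropolis_ratio (\<Sum>j\<in>{1..d}. w s (z j) (\<xi> j)) * \<Delta> (\<xi> i))"
      unfolding ins GP_def[symmetric]
    proof (rule GP.integrable_const_bound[where B="1 * (2 * B)"])
      show "(\<lambda>\<xi>. metropolis_ratio (\<Sum>j\<in>{1..d}. w s (z j) (\<xi> j)) * \<Delta> (\<xi> i)) \<in> borel_measurable GP"
        using i by measurable
    qed (use rb in auto)
  qed auto
  also have "\<dots> = (\<integral>\<xi>. u (\<Sigma> \<xi>) \<partial>PiM ?J (\<lambda>_. gauss))"
  proof -
    have "(\<Sum>j\<in>{1..d}. w s (z j) ((\<xi>(i := \<eta>)) j)) = \<Sigma> \<xi> + w s (z i) \<eta>" for \<xi> \<eta>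
      unfolding \<Sigma>_def using i by (subst sum.remove[of _ i]) (auto intro!: sum.cong)
    then show ?thesis by (simp add: u_def)
  qed
  finally have eq1: "MP (\<lambda>z. g (z i)) z - g (z i) = (\<integral>\<xi>. u (\<Sigma> \<xi>) \<partial>PiM ?J (\<lambda>_. gauss))" .
  have eq2: "S.acc ?J metropolis_ratio z * (\<integral>\<eta>. \<Delta> \<eta> \<partial>gauss) = (\<integral>\<xi>. metropolis_ratio (\<Sigma> \<xi>) * (\<integral>\<eta>. \<Delta> \<eta> \<partial>gauss) \<partial>PiM ?J (\<lambda>_. gauss))"
    unfolding S.acc_def \<Sigma>_def by simp
  have ub: "\<bar>u t\<bar> \<le> 1 * (2 * B)" for t
    unfolding u_def by (rule gauss.abs_integral_le[OF rb]) (use B0 in simp)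
  have j1: "integrable (PiM ?J (\<lambda>_. gauss)) (\<lambda>\<xi>. u (\<Sigma> \<xi>))"
    by (rule J.integrable_const_bound[where B="1 * (2 * B)"]) (use ub in \<open>auto simp del: One_nat_def\<close>)
  have j2: "integrable (PiM ?J (\<lambda>_. gauss)) (\<lambda>\<xi>. metropolis_ratio (\<Sigma> \<xi>) * (\<integral>\<eta>. \<Delta> \<eta> \<partial>gauss))"
    by (intro Bochner_Integration.integrable_mult_left J.integrable_const_bound[where B=1]) (use metropolis_ratio_abs_le in \<open>auto simp del: One_nat_def\<close>)
  have pt: "\<bar>u t - metropolis_ratio t * (\<integral>\<eta>. \<Delta> \<eta> \<partial>gauss)\<bar> \<le> 2 * B * (\<integral>\<eta>. \<bar>w s (z i) \<eta>\<bar> \<partial>gauss)" for t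
  proof -
    have "u t - metropolis_ratio t * (\<integral>\<eta>. \<Delta> \<eta> \<partial>gauss) = (\<integral>\<eta>. metropolis_ratio (t + w s (z i) \<eta>) * \<Delta> \<eta> - metropolis_ratio t * \<Delta> \<eta> \<partial>gauss)"
      unfolding u_def using i1 i2 by simp
    also have "\<bar>\<dots>\<bar> \<le> (\<integral>\<eta>. \<bar>metropolis_ratio (t + w s (z i) \<eta>) * \<Delta> \<eta> - metropolis_ratio t * \<Delta> \<eta>\<bar> \<partial>gauss)"
      by simp
    also have "\<dots> \<le> (\<integral>\<eta>. 2 * B * \<bar>w s (z i) \<eta>\<bar> \<partial>gauss)"
    proof (rule integral_mono)
      fix \<eta>
      have "\<bar>metropolis_ratio (t + w s (z i) \<eta>) - metropolis_ratio t\<bar> * \<bar>\<Delta> \<eta>\<bar> \<le> \<bar>w s (z i) \<eta>\<bar> * (2 * B)"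
        using metropolis_ratio_lipschitz[of "t + w s (z i) \<eta>" t] \<Delta>b[of \<eta>] by (intro mult_mono) auto
      then show "\<bar>metropolis_ratio (t + w s (z i) \<eta>) * \<Delta> \<eta> - metropolis_ratio t * \<Delta> \<eta>\<bar> \<le> 2 * B * \<bar>w s (z i) \<eta>\<bar>"
        by (simp only: left_diff_distrib[symmetric] abs_mult mult.commute[of "\<bar>w s (z i) \<eta>\<bar>"])
    qed (use i1 i2 iw in auto)
    finally show ?thesis by simp
  qed
  have "(MP (\<lambda>z. g (z i)) z - g (z i)) - S.acc ?J metropolis_ratio z * (\<integral>\<eta>. \<Delta> \<eta> \<partial>gauss) =
     (\<integral>\<xi>. u (\<Sigma> \<xi>) - metropolis_ratio (\<Sigma> \<xi>) * (\<integral>\<eta>. \<Delta> \<eta> \<partial>gauss) \<partial>PiM ?J (\<lambda>_. gauss))"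
    unfolding eq1 eq2 using j1 j2 by simp
  also have "\<bar>\<dots>\<bar> \<le> 2 * B * (\<integral>\<eta>. \<bar>w s (z i) \<eta>\<bar> \<partial>gauss)"
    by (rule J.abs_integral_le[OF pt]) (use B0 in simp)
  finally show ?thesis unfolding \<Delta>_def .
qed

text \<open>Three errors, each squared and multiplied by 3: decoupling coordinate i, the
  one-dimensional generator expansion, and the fluctuation of the acceptance probability of the
  other coordinates about its mean.\<close>

lemma generator_error_d:
  fixes f g :: "real \<Rightarrow> real"
  assumes i: "i \<in> {1..d}"
    and g [measurable]: "g \<in> borel_measurable borel" and B: "\<And>x. \<bar>g x\<bar> \<le> B"
    and f [measurable]: "f \<in> borel_measurable borel" and Bf: "\<And>x. \<bar>f x\<bar> \<le> Bf"
    and sp: "integrable H S.spread"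
    and ie: "integrable H (\<lambda>x. ((\<integral>\<eta>. g (move s x \<eta>) - g x \<partial>gauss) - s\<^sup>2 * f x)\<^sup>2)"
  defines "J \<equiv> {1..d} - {i}"
  shows "(\<integral>z. (MP (\<lambda>z. g (z i)) z - g (z i) - s\<^sup>2 * S.mean J metropolis_ratio * f (z i))\<^sup>2 \<partial>HP) \<le>
    3 * (4 * B\<^sup>2 * (\<integral>x. S.spread x \<partial>H) + (\<integral>x. ((\<integral>\<eta>. g (move s x \<eta>) - g x \<partial>gauss) - s\<^sup>2 * f x)\<^sup>2 \<partial>H)
      + s ^ 4 * Bf\<^sup>2 * (\<integral>z. (S.acc J metropolis_ratio z - S.mean J metropolis_ratio)\<^sup>2 \<partial>PiM J (\<lambda>_. H)))"
proof -
  define D where "D x = (\<integral>\<eta>. g (move s x \<eta>) - g x \<partial>gauss)" for x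
  have [measurable]: "D \<in> borel_measurable borel" unfolding D_def[abs_def] by measurable
  define m where "m = S.mean J metropolis_ratio"
  define \<Phi> where "\<Phi> z = (S.acc J metropolis_ratio z - m)\<^sup>2" for z
  have JI: "J \<subseteq> {1..d}" by (auto simp: J_def)
  have mr: "metropolis_ratio \<in> borel_measurable borel" by measurable
  interpret PJ: prob_space "PiM J (\<lambda>_. H)" by (intro prob_space_PiM H.prob_space_axioms)
  have \<Phi>m: "\<Phi> \<in> borel_measurable (PiM J (\<lambda>_. H))"
    unfolding \<Phi>_def[abs_def] using S.integrable_acc_HP(1)[OF mr metropolis_ratio_abs_le, of J] by measurable
  have "integrable (PiM J (\<lambda>_. H)) \<Phi>"
    unfolding \<Phi>_def[abs_def] power2_diff
    using S.integrable_acc_HP[OF mr metropolis_ratio_abs_le, of J] by simp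
  then have i\<Phi>: "integrable HP (\<lambda>z. \<Phi> (restrict z J))"
    using integrable_coordinates_H[OF JI \<Phi>m] by simp
  have ac: "S.acc J metropolis_ratio (restrict z J) = S.acc J metropolis_ratio z" for z
    by (rule S.acc_cong) simp
  have spm: "S.spread \<in> borel_measurable borel"
    using S.spread_measurable by (simp add: measurable_cong_sets[OF sets_H refl])
  have i1: "integrable HP (\<lambda>z. S.spread (z i))"
    using integrable_coordinate_H[OF i spm] sp by simp
  have em: "(\<lambda>x. (D x - s\<^sup>2 * f x)\<^sup>2) \<in> borel_measurable borel" by measurable
  have i2: "integrable HP (\<lambda>z. (D (z i) - s\<^sup>2 * f (z i))\<^sup>2)"
    using integrable_coordinate_H[OF i em] ie by (simp add: D_def)
  have bg: "bdd_fun LP (\<lambda>z. g (z i))" by (rule coordinate_bdd[OF i g B])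
  have bf: "bdd_fun LP (\<lambda>z. f (z i))" by (rule coordinate_bdd[OF i f Bf])
  have "(\<integral>z. (MP (\<lambda>z. g (z i)) z - g (z i) - s\<^sup>2 * m * f (z i))\<^sup>2 \<partial>HP) \<le>
    (\<integral>z. 3 * (4 * B\<^sup>2 * S.spread (z i) + (D (z i) - s\<^sup>2 * f (z i))\<^sup>2 + s ^ 4 * Bf\<^sup>2 * \<Phi> (restrict z J)) \<partial>HP)"
  proof (rule integral_mono)
    have "bdd_fun LP (\<lambda>z. (MP (\<lambda>z. g (z i)) z - g (z i) - s\<^sup>2 * m * f (z i))\<^sup>2)"
      by (intro bdd_fun_power2 bdd_fun_diff bdd_fun_cmult bg bf MP_bdd)
    then show "integrable HP (\<lambda>z. (MP (\<lambda>z. g (z i)) z - g (z i) - s\<^sup>2 * m * f (z i))\<^sup>2)"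
      by (intro HP.bdd_fun_integrable) (simp add: bdd_fun_HP)
    show "integrable HP (\<lambda>z. 3 * (4 * B\<^sup>2 * S.spread (z i) + (D (z i) - s\<^sup>2 * f (z i))\<^sup>2 + s ^ 4 * Bf\<^sup>2 * \<Phi> (restrict z J)))"
      using i1 i2 i\<Phi> by simp
    fix z assume "z \<in> space HP"
    then have z: "z \<in> space LP" by simp
    let ?a = "S.acc J metropolis_ratio z"
    define E where "E = (MP (\<lambda>z. g (z i)) z - g (z i)) - ?a * D (z i)"
    define v where "v = (\<integral>\<eta>. \<bar>w s (z i) \<eta>\<bar> \<partial>gauss)"
    have "\<bar>E\<bar> \<le> 2 * B * v"
      using one_site_increment[OF i z g B] by (simp add: E_def v_def D_def J_def)
    then have "\<bar>E\<bar>\<^sup>2 \<le> (2 * B * v)\<^sup>2" by (rule power_mono) simp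
    then have "E\<^sup>2 \<le> 4 * B\<^sup>2 * v\<^sup>2" by (simp add: power_mult_distrib)
    also have "\<dots> \<le> 4 * B\<^sup>2 * S.spread (z i)"
    proof (intro mult_left_mono)
      have "integrable gauss (\<lambda>\<eta>. \<bar>w s (z i) \<eta>\<bar>\<^sup>2)" using S.w_square[of "z i"] by simp
      from gauss.square_integral_le[OF this] show "v\<^sup>2 \<le> S.spread (z i)"
        by (simp add: v_def S.spread_def)
    qed simp
    finally have e1: "E\<^sup>2 \<le> 4 * B\<^sup>2 * S.spread (z i)" .
    have "\<bar>?a\<bar> \<le> 1" by (rule S.abs_acc_le[OF metropolis_ratio_abs_le])
    then have "?a\<^sup>2 * (D (z i) - s\<^sup>2 * f (z i))\<^sup>2 \<le> 1 * (D (z i) - s\<^sup>2 * f (z i))\<^sup>2"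
      by (intro mult_right_mono) (auto simp: abs_square_le_1)
    then have e2: "(?a * (D (z i) - s\<^sup>2 * f (z i)))\<^sup>2 \<le> (D (z i) - s\<^sup>2 * f (z i))\<^sup>2"
      by (simp add: power_mult_distrib)
    have "(f (z i))\<^sup>2 \<le> Bf\<^sup>2" using Bf[of "z i"] by (metis abs_ge_zero power2_abs power_mono)
    then have "(s\<^sup>2)\<^sup>2 * (f (z i))\<^sup>2 * (?a - m)\<^sup>2 \<le> (s\<^sup>2)\<^sup>2 * Bf\<^sup>2 * (?a - m)\<^sup>2"
      by (intro mult_right_mono mult_left_mono) auto
    then have e3: "(s\<^sup>2 * f (z i) * (?a - m))\<^sup>2 \<le> s ^ 4 * Bf\<^sup>2 * \<Phi> (restrict z J)"
      by (simp add: power_mult_distrib \<Phi>_def ac flip: power_mult)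
    have "MP (\<lambda>z. g (z i)) z - g (z i) - s\<^sup>2 * m * f (z i) =
        E + ?a * (D (z i) - s\<^sup>2 * f (z i)) + s\<^sup>2 * f (z i) * (?a - m)"
      by (simp add: E_def algebra_simps)
    then show "(MP (\<lambda>z. g (z i)) z - g (z i) - s\<^sup>2 * m * f (z i))\<^sup>2 \<le>
       3 * (4 * B\<^sup>2 * S.spread (z i) + (D (z i) - s\<^sup>2 * f (z i))\<^sup>2 + s ^ 4 * Bf\<^sup>2 * \<Phi> (restrict z J))"
      using power2_sum3_le[of E "?a * (D (z i) - s\<^sup>2 * f (z i))" "s\<^sup>2 * f (z i) * (?a - m)"] e1 e2 e3 by simp
  qed
  also have "\<dots> = 3 * (4 * B\<^sup>2 * (\<integral>z. S.spread (z i) \<partial>HP) + (\<integral>z. (D (z i) - s\<^sup>2 * f (z i))\<^sup>2 \<partial>HP) + s ^ 4 * Bf\<^sup>2 * (\<integral>z. \<Phi> (restrict z J) \<partial>HP))"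
    using i1 i2 i\<Phi> by simp
  also have "(\<integral>z. S.spread (z i) \<partial>HP) = (\<integral>x. S.spread x \<partial>H)" by (rule coordinate_H(2)[OF i spm])
  also have "(\<integral>z. (D (z i) - s\<^sup>2 * f (z i))\<^sup>2 \<partial>HP) = (\<integral>x. (D x - s\<^sup>2 * f x)\<^sup>2 \<partial>H)" by (rule coordinate_H(2)[OF i em])
  also have "(\<integral>z. \<Phi> (restrict z J) \<partial>HP) = (\<integral>z. \<Phi> z \<partial>PiM J (\<lambda>_. H))" by (rule coordinates_H(2)[OF JI \<Phi>m])
  finally show ?thesis by (simp add: D_def \<Phi>_def m_def)
qed

text \<open>Rejection only shrinks increments, so one step changes f by at most Lf times the
  displacement. This supplies the almost invariance of f asked for by
  \<open>sqn_pow_le_of_approx_generator\<close>.\<close>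

lemma one_step_difference:
  fixes f :: "real \<Rightarrow> real"
  assumes i: "i \<in> {1..d}" and L: "Lf-lipschitz_on UNIV f" and Bf: "\<And>x. \<bar>f x\<bar> \<le> Bf"
    and id: "\<And>x. integrable gauss (\<lambda>\<xi>. (disp s x \<xi>)\<^sup>2)" and idH: "integrable H (\<lambda>x. \<integral>\<xi>. (disp s x \<xi>)\<^sup>2 \<partial>gauss)"
  shows "(\<integral>z. (MP (\<lambda>z. f (z i)) z - f (z i))\<^sup>2 \<partial>HP) \<le> Lf\<^sup>2 * (\<integral>x. (\<integral>\<xi>. (disp s x \<xi>)\<^sup>2 \<partial>gauss) \<partial>H)"
proof -
  have f [measurable]: "f \<in> borel_measurable borel"
    by (rule borel_measurable_continuous_onI[OF lipschitz_on_continuous_on[OF L]])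
  have bf: "bdd_fun LP (\<lambda>z. f (z i))" by (rule coordinate_bdd[OF i f Bf])
  define v where "v x = (\<integral>\<xi>. (disp s x \<xi>)\<^sup>2 \<partial>gauss)" for x
  have vm: "v \<in> borel_measurable borel" unfolding v_def[abs_def] by measurable
  have "(\<integral>z. (MP (\<lambda>z. f (z i)) z - f (z i))\<^sup>2 \<partial>HP) \<le> (\<integral>z. Lf\<^sup>2 * v (z i) \<partial>HP)"
  proof (rule integral_mono)
    have "bdd_fun LP (\<lambda>z. (MP (\<lambda>z. f (z i)) z - f (z i))\<^sup>2)"
      by (intro bdd_fun_power2 bdd_fun_diff bf MP_bdd)
    then show "integrable HP (\<lambda>z. (MP (\<lambda>z. f (z i)) z - f (z i))\<^sup>2)"
      by (intro HP.bdd_fun_integrable) (simp add: bdd_fun_HP)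
    show "integrable HP (\<lambda>z. Lf\<^sup>2 * v (z i))"
      using integrable_coordinate_H[OF i vm] idH by (simp add: v_def[abs_def])
    fix z
    let ?r = "\<lambda>\<xi>. metropolis_ratio (W z (T z \<xi>)) * (f (T z \<xi> i) - f (z i))"
    have dm: "(\<lambda>\<eta>. (disp s (z i) \<eta>)\<^sup>2) \<in> borel_measurable borel" by measurable
    have id': "integrable GP (\<lambda>\<xi>. Lf\<^sup>2 * (disp s (z i) (\<xi> i))\<^sup>2)"
      using integrable_coordinate_G[OF i dm] id by simp
    have le: "(?r \<xi>)\<^sup>2 \<le> Lf\<^sup>2 * (disp s (z i) (\<xi> i))\<^sup>2" for \<xi>
    proof -
      have "\<bar>f (T z \<xi> i) - f (z i)\<bar> \<le> Lf * \<bar>disp s (z i) (\<xi> i)\<bar>"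
        using lipschitz_onD[OF L, of "T z \<xi> i" "z i"] by (simp add: T_component[OF i] move_def dist_real_def)
      then have "\<bar>?r \<xi>\<bar> \<le> 1 * (Lf * \<bar>disp s (z i) (\<xi> i)\<bar>)"
        unfolding abs_mult by (intro mult_mono metropolis_ratio_abs_le) auto
      then have "\<bar>?r \<xi>\<bar>\<^sup>2 \<le> (Lf * \<bar>disp s (z i) (\<xi> i)\<bar>)\<^sup>2" by (intro power_mono) auto
      then show ?thesis by (simp add: power_mult_distrib)
    qed
    have rm: "?r \<in> borel_measurable GP"
      using increment_integrable[OF bf, of z "f (z i)"] by auto
    have i2: "integrable GP (\<lambda>\<xi>. (?r \<xi>)\<^sup>2)"
    proof (rule Bochner_Integration.integrable_bound[OF id'])
      show "AE \<xi> in GP. norm ((?r \<xi>)\<^sup>2) \<le> norm (Lf\<^sup>2 * (disp s (z i) (\<xi> i))\<^sup>2)"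
        using le by (intro AE_I2) (auto intro: order_trans[OF _ abs_ge_self])
    qed (use rm in measurable)
    have "(MP (\<lambda>z. f (z i)) z - f (z i))\<^sup>2 = (\<integral>\<xi>. ?r \<xi> \<partial>GP)\<^sup>2" by (simp add: MP_def)
    also have "(\<integral>\<xi>. ?r \<xi> \<partial>GP)\<^sup>2 \<le> (\<integral>\<xi>. (?r \<xi>)\<^sup>2 \<partial>GP)" by (rule GP.square_integral_le[OF i2 rm])
    also have "(\<integral>\<xi>. (?r \<xi>)\<^sup>2 \<partial>GP) \<le> (\<integral>\<xi>. Lf\<^sup>2 * (disp s (z i) (\<xi> i))\<^sup>2 \<partial>GP)"
      by (rule integral_mono[OF i2 id' le])
    also have "(\<integral>\<xi>. Lf\<^sup>2 * (disp s (z i) (\<xi> i))\<^sup>2 \<partial>GP) = Lf\<^sup>2 * v (z i)"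
      using coordinate_G(2)[OF i dm] by (simp add: v_def)
    finally show "(MP (\<lambda>z. f (z i)) z - f (z i))\<^sup>2 \<le> Lf\<^sup>2 * v (z i)" .
  qed
  also have "\<dots> = Lf\<^sup>2 * (\<integral>x. v x \<partial>H)" using coordinate_H(2)[OF i vm] by simp
  finally show ?thesis by (simp add: v_def)
qed

lemma MP_pow_const: "(MP ^^ n) (\<lambda>_. c) = (\<lambda>_. c)"
  by (induction n) (auto simp: MP_const)

end

section \<open>Decay for indicators of intervals, uniformly in the dimension\<close>

context langevin_density
begin

text \<open>The order of choices matters. First f and g from the interval and \<eta>; then \<theta>,
  hence the lower bound c0 on the mean acceptance; then the smoothing width \<delta>; then t; and D
  last, because K1 contains 1 / \<delta>^2 and is beaten only by s^2 tending to 0.\<close>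

lemma interval_decay:
  assumes "l > 0" "\<eta> > 0"
  obtains D :: nat and t :: real where "t > 0"
    "\<And>d n i. d \<ge> D \<Longrightarrow> d \<ge> 1 \<Longrightarrow> real n \<ge> real d powr (1 / 3) * t \<Longrightarrow> i \<in> {1..d} \<Longrightarrow>
      (\<integral>z. ((mala_chain.MP h d (l * real d powr (- (1 / 6))) ^^ n) (\<lambda>z. indicator {a<..b} (z i)) z - measure H {a<..b})\<^sup>2
        \<partial>mala_chain.HP h d) \<le> \<eta>"
proof -
  define p where "p = measure H {a<..b}"
  define f0 where "f0 x = indicator {a<..b} x - p" for x :: real
  \<comment> \<open>The indicator is split into f and an approximation error, and
    \<open>sqn_add_le\<close> doubles both; hence \<eta> / 4 for each.\<close>
  have \<eta>4: "\<eta> / 4 > 0" using assms by simp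
  obtain f Lf R where f: "Lf-lipschitz_on UNIV f" "\<And>x. \<bar>x\<bar> \<ge> R \<Longrightarrow> f x = 0" "R > 0" "(\<integral>x. f x \<partial>H) = 0"
    "(\<integral>x. (f x - (indicator {a<..b} x - measure H {a<..b}))\<^sup>2 \<partial>H) \<le> \<eta> / 4"
  proof (rule interval_approximation[OF \<eta>4, of a b], goal_cases)
    case (1 f Lf R)
    from 1(2-) show ?case by (rule 1(1))
  qed
  obtain g g1 g2 L B where g: "\<And>x. (g has_real_derivative g1 x) (at x)" "\<And>x. (g1 has_real_derivative g2 x) (at x)"
    "L-lipschitz_on UNIV g2" "\<And>x. \<bar>g x\<bar> \<le> B" "\<And>x. (score x * g1 x + g2 x) / 2 = f x"
  proof (rule generator_equation_solution[OF f(1) _ f(3,4)], goal_cases)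
    case (1 x)
    then show ?case by (intro f(2))
  next
    case (2 g g1 g2 L B)
    from 2(2-) show ?case by (rule 2(1))
  qed
  obtain Bf where Bf: "\<And>x. \<bar>f x\<bar> \<le> Bf"
    using compact_support_bounded[OF lipschitz_on_continuous_on[OF f(1)] f(2)] by metis
  have fm [measurable]: "f \<in> borel_measurable borel"
    by (rule borel_measurable_continuous_onI[OF lipschitz_on_continuous_on[OF f(1)]])
  have gm [measurable]: "g \<in> borel_measurable borel"
    by (intro borel_measurable_continuous_onI DERIV_continuous_on[OF DERIV_subset[OF g(1)]]) auto
  obtain C1 where C1raw: "C1 \<ge> 0" "\<And>s. 0 < s \<Longrightarrow> s \<le> 1 \<Longrightarrow>
      (\<integral>x. ((\<integral>\<xi>. g (move s x \<xi>) - g x \<partial>gauss) - s\<^sup>2 * ((score x * g1 x + g2 x) / 2))\<^sup>2 \<partial>H) \<le> C1 * s ^ 6"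
    "\<And>s. 0 < s \<Longrightarrow> s \<le> 1 \<Longrightarrow>
      integrable H (\<lambda>x. ((\<integral>\<xi>. g (move s x \<xi>) - g x \<partial>gauss) - s\<^sup>2 * ((score x * g1 x + g2 x) / 2))\<^sup>2)"
  proof (rule generator_error[OF g(1-3)], goal_cases)
    case (1 C1)
    from 1(2-) show ?case by (rule 1(1))
  qed
  note C1 = C1raw(1) C1raw(2)[unfolded g(5)] C1raw(3)[unfolded g(5)]
  obtain C2 where C2: "C2 \<ge> 0" "\<And>s. 0 < s \<Longrightarrow> s \<le> 1 \<Longrightarrow> integrable H (\<lambda>x. \<integral>\<xi>. (disp s x \<xi>)\<^sup>2 \<partial>gauss)
      \<and> (\<integral>x. (\<integral>\<xi>. (disp s x \<xi>)\<^sup>2 \<partial>gauss) \<partial>H) \<le> C2 * s\<^sup>2"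
    "\<And>s x. 0 < s \<Longrightarrow> s \<le> 1 \<Longrightarrow> integrable gauss (\<lambda>\<xi>. (disp s x \<xi>)\<^sup>2)"
  proof (rule square_disp_moment, goal_cases)
    case (1 C2)
    from 1(2-) show ?case by (rule 1(1))
  qed
  obtain C3 where C3: "C3 \<ge> 0"
    "\<And>s. 0 < s \<Longrightarrow> s \<le> 1 \<Longrightarrow> integrable H (w_drift s) \<and> integrable H (w_spread s)
      \<and> integrable H (\<lambda>x. (w_drift s x)\<^sup>2) \<and> integrable H (\<lambda>x. (w_spread s x)\<^sup>2)
      \<and> \<bar>\<integral>x. w_drift s x \<partial>H\<bar> \<le> C3 * s ^ 6 \<and> (\<integral>x. w_spread s x \<partial>H) \<le> C3 * s ^ 6
      \<and> (\<integral>x. (w_drift s x)\<^sup>2 \<partial>H) \<le> C3 * s ^ 8 \<and> (\<integral>x. (w_spread s x)\<^sup>2 \<partial>H) \<le> C3 * s ^ 12"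
  proof (rule site_moments, goal_cases)
    case (1 C3)
    from 1(2-) show ?case by (rule 1(1))
  qed
  \<comment> \<open>As d s^6 = l^6, the hypothesis of \<open>mean_acc_ge\<close> becomes C3 l^6
    (\<theta> + 2 \<theta>^2) \<le> 1/2; \<theta> \<le> 1 allows replacing the bracket by 3
    \<theta>.\<close>
  define \<theta> where "\<theta> = min 1 (1 / (6 * (C3 * l ^ 6 + 1)))"
  have C3l: "C3 * l ^ 6 \<ge> 0" using C3(1) assms(1) by simp
  have \<theta>: "0 < \<theta>" "\<theta> \<le> 1" "C3 * l ^ 6 * (3 * \<theta>) \<le> 1 / 2"
  proof -
    show "0 < \<theta>" "\<theta> \<le> 1" using C3l by (auto simp: \<theta>_def)
    have "C3 * l ^ 6 * (3 * \<theta>) \<le> C3 * l ^ 6 * (3 * (1 / (6 * (C3 * l ^ 6 + 1))))"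
      using C3l by (intro mult_left_mono) (auto simp: \<theta>_def)
    also have "\<dots> \<le> 1 / 2" using C3l by (simp add: field_simps)
    finally show "C3 * l ^ 6 * (3 * \<theta>) \<le> 1 / 2" .
  qed
  define c0 where "c0 = exp (- ((1 + ln 4) / \<theta>)) / 4"
  have c0: "c0 > 0" by (simp add: c0_def)
  \<comment> \<open>The coefficient of \<delta>^2 in the final bound: 8 from the variance, 3 from
    the three errors, 4 from the decay estimate.\<close>
  define K2 where "K2 = 96 * Bf\<^sup>2 / c0\<^sup>2"
  define \<delta> where "\<delta> = sqrt (\<eta> / (12 * (K2 + 1)))"
  have K2: "K2 \<ge> 0" using c0 by (simp add: K2_def)
  have \<delta>: "\<delta> > 0" "K2 * \<delta>\<^sup>2 \<le> \<eta> / 12"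
  proof -
    have "\<eta> / (12 * (K2 + 1)) > 0" using assms K2 by simp
    then show "\<delta> > 0" by (simp add: \<delta>_def)
    have "K2 * \<delta>\<^sup>2 = K2 * (\<eta> / (12 * (K2 + 1)))" using assms K2 by (simp add: \<delta>_def)
    also have "\<dots> \<le> \<eta> / 12" using assms K2 by (simp add: field_simps)
    finally show "K2 * \<delta>\<^sup>2 \<le> \<eta> / 12" .
  qed
  define K1 where "K1 = 4 * (3 * (4 * B\<^sup>2 * C3 + C1 + Bf\<^sup>2 * (l ^ 6 * (4 * C3 + 16 / \<delta>\<^sup>2 * C3)))) / c0\<^sup>2 + Lf\<^sup>2 * C2"
  have K1: "K1 \<ge> 0" using C1(1) C2(1) C3(1) assms(1) \<delta>(1) c0 unfolding K1_def
    by (intro add_nonneg_nonneg divide_nonneg_nonneg mult_nonneg_nonneg) auto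
  \<comment> \<open>Chosen so that (l^2 c0 t)^2 = 12 (B^2 + 1) / \<eta>. This is the first of three
    terms of size \<eta> / 12 that make up \<eta> / 4.\<close>
  define t where "t = sqrt (12 * (B\<^sup>2 + 1) / \<eta>) / (l\<^sup>2 * c0)"
  have t: "t > 0" "B\<^sup>2 / (l\<^sup>2 * c0 * t)\<^sup>2 \<le> \<eta> / 12"
  proof -
    have pos: "12 * (B\<^sup>2 + 1) / \<eta> > 0" using assms by (intro divide_pos_pos mult_pos_pos add_nonneg_pos) auto
    then show "t > 0" using assms c0 by (simp add: t_def)
    have "l\<^sup>2 * c0 * t = sqrt (12 * (B\<^sup>2 + 1) / \<eta>)" using assms c0 by (simp add: t_def)
    then have "B\<^sup>2 / (l\<^sup>2 * c0 * t)\<^sup>2 = B\<^sup>2 / (12 * (B\<^sup>2 + 1) / \<eta>)" using pos by simp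
    also have "\<dots> = B\<^sup>2 / (B\<^sup>2 + 1) * (\<eta> / 12)" using assms by (simp add: field_simps)
    also have "\<dots> \<le> 1 * (\<eta> / 12)"
    proof (rule mult_right_mono)
      have "B\<^sup>2 + 1 > 0" by (rule add_nonneg_pos) auto
      then show "B\<^sup>2 / (B\<^sup>2 + 1) \<le> 1" by simp
    qed (use assms in simp)
    finally show "B\<^sup>2 / (l\<^sup>2 * c0 * t)\<^sup>2 \<le> \<eta> / 12" by simp
  qed
  have lim: "(\<lambda>d. l * real d powr (- (1 / 6))) \<longlonglongrightarrow> 0"
    by (rule tendsto_mult_right_zero, rule tendsto_neg_powr) (auto intro: filterlim_real_sequentially)
  have lim2: "(\<lambda>d. K1 * (l * real d powr (- (1 / 6)))\<^sup>2) \<longlonglongrightarrow> K1 * 0\<^sup>2"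
    by (intro tendsto_intros lim)
  have "eventually (\<lambda>d. l * real d powr (- (1 / 6)) < 1) sequentially"
    by (rule order_tendstoD(2)[OF lim]) simp
  moreover have "eventually (\<lambda>d. K1 * (l * real d powr (- (1 / 6)))\<^sup>2 < \<eta> / 12) sequentially"
    by (rule order_tendstoD(2)[OF lim2]) (use assms in simp)
  ultimately have "eventually (\<lambda>d. l * real d powr (- (1 / 6)) < 1 \<and> K1 * (l * real d powr (- (1 / 6)))\<^sup>2 < \<eta> / 12) sequentially"
    by eventually_elim auto
  then obtain D where D: "\<And>d. d \<ge> D \<Longrightarrow> l * real d powr (- (1 / 6)) < 1"
      "\<And>d. d \<ge> D \<Longrightarrow> K1 * (l * real d powr (- (1 / 6)))\<^sup>2 < \<eta> / 12"
    by (auto simp: eventually_sequentially)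
  show thesis
  proof (rule that[OF t(1), of D])
    fix d n i assume d: "d \<ge> D" "d \<ge> 1" and n: "real n \<ge> real d powr (1 / 3) * t" and i: "i \<in> {1..d}"
    define s where "s = l * real d powr (- (1 / 6))"
    have s: "0 < s" "s \<le> 1" using D(1)[OF d(1)] assms(1) d(2) by (auto simp: s_def)
    have s2: "s\<^sup>2 = l\<^sup>2 * real d powr (- (1 / 3))"
      using d(2) by (simp add: s_def power_mult_distrib powr_power)
    have s6: "real d * s ^ 6 = l ^ 6"
    proof -
      have "(real d powr (- (1 / 6))) ^ 6 = real d powr (- 1)"
        using d(2) by (subst powr_power) auto
      also have "\<dots> = inverse (real d)" using d(2) by (simp add: powr_minus)
      finally show ?thesis using d(2) by (simp add: s_def power_mult_distrib)
    qed
    interpret mala_chain_small h d s by unfold_locales (use s in auto)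
    let ?J = "{1..d} - {i}"
    have cJ: "finite ?J" "real (card ?J) \<le> real d" using i by auto
    have s_le: "s ^ 6 \<le> s\<^sup>2" "s ^ 8 \<le> s ^ 6 * s\<^sup>2" "s ^ 12 \<le> s ^ 6 * s\<^sup>2"
      using s by (auto simp flip: power_add intro!: power_decreasing)
    note M = C3(2)[OF s]
    define m where "m = S.mean ?J metropolis_ratio"
    have m: "c0 \<le> m"
      unfolding c0_def m_def
    proof (rule S.mean_acc_ge[OF cJ(1) \<theta>(1)])
      have "real (card ?J) * (\<theta> * \<bar>\<integral>x. w_drift s x \<partial>H\<bar> + 2 * \<theta>\<^sup>2 * (\<integral>x. w_spread s x \<partial>H)) \<le>
         real d * (\<theta> * (C3 * s ^ 6) + 2 * (\<theta> * 1) * (C3 * s ^ 6))"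
      proof (rule mult_mono[OF cJ(2)])
        have "\<theta> * \<bar>\<integral>x. w_drift s x \<partial>H\<bar> \<le> \<theta> * (C3 * s ^ 6)"
          using M \<theta> by (intro mult_left_mono) auto
        moreover have "2 * \<theta>\<^sup>2 * (\<integral>x. w_spread s x \<partial>H) \<le> 2 * (\<theta> * 1) * (C3 * s ^ 6)"
        proof (rule mult_mono)
          show "2 * \<theta>\<^sup>2 \<le> 2 * (\<theta> * 1)" using \<theta> by (simp add: power2_eq_square)
        qed (use M \<theta> S.spread_nonneg in auto)
        ultimately show "\<theta> * \<bar>\<integral>x. w_drift s x \<partial>H\<bar> + 2 * \<theta>\<^sup>2 * (\<integral>x. w_spread s x \<partial>H) \<le>
          \<theta> * (C3 * s ^ 6) + 2 * (\<theta> * 1) * (C3 * s ^ 6)" by (rule add_mono)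
        show "0 \<le> \<theta> * \<bar>\<integral>x. w_drift s x \<partial>H\<bar> + 2 * \<theta>\<^sup>2 * (\<integral>x. w_spread s x \<partial>H)"
          using \<theta> S.spread_nonneg by simp
      qed simp
      also have "\<dots> = C3 * (real d * s ^ 6) * (3 * \<theta>)" by (simp add: algebra_simps)
      also have "\<dots> \<le> 1 / 2" unfolding s6 by (rule \<theta>(3))
      finally show "real (card ?J) * (\<theta> * \<bar>\<integral>x. w_drift s x \<partial>H\<bar> + 2 * \<theta>\<^sup>2 * (\<integral>x. w_spread s x \<partial>H)) \<le> 1 / 2" .
    qed (use M in auto)
    have var: "(\<integral>z. (S.acc ?J metropolis_ratio z - m)\<^sup>2 \<partial>PiM ?J (\<lambda>_. H)) \<le>
        l ^ 6 * (4 * C3 + 16 / \<delta>\<^sup>2 * C3) * s\<^sup>2 + 8 * \<delta>\<^sup>2"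
    proof -
      have "(\<integral>z. (S.acc ?J metropolis_ratio z - m)\<^sup>2 \<partial>PiM ?J (\<lambda>_. H)) \<le>
         real (card ?J) * (4 * (\<integral>x. (w_drift s x)\<^sup>2 \<partial>H) + 16 / \<delta>\<^sup>2 * (\<integral>x. (w_spread s x)\<^sup>2 \<partial>H)) + 8 * \<delta>\<^sup>2"
        unfolding m_def by (rule S.variance_acc_le[OF cJ(1) \<delta>(1)]) (use M in auto)
      also have "\<dots> \<le> real d * (4 * (C3 * (s ^ 6 * s\<^sup>2)) + 16 / \<delta>\<^sup>2 * (C3 * (s ^ 6 * s\<^sup>2))) + 8 * \<delta>\<^sup>2"
      proof (intro add_mono mult_mono cJ order_refl)
        have "C3 * s ^ 8 \<le> C3 * (s ^ 6 * s\<^sup>2)" "C3 * s ^ 12 \<le> C3 * (s ^ 6 * s\<^sup>2)"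
          using s_le C3(1) by (auto intro: mult_left_mono)
        then show "(\<integral>x. (w_drift s x)\<^sup>2 \<partial>H) \<le> C3 * (s ^ 6 * s\<^sup>2)" "(\<integral>x. (w_spread s x)\<^sup>2 \<partial>H) \<le> C3 * (s ^ 6 * s\<^sup>2)"
          using M by linarith+
      qed auto
      also have "\<dots> = (real d * s ^ 6) * (4 * C3 + 16 / \<delta>\<^sup>2 * C3) * s\<^sup>2 + 8 * \<delta>\<^sup>2"
        by (simp add: algebra_simps)
      finally show ?thesis unfolding s6 .
    qed
    define \<epsilon>1 where "\<epsilon>1 = 3 * (4 * B\<^sup>2 * C3 + C1 + Bf\<^sup>2 * (l ^ 6 * (4 * C3 + 16 / \<delta>\<^sup>2 * C3))) * s\<^sup>2 + 24 * Bf\<^sup>2 * \<delta>\<^sup>2"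
    have gen: "(\<integral>z. (MP (\<lambda>z. g (z i)) z - g (z i) - s\<^sup>2 * m * f (z i))\<^sup>2 \<partial>HP) \<le> (s\<^sup>2)\<^sup>2 * \<epsilon>1"
    proof -
      have "(\<integral>z. (MP (\<lambda>z. g (z i)) z - g (z i) - s\<^sup>2 * m * f (z i))\<^sup>2 \<partial>HP) \<le>
        3 * (4 * B\<^sup>2 * (\<integral>x. w_spread s x \<partial>H) + (\<integral>x. ((\<integral>\<eta>. g (move s x \<eta>) - g x \<partial>gauss) - s\<^sup>2 * f x)\<^sup>2 \<partial>H)
          + s ^ 4 * Bf\<^sup>2 * (\<integral>z. (S.acc ?J metropolis_ratio z - m)\<^sup>2 \<partial>PiM ?J (\<lambda>_. H)))"
        unfolding m_def by (rule generator_error_d[OF i gm g(4) fm Bf]) (use M C1(3)[OF s] in auto)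
      also have "\<dots> \<le> 3 * (4 * B\<^sup>2 * (C3 * s ^ 6) + C1 * s ^ 6
          + s ^ 4 * Bf\<^sup>2 * (l ^ 6 * (4 * C3 + 16 / \<delta>\<^sup>2 * C3) * s\<^sup>2 + 8 * \<delta>\<^sup>2))"
        using M C1(2)[OF s] var by (intro mult_left_mono add_mono) auto
      also have "\<dots> = (s\<^sup>2)\<^sup>2 * \<epsilon>1"
        by (simp add: \<epsilon>1_def algebra_simps eval_nat_numeral)
      finally show ?thesis .
    qed
    have diff: "(\<integral>z. (MP (\<lambda>z. f (z i)) z - f (z i))\<^sup>2 \<partial>HP) \<le> Lf\<^sup>2 * (C2 * s\<^sup>2)"
    proof -
      have "(\<integral>z. (MP (\<lambda>z. f (z i)) z - f (z i))\<^sup>2 \<partial>HP) \<le> Lf\<^sup>2 * (\<integral>x. (\<integral>\<xi>. (disp s x \<xi>)\<^sup>2 \<partial>gauss) \<partial>H)"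
        using C2(2)[OF s] by (intro one_step_difference[OF i f(1) Bf C2(3)[OF s]]) auto
      also have "\<dots> \<le> Lf\<^sup>2 * (C2 * s\<^sup>2)" using C2(2)[OF s] by (intro mult_left_mono) auto
      finally show ?thesis .
    qed
    have bf: "bdd_fun HP (\<lambda>z. f (z i))" and bg: "bdd_fun HP (\<lambda>z. g (z i))"
      unfolding bdd_fun_HP by (rule coordinate_bdd[OF i fm Bf] coordinate_bdd[OF i gm g(4)])+
    have d13: "real d powr (1 / 3) > 0" using d(2) by simp
    have n0: "n > 0" using n t(1) d13 mult_pos_pos[OF d13 t(1)] by (cases n) auto
    have "MP.sqn ((MP ^^ n) (\<lambda>z. f (z i))) \<le> MP.sqn (\<lambda>z. g (z i)) / (s\<^sup>2 * c0 * real n)\<^sup>2 + 4 * \<epsilon>1 / c0\<^sup>2 + Lf\<^sup>2 * (C2 * s\<^sup>2)"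
      using s by (intro MP.sqn_pow_le_of_approx_generator[OF bf bg _ c0 m n0 gen diff]) simp
    also have "\<dots> \<le> B\<^sup>2 / (l\<^sup>2 * c0 * t)\<^sup>2 + 4 * \<epsilon>1 / c0\<^sup>2 + Lf\<^sup>2 * (C2 * s\<^sup>2)"
    proof (intro add_mono order_refl frac_le power_mono)
      have "MP.sqn (\<lambda>z. g (z i)) \<le> (\<integral>z. B\<^sup>2 \<partial>HP)"
      proof (rule integral_mono)
        show "integrable HP (\<lambda>z. (g (z i))\<^sup>2)" by (intro HP.bdd_fun_integrable bdd_fun_power2 bg)
        show "(g (z i))\<^sup>2 \<le> B\<^sup>2" for z using g(4)[of "z i"] by (metis abs_ge_zero power2_abs power_mono)
      qed simp
      then show "MP.sqn (\<lambda>z. g (z i)) \<le> B\<^sup>2" by (simp add: HP.prob_space del: space_HP)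
      \<comment> \<open>The powers of d in s^2 and in the lower bound for n cancel exactly: s^2 n is
        at least l^2 t.\<close>
      have "l\<^sup>2 * c0 * t = (l\<^sup>2 * real d powr (- (1 / 3))) * c0 * (real d powr (1 / 3) * t)"
        using d(2) by (simp add: powr_minus field_simps)
      also have "\<dots> \<le> s\<^sup>2 * c0 * real n"
        unfolding s2 using n c0 by (intro mult_left_mono) auto
      finally show "l\<^sup>2 * c0 * t \<le> s\<^sup>2 * c0 * real n" .
    qed (use assms c0 t(1) in auto)
    also have "\<dots> = B\<^sup>2 / (l\<^sup>2 * c0 * t)\<^sup>2 + K1 * s\<^sup>2 + K2 * \<delta>\<^sup>2"
      by (simp add: \<epsilon>1_def K1_def K2_def add_divide_distrib algebra_simps)
    also have "\<dots> \<le> \<eta> / 4"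
      using t(2) \<delta>(2) D(2)[OF d(1)] unfolding s_def[symmetric] by linarith
    finally have Nf: "MP.sqn ((MP ^^ n) (\<lambda>z. f (z i))) \<le> \<eta> / 4" .
    have f0m [measurable]: "f0 \<in> borel_measurable borel" unfolding f0_def[abs_def] by measurable
    have f0b: "\<bar>f0 x\<bar> \<le> 1 + \<bar>p\<bar>" for x by (auto simp: f0_def indicator_def)
    have b0: "bdd_fun HP (\<lambda>z. f0 (z i))" unfolding bdd_fun_HP by (rule coordinate_bdd[OF i f0m f0b])
    have bI: "bdd_fun HP (\<lambda>z. indicator {a<..b} (z i))"
      unfolding bdd_fun_HP by (rule coordinate_bdd[OF i, where B=1]) (auto simp: indicator_def)
    have be: "bdd_fun HP (\<lambda>z. f0 (z i) - f (z i))" by (rule bdd_fun_diff[OF b0 bf])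
    \<comment> \<open>The approximation error need not decay: contraction keeps it as small as it is
      at time 0.\<close>
    have Ne: "MP.sqn ((MP ^^ n) (\<lambda>z. f0 (z i) - f (z i))) \<le> \<eta> / 4"
    proof -
      have "MP.sqn ((MP ^^ n) (\<lambda>z. f0 (z i) - f (z i))) \<le> MP.sqn (\<lambda>z. f0 (z i) - f (z i))"
        by (rule MP.contraction_pow[OF be])
      also have "\<dots> = (\<integral>x. (f0 x - f x)\<^sup>2 \<partial>H)" by (rule coordinate_H(2)[OF i]) measurable
      also have "\<dots> \<le> \<eta> / 4" using f(5) by (simp add: f0_def p_def power2_commute)
      finally show ?thesis .
    qed
    have e1: "(MP ^^ n) (\<lambda>z. f0 (z i)) = (\<lambda>z. (MP ^^ n) (\<lambda>z. indicator {a<..b} (z i)) z - p)"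
      using MP.linear_pow[OF bI bdd_fun_const[of HP 1], of n 1 "- p"] by (simp add: f0_def MP_pow_const)
    have e2: "(MP ^^ n) (\<lambda>z. f0 (z i)) = (\<lambda>z. (MP ^^ n) (\<lambda>z. f (z i)) z + (MP ^^ n) (\<lambda>z. f0 (z i) - f (z i)) z)"
      using MP.linear_pow[OF bf be, of n 1 1] by simp
    have pt: "(MP ^^ n) (\<lambda>z. indicator {a<..b} (z i)) z - p = (MP ^^ n) (\<lambda>z. f (z i)) z + (MP ^^ n) (\<lambda>z. f0 (z i) - f (z i)) z" for z
      using fun_cong[OF e1, of z] fun_cong[OF e2, of z] by linarith
    have "MP.sqn (\<lambda>z. (MP ^^ n) (\<lambda>z. indicator {a<..b} (z i)) z - p) =
       MP.sqn (\<lambda>z. (MP ^^ n) (\<lambda>z. f (z i)) z + (MP ^^ n) (\<lambda>z. f0 (z i) - f (z i)) z)" by (simp only: pt)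
    also have "\<dots> \<le> 2 * MP.sqn ((MP ^^ n) (\<lambda>z. f (z i))) + 2 * MP.sqn ((MP ^^ n) (\<lambda>z. f0 (z i) - f (z i)))"
      by (intro MP.sqn_add_le MP.bdd_pow bf be)
    also have "\<dots> \<le> \<eta>" using Nf Ne by linarith
    finally show "(\<integral>z. ((mala_chain.MP h d (l * real d powr (- (1 / 6))) ^^ n) (\<lambda>z. indicator {a<..b} (z i)) z - measure H {a<..b})\<^sup>2
        \<partial>mala_chain.HP h d) \<le> \<eta>"
      unfolding s_def[symmetric] p_def .
  qed
qed

end

text \<open>A test function is replaced by its value at p j on each cell, with error \<omega> on the
  cells and 1 off them. The mass of M off the cells differs from that of N by at most the sum of the
  cell differences, which explains the first factor 2.\<close>

lemma kr_dist_le_cells: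
  fixes M N :: "real measure" and c :: "nat \<Rightarrow> real set"
  assumes "prob_space M" "prob_space N" and sets: "sets M = sets borel" "sets N = sets borel"
    and c: "\<And>j. j < k \<Longrightarrow> c j \<in> sets borel" and disj: "disjoint_family_on c {..<k}"
    and width: "\<And>j x. j < k \<Longrightarrow> x \<in> c j \<Longrightarrow> \<bar>x - p j\<bar> \<le> \<omega>" and \<omega>: "\<omega> \<ge> 0"
  shows "kr_dist M N \<le> 2 * (\<Sum>j<k. \<bar>measure M (c j) - measure N (c j)\<bar>) + 2 * \<omega> + 2 * (1 - (\<Sum>j<k. measure N (c j)))"
proof -
  interpret M: prob_space M by fact
  interpret N: prob_space N by fact
  note [measurable_cong] = sets
  note c [measurable]
  let ?S = "\<Sum>j<k. \<bar>measure M (c j) - measure N (c j)\<bar>"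
  have spaces: "space M = UNIV" "space N = UNIV" using sets[THEN sets_eq_imp_space_eq] by simp_all
  have "(\<integral>x. f x \<partial>M) - (\<integral>x. f x \<partial>N) \<le> 2 * ?S + 2 * \<omega> + 2 * (1 - (\<Sum>j<k. measure N (c j)))"
    if lip: "\<And>x y. \<bar>f x - f y\<bar> \<le> \<bar>x - y\<bar>" and f1: "\<And>x. \<bar>f x\<bar> \<le> 1" for f :: "real \<Rightarrow> real"
  proof -
    have "1-lipschitz_on UNIV f" by (rule lipschitz_onI) (use lip in \<open>auto simp: dist_real_def\<close>)
    then have fm [measurable]: "f \<in> borel_measurable borel"
      by (intro borel_measurable_continuous_onI lipschitz_on_continuous_on)
    define \<phi> where "\<phi> x = (\<Sum>j<k. f (p j) * indicator (c j) x)" for x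
    \<comment> \<open>By disjointness this is the indicator of the complement of all cells.\<close>
    define out where "out x = 1 - (\<Sum>j<k. indicator (c j) x :: real)" for x
    have pt: "\<bar>f x - \<phi> x\<bar> \<le> \<omega> + out x" for x
    proof (cases "\<exists>j<k. x \<in> c j")
      case True
      then obtain j where j: "j < k" "x \<in> c j" by auto
      have ind: "indicator (c i) x = (if i = j then 1 else 0 :: real)" if "i < k" for i
        using disj j that by (auto simp: disjoint_family_on_def indicator_def)
      have "\<phi> x = (\<Sum>i<k. f (p i) * (if i = j then 1 else 0))" "out x = 1 - (\<Sum>i<k. if i = j then 1 else 0)"
        unfolding \<phi>_def out_def using ind by (auto intro!: sum.cong)
      then have "\<phi> x = f (p j)" "out x = 0" using j(1) by (simp_all add: if_distrib[of "(*) _"] cong: if_cong)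
      then show ?thesis using lip[of x "p j"] width[OF j] by simp
    next
      case False
      then have "\<phi> x = 0" "out x = 1" by (auto simp: \<phi>_def out_def indicator_def intro!: sum.neutral)
      then show ?thesis using f1[of x] \<omega> by simp
    qed
    have pt1: "f x \<le> \<phi> x + (\<omega> + out x)" and pt2: "\<phi> x - (\<omega> + out x) \<le> f x" for x
      using pt[of x] by linarith+
    have ind: "integrable M (indicator (c j) :: real \<Rightarrow> real)" "integrable N (indicator (c j) :: real \<Rightarrow> real)"
      if "j < k" for j
      using c[OF that] by (auto simp: M.emeasure_eq_measure N.emeasure_eq_measure)
    have iM: "integrable M f" "integrable M \<phi>" "integrable M out"
    proof -
      show "integrable M f" by (rule M.integrable_const_bound[where B=1]) (use f1 in auto)
      show "integrable M \<phi>" unfolding \<phi>_def[abs_def]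
        by (rule Bochner_Integration.integrable_sum, rule Bochner_Integration.integrable_mult_right) (simp add: ind)
      show "integrable M out" unfolding out_def[abs_def]
        by (rule Bochner_Integration.integrable_diff, simp, rule Bochner_Integration.integrable_sum) (simp add: ind)
    qed
    have iN: "integrable N f" "integrable N \<phi>" "integrable N out"
    proof -
      show "integrable N f" by (rule N.integrable_const_bound[where B=1]) (use f1 in auto)
      show "integrable N \<phi>" unfolding \<phi>_def[abs_def]
        by (rule Bochner_Integration.integrable_sum, rule Bochner_Integration.integrable_mult_right) (simp add: ind)
      show "integrable N out" unfolding out_def[abs_def]
        by (rule Bochner_Integration.integrable_diff, simp, rule Bochner_Integration.integrable_sum) (simp add: ind)
    qed
    have \<phi>: "(\<integral>x. \<phi> x \<partial>M) = (\<Sum>j<k. f (p j) * measure M (c j))" "(\<integral>x. \<phi> x \<partial>N) = (\<Sum>j<k. f (p j) * measure N (c j))"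
      unfolding \<phi>_def by (subst Bochner_Integration.integral_sum; (auto simp: ind spaces intro!: sum.cong)[1])+
    have out: "(\<integral>x. out x \<partial>M) = 1 - (\<Sum>j<k. measure M (c j))" "(\<integral>x. out x \<partial>N) = 1 - (\<Sum>j<k. measure N (c j))"
    proof -
      have "(\<integral>x. out x \<partial>M) = 1 - (\<integral>x. (\<Sum>j<k. indicator (c j) x) \<partial>M)"
        unfolding out_def by (subst Bochner_Integration.integral_diff) (use ind in \<open>auto simp: M.prob_space intro!: Bochner_Integration.integrable_sum\<close>)
      then show "(\<integral>x. out x \<partial>M) = 1 - (\<Sum>j<k. measure M (c j))"
        using ind by (simp add: Bochner_Integration.integral_sum spaces)
      have "(\<integral>x. out x \<partial>N) = 1 - (\<integral>x. (\<Sum>j<k. indicator (c j) x) \<partial>N)"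
        unfolding out_def by (subst Bochner_Integration.integral_diff) (use ind in \<open>auto simp: N.prob_space intro!: Bochner_Integration.integrable_sum\<close>)
      then show "(\<integral>x. out x \<partial>N) = 1 - (\<Sum>j<k. measure N (c j))"
        using ind by (simp add: Bochner_Integration.integral_sum spaces)
    qed
    have "(\<integral>x. f x \<partial>M) \<le> (\<integral>x. \<phi> x + (\<omega> + out x) \<partial>M)"
      using iM by (intro integral_mono) (auto intro: pt1 pt2)
    also have "\<dots> = (\<integral>x. \<phi> x \<partial>M) + (\<omega> + (\<integral>x. out x \<partial>M))" using iM by (simp add: M.prob_space)
    finally have 1: "(\<integral>x. f x \<partial>M) \<le> (\<integral>x. \<phi> x \<partial>M) + (\<omega> + (\<integral>x. out x \<partial>M))" .
    have "(\<integral>x. \<phi> x - (\<omega> + out x) \<partial>N) \<le> (\<integral>x. f x \<partial>N)"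
      using iN by (intro integral_mono) (auto intro: pt1 pt2)
    moreover have "(\<integral>x. \<phi> x - (\<omega> + out x) \<partial>N) = (\<integral>x. \<phi> x \<partial>N) - (\<omega> + (\<integral>x. out x \<partial>N))" using iN by (simp add: N.prob_space)
    ultimately have 2: "(\<integral>x. \<phi> x \<partial>N) - (\<omega> + (\<integral>x. out x \<partial>N)) \<le> (\<integral>x. f x \<partial>N)" by simp
    have "(\<integral>x. \<phi> x \<partial>M) - (\<integral>x. \<phi> x \<partial>N) = (\<Sum>j<k. f (p j) * (measure M (c j) - measure N (c j)))"
      unfolding \<phi> by (simp add: sum_subtractf algebra_simps)
    also have "\<dots> \<le> ?S"
    proof (rule sum_mono)
      fix j
      have "\<bar>f (p j)\<bar> * \<bar>measure M (c j) - measure N (c j)\<bar> \<le> 1 * \<bar>measure M (c j) - measure N (c j)\<bar>"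
        using f1 by (intro mult_right_mono) auto
      then show "f (p j) * (measure M (c j) - measure N (c j)) \<le> \<bar>measure M (c j) - measure N (c j)\<bar>"
        unfolding abs_mult[symmetric] mult_1 by (rule order_trans[OF abs_ge_self])
    qed
    finally have 3: "(\<integral>x. \<phi> x \<partial>M) - (\<integral>x. \<phi> x \<partial>N) \<le> ?S" .
    have "(\<Sum>j<k. measure N (c j)) - (\<Sum>j<k. measure M (c j)) \<le> ?S"
      unfolding sum_subtractf[symmetric] by (rule sum_mono) simp
    moreover have "MF - NF \<le> 2 * S + 2 * \<omega> + 2 * (1 - SN)"
      if "MF \<le> MP + (\<omega> + (1 - SM))" "NP - (\<omega> + (1 - SN)) \<le> NF" "MP - NP \<le> S" "SN - SM \<le> S"
      for MF NF MP NP SM SN S :: real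
      using that unfolding right_diff_distrib by linarith
    ultimately show ?thesis using 1 2 3 unfolding out by blast
  qed
  \<comment> \<open>Bounding the supremum from above requires a nonempty class of test functions;
    the zero function belongs to it.\<close>
  then show ?thesis
    unfolding kr_dist_def
    by (intro cSUP_least) (auto intro!: exI[of _ "\<lambda>_. 0"])
qed

section \<open>Coordinate laws and the averaged distance\<close>

context mala_chain
begin

lemma coordinate_law:
  assumes z: "z \<in> space LP" and i: "i \<in> {1..d}"
  shows coordinate_law_prob: "prob_space (mala_coord_law d (s\<^sup>2) (prod_target h d) z n i)"
    and coordinate_law_sets: "sets (mala_coord_law d (s\<^sup>2) (prod_target h d) z n i) = sets borel"
    and coordinate_law_interval: "measure (mala_coord_law d (s\<^sup>2) (prod_target h d) z n i) {a<..b} =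
      (MP ^^ n) (\<lambda>z. indicator {a<..b} (z i)) z"
proof -
  let ?L = "mala_law d (s\<^sup>2) (prod_target h d) z n"
  interpret L: prob_space ?L using mala_law_prob[OF z] by simp
  have sets: "sets ?L = sets LP" using mala_law_prob[OF z] by simp
  have "(\<lambda>x. x i) \<in> borel_measurable LP" using i by measurable
  then have m: "(\<lambda>x. x i) \<in> borel_measurable ?L" by (simp add: measurable_cong_sets[OF sets refl])
  show "prob_space (mala_coord_law d (s\<^sup>2) (prod_target h d) z n i)"
    unfolding mala_coord_law_def by (rule L.prob_space_distr[OF m])
  show "sets (mala_coord_law d (s\<^sup>2) (prod_target h d) z n i) = sets borel"
    unfolding mala_coord_law_def by simp
  have b: "bdd_fun LP (\<lambda>z. indicator {a<..b} (z i))"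
  proof (rule bdd_funI[where B=1])
    show "(\<lambda>z. indicator {a<..b} (z i) :: real) \<in> borel_measurable LP" using i by measurable
  qed (auto simp: indicator_def)
  have "measure (mala_coord_law d (s\<^sup>2) (prod_target h d) z n i) {a<..b} =
      (\<integral>x. indicator {a<..b} x \<partial>mala_coord_law d (s\<^sup>2) (prod_target h d) z n i)"
    unfolding mala_coord_law_def by simp
  also have "\<dots> = (\<integral>x. indicator {a<..b} (x i) \<partial>?L)"
    unfolding mala_coord_law_def by (rule integral_distr[OF m]) simp
  also have "\<dots> = (MP ^^ n) (\<lambda>z. indicator {a<..b} (z i)) z"
    by (rule mala_law_integral[OF z b])
  finally show "measure (mala_coord_law d (s\<^sup>2) (prod_target h d) z n i) {a<..b} =
      (MP ^^ n) (\<lambda>z. indicator {a<..b} (z i)) z" .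
qed

text \<open>The distance is dominated pointwise by the measurable function \<open>G\<close>.
  Monotonicity of the nonnegative integral holds for arbitrary integrands, so measurability of the
  distance in z does not arise. The step from mean square to mean is Cauchy-Schwarz.\<close>

lemma averaged_kr_le:
  assumes i: "i \<in> {1..d}"
    and disj: "disjoint_family_on (\<lambda>j. {x j<..x (Suc j) :: real}) {..<k}"
    and width: "\<And>j. x (Suc j) - x j \<le> \<omega>" and \<omega>: "\<omega> \<ge> 0" and \<eta>: "\<eta> \<ge> 0"
    and decay: "\<And>j. j < k \<Longrightarrow>
      (\<integral>z. ((MP ^^ n) (\<lambda>z. indicator {x j<..x (Suc j)} (z i)) z - measure H {x j<..x (Suc j)})\<^sup>2 \<partial>HP) \<le> \<eta>\<^sup>2"
  shows "(\<integral>\<^sup>+z. ennreal (prod_target h d z) *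
      ennreal (kr_dist (mala_coord_law d (s\<^sup>2) (prod_target h d) z n i) H) \<partial>LP) \<le>
    ennreal (2 * (real k * \<eta>) + 2 * \<omega> + 2 * (1 - (\<Sum>j<k. measure H {x j<..x (Suc j)})))"
proof -
  define c where "c j = {x j<..x (Suc j)}" for j
  define C where "C = 2 * \<omega> + 2 * (1 - (\<Sum>j<k. measure H (c j)))"
  define A where "A j z = (MP ^^ n) (\<lambda>z. indicator (c j) (z i)) z - measure H (c j)" for j z
  define G where "G z = 2 * (\<Sum>j<k. \<bar>A j z\<bar>) + C" for z
  have bI: "bdd_fun HP (\<lambda>z. indicator (c j) (z i))" for j
    unfolding bdd_fun_HP
  proof (rule bdd_funI[where B=1])
    show "(\<lambda>z. indicator (c j) (z i) :: real) \<in> borel_measurable LP" unfolding c_def using i by measurable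
  qed (auto simp: indicator_def)
  have bA: "bdd_fun HP (A j)" for j
    unfolding A_def[abs_def] by (intro bdd_fun_diff MP.bdd_pow bI bdd_fun_const)
  have mA [measurable]: "A j \<in> borel_measurable LP" for j
    using bA[of j] unfolding bdd_fun_HP by (rule bdd_fun_measurable)
  have mG [measurable]: "G \<in> borel_measurable LP" unfolding G_def[abs_def] by measurable
  have iA: "integrable HP (\<lambda>z. \<bar>A j z\<bar>)" for j using HP.bdd_fun_integrable[OF bA[of j]] by simp
  have iG: "integrable HP G" unfolding G_def[abs_def] using iA by simp
  have sum1: "(\<Sum>j<k. measure H (c j)) \<le> 1"
  proof -
    have "(\<Sum>j<k. measure H (c j)) = measure H (\<Union>j<k. c j)"
      using disj by (intro H.finite_measure_finite_Union[symmetric]) (auto simp: c_def[abs_def])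
    then show ?thesis by simp
  qed
  have C0: "C \<ge> 0" unfolding C_def using sum1 \<omega> by simp
  have G0: "G z \<ge> 0" for z unfolding G_def using C0 by (intro add_nonneg_nonneg mult_nonneg_nonneg sum_nonneg) auto
  have kr: "kr_dist (mala_coord_law d (s\<^sup>2) (prod_target h d) z n i) H \<le> G z" if z: "z \<in> space LP" for z
  proof -
    have "kr_dist (mala_coord_law d (s\<^sup>2) (prod_target h d) z n i) H \<le>
      2 * (\<Sum>j<k. \<bar>measure (mala_coord_law d (s\<^sup>2) (prod_target h d) z n i) (c j) - measure H (c j)\<bar>)
        + 2 * \<omega> + 2 * (1 - (\<Sum>j<k. measure H (c j)))"
    proof (rule kr_dist_le_cells[where p="\<lambda>j. x (Suc j)"])
      show "\<bar>y - x (Suc j)\<bar> \<le> \<omega>" if "y \<in> c j" for j y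
        using that width[of j] by (auto simp: c_def)
      show "disjoint_family_on c {..<k}" using disj by (simp add: c_def[abs_def])
    qed (auto simp: c_def coordinate_law_prob[OF z i] coordinate_law_sets[OF z i] H.prob_space_axioms \<omega>)
    also have "\<dots> = G z"
      unfolding G_def C_def A_def c_def coordinate_law_interval[OF z i] by simp
    finally show ?thesis .
  qed
  have "(\<integral>\<^sup>+z. ennreal (prod_target h d z) *
      ennreal (kr_dist (mala_coord_law d (s\<^sup>2) (prod_target h d) z n i) H) \<partial>LP) \<le>
    (\<integral>\<^sup>+z. ennreal (prod_target h d z) * ennreal (G z) \<partial>LP)"
    by (intro nn_integral_mono mult_left_mono ennreal_leI kr) auto
  also have "\<dots> = (\<integral>\<^sup>+z. ennreal (G z) \<partial>HP)"
    unfolding target_eq[symmetric] by (rule nn_integral_density[symmetric]) measurable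
  also have "\<dots> = ennreal (\<integral>z. G z \<partial>HP)"
    by (rule nn_integral_eq_integral[OF iG]) (simp add: G0)
  also have "\<dots> \<le> ennreal (2 * (real k * \<eta>) + C)"
  proof (rule ennreal_leI)
    have A1: "(\<integral>z. \<bar>A j z\<bar> \<partial>HP) \<le> \<eta>" if "j < k" for j
    proof (rule power2_le_imp_le[OF _ \<eta>])
      have "(\<integral>z. \<bar>A j z\<bar> \<partial>HP)\<^sup>2 \<le> (\<integral>z. \<bar>A j z\<bar>\<^sup>2 \<partial>HP)"
        by (rule HP.square_integral_le) (use HP.bdd_fun_integrable[OF bdd_fun_power2[OF bA[of j]]] iA[of j] in auto)
      also have "\<dots> \<le> \<eta>\<^sup>2" using decay[OF that] by (simp add: A_def c_def)
      finally show "(\<integral>z. \<bar>A j z\<bar> \<partial>HP)\<^sup>2 \<le> \<eta>\<^sup>2" .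
    qed
    have "(\<integral>z. G z \<partial>HP) = 2 * (\<Sum>j<k. \<integral>z. \<bar>A j z\<bar> \<partial>HP) + C"
      unfolding G_def using iA by (simp add: HP.prob_space del: space_HP)
    also have "(\<Sum>j<k. \<integral>z. \<bar>A j z\<bar> \<partial>HP) \<le> (\<Sum>j<k. \<eta>)"
      by (rule sum_mono) (use A1 in auto)
    finally show "(\<integral>z. G z \<partial>HP) \<le> 2 * (real k * \<eta>) + C" by simp
  qed
  finally show ?thesis by (simp add: C_def c_def add.assoc)
qed

end

section \<open>Partition of the line and the choice of constants\<close>

context langevin_density
begin

lemma interval_partition_measure:
  assumes "\<And>j. x j \<le> x (Suc j)"
  shows "(\<Sum>j<k. measure H {x j<..x (Suc j)}) = measure H {x 0<..x k}"
proof (induction k)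
  case (Suc k)
  have "x 0 \<le> x k" using lift_Suc_mono_le[of x 0 k] assms by simp
  then have "{x 0<..x (Suc k)} = {x 0<..x k} \<union> {x k<..x (Suc k)}"
    using assms[of k] by auto
  then have "measure H {x 0<..x (Suc k)} = measure H {x 0<..x k} + measure H {x k<..x (Suc k)}"
    by (simp add: H.finite_measure_Union)
  then show ?case using Suc by simp
qed simp

lemma tight_H:
  assumes "\<epsilon> > 0"
  obtains R where "R > 0" "1 - measure H {- R<..R} < \<epsilon>"
proof -
  have "(\<lambda>n. measure H {- real n<..real n}) \<longlonglongrightarrow> measure H (\<Union>n. {- real n<..real n})"
    by (intro H.finite_Lim_measure_incseq) (auto simp: incseq_def)
  also have "(\<Union>n. {- real n<..real n}) = (UNIV :: real set)"
  proof (intro equalityI subsetI)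
    fix x :: real
    obtain n where "\<bar>x\<bar> < real n" using reals_Archimedean2 by blast
    then show "x \<in> (\<Union>n. {- real n<..real n})" by (intro UN_I[of n]) auto
  qed simp
  finally have "(\<lambda>n. measure H {- real n<..real n}) \<longlonglongrightarrow> 1" by simp
  then have "eventually (\<lambda>n. measure H {- real n<..real n} > 1 - \<epsilon>) sequentially"
    by (rule order_tendstoD(1)) (use assms in simp)
  moreover have "eventually (\<lambda>n. n > (0::nat)) sequentially" by (rule eventually_gt_at_top)
  ultimately have "eventually (\<lambda>n. measure H {- real n<..real n} > 1 - \<epsilon> \<and> n > 0) sequentially"
    by eventually_elim auto
  then obtain n where n: "measure H {- real n<..real n} > 1 - \<epsilon>" "n > 0"
    using eventually_happens'[OF sequentially_bot] by blast
  show thesis by (rule that[of "real n"]) (use n in auto)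
qed

text \<open>Each of the three terms in \<open>averaged_kr_le\<close> gets at most \<epsilon> / 4:
  mass differences, cell width, and mass outside (-R, R]. The number of cells depends only on h and
  \<epsilon>, so finitely many uses of \<open>interval_decay\<close> suffice.\<close>

lemma averaged_kr_convergence:
  assumes l: "l > 0" and \<epsilon>: "\<epsilon> > 0"
  shows "\<exists>(D::nat) (t::real). 0 \<le> t \<and> (\<forall>d n. d \<ge> 1 \<and> d \<ge> D \<and> real n \<ge> real d powr (1 / 3) * t \<longrightarrow>
    (\<forall>i\<in>{1..d}. mala_avg_kr h l d n i < ennreal \<epsilon>))"
proof -
  obtain R where R: "R > 0" "1 - measure H {- R<..R} < \<epsilon> / 8"
    using tight_H[of "\<epsilon> / 8"] \<epsilon> by auto
  \<comment> \<open>This makes the cell width 2 R / k less than \<epsilon> / 8.\<close>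
  obtain k :: nat where k: "16 * R / \<epsilon> < real k" using reals_Archimedean2 by blast
  have k0: "k > 0"
  proof -
    have "0 < 16 * R / \<epsilon>" using R \<epsilon> by simp
    then show ?thesis using k by (cases k) auto
  qed
  define \<omega> where "\<omega> = 2 * R / real k"
  have \<omega>: "0 \<le> \<omega>" "\<omega> \<le> \<epsilon> / 8" using R k k0 \<epsilon> by (auto simp: \<omega>_def field_simps)
  define x where "x j = - R + real j * \<omega>" for j
  have x: "x j \<le> x (Suc j)" "x (Suc j) - x j \<le> \<omega>" for j using \<omega> by (auto simp: x_def algebra_simps)
  have x0: "x 0 = - R" and xk: "x k = R" using k0 by (auto simp: x_def \<omega>_def)
  have mono: "i \<le> j \<Longrightarrow> x i \<le> x j" for i j using lift_Suc_mono_le[of x i j] x(1) by blast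
  have disj: "disjoint_family_on (\<lambda>j. {x j<..x (Suc j)}) {..<k}"
  proof (unfold disjoint_family_on_def, intro ballI impI)
    fix i j :: nat assume "i \<noteq> j"
    then consider "Suc i \<le> j" | "Suc j \<le> i" by linarith
    then show "{x i<..x (Suc i)} \<inter> {x j<..x (Suc j)} = {}"
    proof cases
      case 1
      then show ?thesis using mono[OF 1] by auto
    next
      case 2
      then show ?thesis using mono[OF 2] by auto
    qed
  qed
  define \<eta> where "\<eta> = \<epsilon> / (8 * real k)"
  have \<eta>: "\<eta> > 0" "real k * \<eta> = \<epsilon> / 8" using \<epsilon> k0 by (auto simp: \<eta>_def)
  define P where "P j D t \<longleftrightarrow> t > 0 \<and> (\<forall>d n i. d \<ge> D \<longrightarrow> d \<ge> 1 \<longrightarrow> real n \<ge> real d powr (1 / 3) * t \<longrightarrow> i \<in> {1..d} \<longrightarrow>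
      (\<integral>z. ((mala_chain.MP h d (l * real d powr (- (1 / 6))) ^^ n) (\<lambda>z. indicator {x j<..x (Suc j)} (z i)) z - measure H {x j<..x (Suc j)})\<^sup>2
        \<partial>mala_chain.HP h d) \<le> \<eta>\<^sup>2)" for j and D :: nat and t :: real
  have "\<exists>D t. P j D t" for j
  proof -
    have "\<eta>\<^sup>2 > 0" using \<eta> by simp
    then show ?thesis
    proof (rule interval_decay[OF l, of _ "x j" "x (Suc j)"], goal_cases)
      case (1 D t)
      then have "P j D t" unfolding P_def by blast
      then show ?case by blast
    qed
  qed
  then obtain Df tf where P: "\<And>j. P j (Df j) (tf j)" by metis
  have Df: "tf j > 0"
    "\<forall>d n i. d \<ge> Df j \<longrightarrow> d \<ge> 1 \<longrightarrow> real n \<ge> real d powr (1 / 3) * tf j \<longrightarrow> i \<in> {1..d} \<longrightarrow>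
      (\<integral>z. ((mala_chain.MP h d (l * real d powr (- (1 / 6))) ^^ n) (\<lambda>z. indicator {x j<..x (Suc j)} (z i)) z - measure H {x j<..x (Suc j)})\<^sup>2
        \<partial>mala_chain.HP h d) \<le> \<eta>\<^sup>2" for j
    using P[of j] unfolding P_def by blast+
  \<comment> \<open>Sums of nonnegative terms serve as common upper bounds for the finitely many
    thresholds.\<close>
  define D where "D = (\<Sum>j<k. Df j)"
  define t where "t = (\<Sum>j<k. tf j)"
  show ?thesis
  proof (intro exI[of _ D] exI[of _ t] conjI allI impI ballI)
    show "0 \<le> t" unfolding t_def using Df(1) by (intro sum_nonneg) (auto intro: less_imp_le)
    fix d n i assume a: "1 \<le> d \<and> D \<le> d \<and> real d powr (1 / 3) * t \<le> real n" and i: "i \<in> {1..d}"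
    define s where "s = l * real d powr (- (1 / 6))"
    interpret mala_chain h d s
      by unfold_locales (use l a in \<open>simp add: s_def\<close>)
    have s2: "l\<^sup>2 * real d powr (- (1 / 3)) = s\<^sup>2"
      using a by (simp add: s_def power_mult_distrib powr_power)
    have decay: "(\<integral>z. ((MP ^^ n) (\<lambda>z. indicator {x j<..x (Suc j)} (z i)) z - measure H {x j<..x (Suc j)})\<^sup>2 \<partial>HP) \<le> \<eta>\<^sup>2"
      if j: "j < k" for j
    proof -
      have D: "Df j \<le> D" unfolding D_def using j by (intro member_le_sum) auto
      have "tf j \<le> t" unfolding t_def using j Df(1) by (intro member_le_sum) (auto intro: less_imp_le)
      then have "real d powr (1 / 3) * tf j \<le> real d powr (1 / 3) * t" by (intro mult_left_mono) auto
      with a have n: "real d powr (1 / 3) * tf j \<le> real n" by linarith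
      show ?thesis unfolding s_def by (rule Df(2)[rule_format]) (use a D n i in auto)
    qed
    have "mala_avg_kr h l d n i \<le> ennreal (2 * (real k * \<eta>) + 2 * \<omega> + 2 * (1 - (\<Sum>j<k. measure H {x j<..x (Suc j)})))"
      unfolding mala_avg_kr_def s2 H_def[symmetric]
      by (rule averaged_kr_le[OF i disj x(2) \<omega>(1) less_imp_le[OF \<eta>(1)] decay])
    also have "\<dots> < ennreal \<epsilon>"
    proof (rule ennreal_lessI[OF \<epsilon>])
      have "(\<Sum>j<k. measure H {x j<..x (Suc j)}) = measure H {- R<..R}"
        using interval_partition_measure[of x, OF x(1), of k] by (simp add: x0 xk)
      then show "2 * (real k * \<eta>) + 2 * \<omega> + 2 * (1 - (\<Sum>j<k. measure H {x j<..x (Suc j)})) < \<epsilon>"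
        using \<eta>(2) \<omega>(2) R(2) \<epsilon> unfolding right_diff_distrib by linarith
    qed
    finally show "mala_avg_kr h l d n i < ennreal \<epsilon>" .
  qed
qed

end

theorem theorem3:
  fixes h :: "real \<Rightarrow> real" and l :: real
  assumes h_pos: "\<And>x. 0 < h x"
    and h_density: "has_bochner_integral lborel h 1"
    and h_smooth: "\<And>k. (deriv ^^ k) h differentiable_on UNIV"
    and log_h_derivs: "\<And>k::nat. k \<ge> 1 \<Longrightarrow>
          \<exists>P :: real poly. \<forall>x. \<bar>(deriv ^^ k) (\<lambda>u. ln (h u)) x\<bar> \<le> poly P x"
    and h_moments: "\<And>k::nat. integrable lborel (\<lambda>x. \<bar>x\<bar> ^ k * h x)"
    and h_score_lipschitz: "\<exists>L. L-lipschitz_on UNIV (\<lambda>x. deriv h x / h x)"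
    and l_pos: "0 < l"
  shows
    "(\<forall>\<epsilon>::real. \<epsilon> > 0 \<longrightarrow>
        (\<exists>(D::nat) (T::real). 0 \<le> T \<and>
          (\<forall>(t::real) (d::nat). t \<ge> T \<and> d \<ge> 1 \<and> d \<ge> D \<longrightarrow>
             mala_avg_kr h l d (nat \<lfloor>real d powr (1/3) * t\<rfloor>) 1 < ennreal \<epsilon>))) \<and>
     (\<forall>\<epsilon>::real. \<epsilon> > 0 \<longrightarrow>
        (\<exists>(D::nat) (T::real). 0 \<le> T \<and>
          (\<forall>(d::nat) (n::nat). d \<ge> 1 \<and> d \<ge> D \<and> real n \<ge> real d powr (1/3) * T \<longrightarrow>
             (\<forall>i\<in>{1..d}. mala_avg_kr h l d n i < ennreal \<epsilon>))))"
proof -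
  interpret langevin_density h by (rule langevin_density.intro; fact)
  note main = averaged_kr_convergence[OF l_pos]
  have "\<exists>(D::nat) (T::real). 0 \<le> T \<and>
          (\<forall>(t::real) (d::nat). t \<ge> T \<and> d \<ge> 1 \<and> d \<ge> D \<longrightarrow>
             mala_avg_kr h l d (nat \<lfloor>real d powr (1/3) * t\<rfloor>) 1 < ennreal \<epsilon>)" if \<epsilon>: "\<epsilon> > 0" for \<epsilon>
  proof -
    obtain D :: nat and T :: real where T: "0 \<le> T" and
      D: "\<And>d n i. d \<ge> 1 \<Longrightarrow> d \<ge> D \<Longrightarrow> real n \<ge> real d powr (1/3) * T \<Longrightarrow> i \<in> {1..d} \<Longrightarrow> mala_avg_kr h l d n i < ennreal \<epsilon>"
      using main[OF \<epsilon>] by blast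
    show ?thesis
    \<comment> \<open>The extra 1 pays for the floor: d^(1/3) \<ge> 1, so passing from T to T + 1
      gains at least one full step.\<close>
    proof (intro exI[of _ D] exI[of _ "T + 1"] conjI allI impI)
      show "0 \<le> T + 1" using T by simp
      fix t :: real and d :: nat assume a: "T + 1 \<le> t \<and> 1 \<le> d \<and> D \<le> d"
      let ?c = "real d powr (1/3)"
      have c: "?c \<ge> 1" using a by (intro ge_one_powr_ge_zero) auto
      have "?c * T + 1 \<le> ?c * (T + 1)" using c by (simp add: algebra_simps)
      also have "\<dots> \<le> ?c * t" using a c by (intro mult_left_mono) auto
      finally have "?c * T \<le> real (nat \<lfloor>?c * t\<rfloor>)" by linarith
      then show "mala_avg_kr h l d (nat \<lfloor>?c * t\<rfloor>) 1 < ennreal \<epsilon>"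
        using a by (intro D) auto
    qed
  qed
  then show ?thesis using main by blast
qed

end
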